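(* Let $q>d$. Then $$0\in\operatorname{int}\big\{G(\operatorname{dom}(\mathcal{J}_q))-\mathcal{K}\big\},$$ where the interior is taken in $Y:=(W^{1,q'}_\diamond(\Omega))^*\times\mathbb{R}\times C(\overline\Omega)$.
   Context: $\Omega\subset\mathbb{R}^d$ ($d\ge2$) is a non-empty, bounded, connected open set with smooth boundary satisfying a uniform interior ball condition, with Lebesgue measure $|\Omega|>1$. $q':=q/(q-1)$. $f:\overline\Omega\times\mathbb{R}\to\mathbb{R}$ is continuous and non-decreasing in its second variable, $F(x,m):=\int_0^m f(x,s)\,ds$, and $\mathcal{F}(m):=\int_\Omega F(x,m(x))\,dx$ for $m\in W^{1,q}(\Omega)$. $\mathcal{L}_q:W^{1,q}(\Omega)\times L^q(\Omega)^d\to\mathbb{R}\cup\{+\infty\}$ is $\mathcal{L}_q(m,w):=\int_\Omega\ell_q(m(x),w(x))\,dx$, where for $(a,b)\in\mathbb{R}\times\mathbb{R}^d$: $\ell_q(a,b):=\frac1q\frac{|b|^q}{a^{q-1}}$ if $a>0$, $\ell_q(0,0):=0$, and $\ell_q(a,b):=+\infty$ otherwise. $\mathcal{J}_q(m,w):=\mathcal{L}_q(m,w)+\mathcal{F}(m)$ and $\operatorname{dom}(\mathcal{J}_q):=\{(m,w)\in W^{1,q}(\Omega)\times L^q(\Omega)^d:\mathcal{J}_q(m,w)<\infty\}$. $W^{1,q'}_\diamond(\Omega):=\{u\in W^{1,q'}(\Omega):\int_\Omega u\,dx=0\}$. The bounded linear operators $A:W^{1,q}(\Omega)\to(W^{1,q'}_\diamond(\Omega))^*$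 and $B:L^q(\Omega)^d\to(W^{1,q'}_\diamond(\Omega))^*$ are $\langle Am,\phi\rangle:=\int_\Omega\nabla m\cdot\nabla\phi\,dx$ and $\langle Bw,\phi\rangle:=-\int_\Omega w\cdot\nabla\phi\,dx$. $I:W^{1,q}(\Omega)\to C(\overline\Omega)$ is the Sobolev injection (well defined since $q>d$). $\mathcal{C}:=\{z\in C(\overline\Omega):z\le1\}$, $\mathcal{K}:=\{0\}\times\{0\}\times\mathcal{C}\subseteq Y$, and $G:W^{1,q}(\Omega)\times L^q(\Omega)^d\to Y$ is $$G(m,w):=\Big(Am+Bw,\ \int_\Omega m(x)\,dx-1,\ Im\Big).$$ *)

theory Defs
  imports "HOL-Analysis.Analysis"
begin

section \<open>Smooth functions and domains\<close>

primrec higher_differentiable_on ::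
  "'a::euclidean_space set \<Rightarrow> ('a \<Rightarrow> real) \<Rightarrow> nat \<Rightarrow> bool" where
  "higher_differentiable_on S f 0 \<longleftrightarrow> continuous_on S f"
| "higher_differentiable_on S f (Suc k) \<longleftrightarrow>
     (\<forall>x\<in>S. f differentiable (at x)) \<and>
     (\<forall>v. higher_differentiable_on S (\<lambda>x. frechet_derivative f (at x) v) k)"

definition smooth_on :: "'a::euclidean_space set \<Rightarrow> ('a \<Rightarrow> real) \<Rightarrow> bool" where
  "smooth_on S f \<longleftrightarrow> (\<forall>k. higher_differentiable_on S f k)"

text \<open>Near every boundary point, \<open>\<Omega>\<close> is the region strictly above the graph of a smooth function,
  the vertical direction being a unit vector \<open>e\<close>. The function \<open>\<gamma>\<close> matters only on the hyperplane
  orthogonal to \<open>e\<close>: it is evaluated at the projection of \<open>x\<close> to that hyperplane.\<close>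

definition smooth_boundary :: "'a::euclidean_space set \<Rightarrow> bool" where
  "smooth_boundary \<Omega> \<longleftrightarrow>
     (\<forall>p\<in>frontier \<Omega>. \<exists>r>0. \<exists>e \<gamma>. norm e = 1 \<and> smooth_on UNIV \<gamma> \<and>
        \<Omega> \<inter> ball p r = {x \<in> ball p r. \<gamma> (x - (x \<bullet> e) *\<^sub>R e) < x \<bullet> e})"

definition uniform_interior_ball :: "'a::euclidean_space set \<Rightarrow> bool" where
  "uniform_interior_ball \<Omega> \<longleftrightarrow>
     (\<exists>r>0. \<forall>p\<in>frontier \<Omega>. \<exists>c. ball c r \<subseteq> \<Omega> \<and> p \<in> sphere c r)"

section \<open>Lebesgue and Sobolev spaces\<close>

text \<open>Elements of \<open>L\<^sup>p(\<Omega>)\<close> and \<open>W\<^sup>1\<^sup>,\<^sup>p(\<Omega>)\<close> are represented by functions on the whole space; only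
  their values almost everywhere on \<open>\<Omega>\<close> matter, and all notions below are insensitive to the choice
  of the representative. The space \<open>L\<^sup>p(\<Omega>)\<^sup>d\<close> is \<open>lp_space p \<Omega>\<close> at the type of vector fields.\<close>

definition lp_space :: "real \<Rightarrow> 'a::euclidean_space set \<Rightarrow> ('a \<Rightarrow> 'b::euclidean_space) set" where
  "lp_space p \<Omega> = {u \<in> borel_measurable (lebesgue_on \<Omega>).
     integrable (lebesgue_on \<Omega>) (\<lambda>x. norm (u x) powr p)}"

definition locally_integrable ::
  "'a::euclidean_space set \<Rightarrow> ('a \<Rightarrow> 'b::euclidean_space) \<Rightarrow> bool" where
  "locally_integrable \<Omega> u \<longleftrightarrow> (\<forall>K. compact K \<and> K \<subseteq> \<Omega> \<longrightarrow> set_integrable lebesgue K u)"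

text \<open>\<open>C\<^sub>c\<^sup>\<infinity>(\<Omega>)\<close>, its elements being extended by zero to the whole space.\<close>

definition test_functions :: "'a::euclidean_space set \<Rightarrow> ('a \<Rightarrow> real) set" where
  "test_functions \<Omega> =
     {\<phi>. smooth_on UNIV \<phi> \<and> (\<exists>K. compact K \<and> K \<subseteq> \<Omega> \<and> (\<forall>x. x \<notin> K \<longrightarrow> \<phi> x = 0))}"

definition weak_gradient ::
  "'a::euclidean_space set \<Rightarrow> ('a \<Rightarrow> real) \<Rightarrow> ('a \<Rightarrow> 'a) \<Rightarrow> bool" where
  "weak_gradient \<Omega> u g \<longleftrightarrow> locally_integrable \<Omega> u \<and> locally_integrable \<Omega> g \<and>
     (\<forall>\<phi>\<in>test_functions \<Omega>. \<forall>i\<in>Basis.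
        (LINT x|lebesgue_on \<Omega>. u x * frechet_derivative \<phi> (at x) i) =
        - (LINT x|lebesgue_on \<Omega>. (g x \<bullet> i) * \<phi> x))"

text \<open>A weak gradient is determined up to a null set; some version of it is chosen.\<close>

definition wgrad :: "'a::euclidean_space set \<Rightarrow> ('a \<Rightarrow> real) \<Rightarrow> 'a \<Rightarrow> 'a" where
  "wgrad \<Omega> u = (SOME g. weak_gradient \<Omega> u g)"

definition sobolev_space :: "real \<Rightarrow> 'a::euclidean_space set \<Rightarrow> ('a \<Rightarrow> real) set" where
  "sobolev_space p \<Omega> = {u \<in> lp_space p \<Omega>. \<exists>g\<in>lp_space p \<Omega>. weak_gradient \<Omega> u g}"

definition sobolev_norm :: "real \<Rightarrow> 'a::euclidean_space set \<Rightarrow> ('a \<Rightarrow> real) \<Rightarrow> real" where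
  "sobolev_norm p \<Omega> u =
     ((LINT x|lebesgue_on \<Omega>. \<bar>u x\<bar> powr p) +
      (LINT x|lebesgue_on \<Omega>. norm (wgrad \<Omega> u x) powr p)) powr (1 / p)"

definition sobolev_mean_zero :: "real \<Rightarrow> 'a::euclidean_space set \<Rightarrow> ('a \<Rightarrow> real) set" where
  "sobolev_mean_zero p \<Omega> = {u \<in> sobolev_space p \<Omega>. (LINT x|lebesgue_on \<Omega>. u x) = 0}"

section \<open>Dual spaces\<close>

text \<open>The dual of a space \<open>V\<close> of functions with (semi)norm \<open>N\<close>. Functionals are fixed to be
  \<open>undefined\<close> outside \<open>V\<close>, so that equality is equality on \<open>V\<close>. By the bound, a functional takes the
  same value on any two functions at distance zero; hence, for Sobolev spaces, it is a functional on
  the classes modulo equality almost everywhere.\<close>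

definition dual_space :: "('a \<Rightarrow> real) set \<Rightarrow> (('a \<Rightarrow> real) \<Rightarrow> real) \<Rightarrow> (('a \<Rightarrow> real) \<Rightarrow> real) set" where
  "dual_space V N = {T \<in> extensional V.
     (\<forall>u\<in>V. \<forall>v\<in>V. \<forall>a b. T (\<lambda>x. a * u x + b * v x) = a * T u + b * T v) \<and>
     (\<exists>C. \<forall>u\<in>V. \<bar>T u\<bar> \<le> C * N u)}"

definition dual_norm ::
  "('a \<Rightarrow> real) set \<Rightarrow> (('a \<Rightarrow> real) \<Rightarrow> real) \<Rightarrow> (('a \<Rightarrow> real) \<Rightarrow> real) \<Rightarrow> real" where
  "dual_norm V N T = Inf {C. 0 \<le> C \<and> (\<forall>u\<in>V. \<bar>T u\<bar> \<le> C * N u)}"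

text \<open>The value outside the dual space is irrelevant; it makes the distance total.\<close>

definition dual_dist ::
  "('a \<Rightarrow> real) set \<Rightarrow> (('a \<Rightarrow> real) \<Rightarrow> real) \<Rightarrow>
   (('a \<Rightarrow> real) \<Rightarrow> real) \<Rightarrow> (('a \<Rightarrow> real) \<Rightarrow> real) \<Rightarrow> real" where
  "dual_dist V N S T =
     (if S \<in> dual_space V N \<and> T \<in> dual_space V N then dual_norm V N (\<lambda>u. S u - T u) else 0)"

definition dual_metric ::
  "('a \<Rightarrow> real) set \<Rightarrow> (('a \<Rightarrow> real) \<Rightarrow> real) \<Rightarrow> (('a \<Rightarrow> real) \<Rightarrow> real) metric" where
  "dual_metric V N = metric (dual_space V N, dual_dist V N)"

lemma dual_dist_le:
  assumes "S \<in> dual_space V N" "T \<in> dual_space V N"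
    and "0 \<le> C" "\<And>u. u \<in> V \<Longrightarrow> \<bar>S u - T u\<bar> \<le> C * N u"
  shows "dual_dist V N S T \<le> C"
  using assms unfolding dual_dist_def dual_norm_def
  by (auto intro!: cInf_lower bdd_belowI[where m = 0])

lemma
  assumes N: "\<And>u. 0 \<le> N u"
  shows dual_dist_nonneg: "0 \<le> dual_dist V N S T"
    and dual_dist_bound:
      "\<lbrakk>S \<in> dual_space V N; T \<in> dual_space V N; u \<in> V\<rbrakk> \<Longrightarrow> \<bar>S u - T u\<bar> \<le> dual_dist V N S T * N u"
proof -
  let ?A = "{C. 0 \<le> C \<and> (\<forall>u\<in>V. \<bar>S u - T u\<bar> \<le> C * N u)}"
  have ne: "\<exists>C. C \<in> ?A" if S: "S \<in> dual_space V N" and T: "T \<in> dual_space V N"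
  proof -
    obtain C D where C: "\<And>u. u \<in> V \<Longrightarrow> \<bar>S u\<bar> \<le> C * N u" and D: "\<And>u. u \<in> V \<Longrightarrow> \<bar>T u\<bar> \<le> D * N u"
      using S T unfolding dual_space_def by blast
    have "\<bar>S u - T u\<bar> \<le> (\<bar>C\<bar> + \<bar>D\<bar>) * N u" if "u \<in> V" for u
    proof -
      have "\<bar>S u - T u\<bar> \<le> C * N u + D * N u" using C[OF that] D[OF that] by linarith
      also have "\<dots> \<le> \<bar>C\<bar> * N u + \<bar>D\<bar> * N u" by (intro add_mono mult_right_mono N) auto
      finally show ?thesis by (simp add: distrib_right)
    qed
    then show ?thesis by (intro exI[of _ "\<bar>C\<bar> + \<bar>D\<bar>"]) auto
  qed
  show "0 \<le> dual_dist V N S T"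
    unfolding dual_dist_def dual_norm_def using ne by (auto intro!: cInf_greatest)
  assume S: "S \<in> dual_space V N" and T: "T \<in> dual_space V N" and u: "u \<in> V"
  obtain C where C: "C \<in> ?A" using ne[OF S T] by blast
  show "\<bar>S u - T u\<bar> \<le> dual_dist V N S T * N u"
  proof (cases "N u = 0")
    case True
    then show ?thesis using C u by auto
  next
    case False
    then have pos: "0 < N u" using N[of u] by simp
    have "\<bar>S u - T u\<bar> / N u \<le> Inf ?A"
      by (rule cInf_greatest) (use C u pos in \<open>auto simp: divide_le_eq\<close>)
    then show ?thesis using pos S T by (simp add: divide_le_eq dual_dist_def dual_norm_def)
  qed
qed

lemma Metric_space_dual:
  assumes N: "\<And>u. 0 \<le> N u"
  shows "Metric_space (dual_space V N) (dual_dist V N)"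
proof
  fix S T R
  show "0 \<le> dual_dist V N S T" by (rule dual_dist_nonneg[OF N])
  show "dual_dist V N S T = dual_dist V N T S"
    by (simp add: dual_dist_def dual_norm_def abs_minus_commute)
  assume S: "S \<in> dual_space V N" and T: "T \<in> dual_space V N"
  show "dual_dist V N S T = 0 \<longleftrightarrow> S = T"
  proof
    assume "dual_dist V N S T = 0"
    then have "S u = T u" if "u \<in> V" for u
      using dual_dist_bound[where N = N, OF N S T that] by simp
    then show "S = T" using S T unfolding dual_space_def by (auto intro: extensionalityI)
  next
    assume "S = T"
    then have "dual_dist V N S T \<le> 0" using S T by (intro dual_dist_le) auto
    then show "dual_dist V N S T = 0" using dual_dist_nonneg[where N = N and V = V and S = S and T = T, OF N] by simp
  qed
  assume R: "R \<in> dual_space V N"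
  show "dual_dist V N S R \<le> dual_dist V N S T + dual_dist V N T R"
  proof (rule dual_dist_le[OF S R])
    show "0 \<le> dual_dist V N S T + dual_dist V N T R" by (simp add: dual_dist_nonneg[OF N])
    fix u assume u: "u \<in> V"
    show "\<bar>S u - R u\<bar> \<le> (dual_dist V N S T + dual_dist V N T R) * N u"
      using dual_dist_bound[where N = N, OF N S T u] dual_dist_bound[where N = N, OF N T R u]
      by (simp add: distrib_right)
  qed
qed

lemma
  assumes "\<And>u. 0 \<le> N u"
  shows mspace_dual_metric: "mspace (dual_metric V N) = dual_space V N"
    and mdist_dual_metric: "mdist (dual_metric V N) = dual_dist V N"
  unfolding dual_metric_def
  by (simp_all add: Metric_space.mspace_metric Metric_space.mdist_metric Metric_space_dual assms)

section \<open>The functional\<close>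

definition ell :: "real \<Rightarrow> real \<Rightarrow> 'a::euclidean_space \<Rightarrow> ennreal" where
  "ell q a b =
     (if a > 0 then ennreal (1 / q * (norm b powr q / a powr (q - 1)))
      else if a = 0 \<and> b = 0 then 0 else \<infinity>)"

definition kinetic_energy ::
  "real \<Rightarrow> 'a::euclidean_space set \<Rightarrow> ('a \<Rightarrow> real) \<Rightarrow> ('a \<Rightarrow> 'a) \<Rightarrow> ereal" where
  "kinetic_energy q \<Omega> m w = enn2ereal (\<integral>\<^sup>+x. ell q (m x) (w x) \<partial>lebesgue_on \<Omega>)"

definition antiderivative :: "('a \<Rightarrow> real \<Rightarrow> real) \<Rightarrow> 'a \<Rightarrow> real \<Rightarrow> real" where
  "antiderivative f x t = (LBINT s=ereal 0..ereal t. f x s)"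

definition coupling_energy ::
  "('a \<Rightarrow> real \<Rightarrow> real) \<Rightarrow> 'a::euclidean_space set \<Rightarrow> ('a \<Rightarrow> real) \<Rightarrow> real" where
  "coupling_energy f \<Omega> m = (LINT x|lebesgue_on \<Omega>. antiderivative f x (m x))"

definition total_energy ::
  "real \<Rightarrow> ('a \<Rightarrow> real \<Rightarrow> real) \<Rightarrow> 'a::euclidean_space set \<Rightarrow>
   ('a \<Rightarrow> real) \<Rightarrow> ('a \<Rightarrow> 'a) \<Rightarrow> ereal" where
  "total_energy q f \<Omega> m w = kinetic_energy q \<Omega> m w + ereal (coupling_energy f \<Omega> m)"

definition energy_domain ::
  "real \<Rightarrow> ('a \<Rightarrow> real \<Rightarrow> real) \<Rightarrow> 'a::euclidean_space set \<Rightarrow>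
   (('a \<Rightarrow> real) \<times> ('a \<Rightarrow> 'a)) set" where
  "energy_domain q f \<Omega> =
     {(m, w). m \<in> sobolev_space q \<Omega> \<and> w \<in> lp_space q \<Omega> \<and> total_energy q f \<Omega> m w < \<infinity>}"

section \<open>The constraint operator\<close>

definition conj_exp :: "real \<Rightarrow> real" where
  "conj_exp q = q / (q - 1)"

abbreviation test_space :: "real \<Rightarrow> 'a::euclidean_space set \<Rightarrow> ('a \<Rightarrow> real) set" where
  "test_space q \<Omega> \<equiv> sobolev_mean_zero (conj_exp q) \<Omega>"

definition op_A ::
  "real \<Rightarrow> 'a::euclidean_space set \<Rightarrow> ('a \<Rightarrow> real) \<Rightarrow> ('a \<Rightarrow> real) \<Rightarrow> real" where
  "op_A q \<Omega> m = (\<lambda>\<phi>\<in>test_space q \<Omega>. LINT x|lebesgue_on \<Omega>. wgrad \<Omega> m x \<bullet> wgrad \<Omega> \<phi> x)"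

definition op_B ::
  "real \<Rightarrow> 'a::euclidean_space set \<Rightarrow> ('a \<Rightarrow> 'a) \<Rightarrow> ('a \<Rightarrow> real) \<Rightarrow> real" where
  "op_B q \<Omega> w = (\<lambda>\<phi>\<in>test_space q \<Omega>. - (LINT x|lebesgue_on \<Omega>. w x \<bullet> wgrad \<Omega> \<phi> x))"

text \<open>\<open>C(closure \<Omega>)\<close> with the supremum distance; its elements are \<open>undefined\<close> outside \<open>closure \<Omega>\<close>.\<close>

abbreviation C_closure :: "'a::euclidean_space set \<Rightarrow> ('a \<Rightarrow> real) metric" where
  "C_closure \<Omega> \<equiv> cfunspace (top_of_set (closure \<Omega>)) euclidean_metric"

text \<open>The Sobolev injection sends (the class of) \<open>m\<close> to its continuous version on \<open>closure \<Omega>\<close>.\<close>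

definition sobolev_injection :: "'a::euclidean_space set \<Rightarrow> ('a \<Rightarrow> real) \<Rightarrow> 'a \<Rightarrow> real" where
  "sobolev_injection \<Omega> m =
     (THE z. z \<in> mspace (C_closure \<Omega>) \<and> (AE x in lebesgue_on \<Omega>. z x = m x))"

type_synonym 'a constraint_value = "(('a \<Rightarrow> real) \<Rightarrow> real) \<times> real \<times> ('a \<Rightarrow> real)"

definition Y_topology :: "real \<Rightarrow> 'a::euclidean_space set \<Rightarrow> 'a constraint_value topology" where
  "Y_topology q \<Omega> =
     prod_topology (mtopology_of (dual_metric (test_space q \<Omega>) (sobolev_norm (conj_exp q) \<Omega>)))
       (prod_topology euclideanreal (mtopology_of (C_closure \<Omega>)))"

text \<open>Zero and subtraction of the vector space \<open>Y\<close>; the restrictions keep the components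
  \<open>undefined\<close> outside their domains.\<close>

definition Y_zero :: "real \<Rightarrow> 'a::euclidean_space set \<Rightarrow> 'a constraint_value" where
  "Y_zero q \<Omega> = ((\<lambda>\<phi>\<in>test_space q \<Omega>. 0), 0, (\<lambda>x\<in>closure \<Omega>. 0))"

fun Y_diff ::
  "real \<Rightarrow> 'a::euclidean_space set \<Rightarrow> 'a constraint_value \<Rightarrow> 'a constraint_value \<Rightarrow>
   'a constraint_value" where
  "Y_diff q \<Omega> (S, a, z) (S', a', z') =
     ((\<lambda>\<phi>\<in>test_space q \<Omega>. S \<phi> - S' \<phi>), a - a', (\<lambda>x\<in>closure \<Omega>. z x - z' x))"

fun op_G ::
  "real \<Rightarrow> 'a::euclidean_space set \<Rightarrow> ('a \<Rightarrow> real) \<times> ('a \<Rightarrow> 'a) \<Rightarrow> 'a constraint_value" where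
  "op_G q \<Omega> (m, w) =
     ((\<lambda>\<phi>\<in>test_space q \<Omega>. op_A q \<Omega> m \<phi> + op_B q \<Omega> w \<phi>),
      (LINT x|lebesgue_on \<Omega>. m x) - 1,
      sobolev_injection \<Omega> m)"

definition upper_bound_C :: "'a::euclidean_space set \<Rightarrow> ('a \<Rightarrow> real) set" where
  "upper_bound_C \<Omega> = {z \<in> mspace (C_closure \<Omega>). \<forall>x\<in>closure \<Omega>. z x \<le> 1}"

definition constraint_K :: "real \<Rightarrow> 'a::euclidean_space set \<Rightarrow> 'a constraint_value set" where
  "constraint_K q \<Omega> = {\<lambda>\<phi>\<in>test_space q \<Omega>. 0} \<times> {0} \<times> upper_bound_C \<Omega>"

end

theory Submission
  imports Defs
begin

text \<open>Every \<open>(S, a, z)\<close> near the origin of \<open>Y\<close> has to be written as \<open>G (m, w) - (0, 0, c)\<close> with \<open>(m, w)\<close> of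
  finite energy and \<open>c \<le> 1\<close>. Take for \<open>m\<close> the constant \<open>(1 + a) / \<bar>\<Omega>\<bar>\<close>. Then \<open>A m = 0\<close>, the mass
  constraint holds, and \<open>c = m - z\<close> stays below \<open>1\<close> for small \<open>a\<close> and \<open>z\<close>, because \<open>\<bar>\<Omega>\<bar> > 1\<close>. As \<open>m\<close> is a
  positive constant, the energy is finite for every \<open>w\<close> in \<open>L\<^sup>q\<close>. It remains to solve \<open>B w = S\<close> for
  an arbitrary element \<open>S\<close> of the dual space (\<open>op_B_surjective\<close>), with no smallness of \<open>S\<close> involved.

  Let \<open>p = q / (q - 1)\<close>, so that \<open>1 < p \<le> 2\<close>. Solving \<open>B w = S\<close> means to represent \<open>S\<close>, as a functional of
  the gradient, by an \<open>L\<^sup>q\<close> field, and rests on two results.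

  The first is a representation theorem for bounded functionals on arbitrary subspaces of \<open>L\<^sup>p\<close>
  (\<open>bounded_functional_on_Lp_subspace\<close>). It comes from the direct method of the calculus of variations;
  strong monotonicity of the duality map \<open>\<bar>x\<bar>\<^bsup>q-2\<^esup> x\<close> for \<open>q \<ge> 2\<close> gives strong convergence.

  The second is the Poincare inequality for functions of mean zero (\<open>poincare_inequality_mean_zero\<close>),
  which makes \<open>S\<close> bounded with respect to the \<open>L\<^sup>p\<close> norm of the gradient. It is obtained without
  a compact embedding, from the estimate of \<open>U (x + h) - U x\<close> by the gradient
  (\<open>weak_gradient_translation_estimate\<close>): on a ball one averages over all translations, and closeness to a
  constant is then carried from the ball through the connected set \<open>\<Omega>\<close> and up to its boundary by finitely
  many translations along segments inside \<open>\<Omega>\<close> (\<open>poincare_of_translation_estimate\<close>). For functions with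
  only a weak gradient the translation estimate follows by duality from the fundamental lemma of the
  calculus of variations.\<close>

section \<open>The duality map of \<open>L\<^sup>p\<close>\<close>

text \<open>The derivative of \<open>norm x powr p / p\<close>. For conjugate exponents \<open>p\<close> and \<open>q\<close> the maps
  \<open>duality_map p\<close> and \<open>duality_map q\<close> are inverse to each other; pointwise application of the first
  sends \<open>L\<^sup>p\<close> to its dual \<open>L\<^sup>q\<close>.\<close>

definition duality_map :: "real \<Rightarrow> 'b::real_inner \<Rightarrow> 'b" where
  "duality_map p x = norm x powr (p - 2) *\<^sub>R x"

lemma norm_duality_map: "1 < p \<Longrightarrow> norm (duality_map p x) = norm x powr (p - 1)"
  by (cases "x = 0") (auto simp: duality_map_def powr_diff power2_eq_square)

lemma duality_map_inner_self: "0 < p \<Longrightarrow> duality_map p x \<bullet> x = norm x powr p"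
  by (cases "x = 0") (auto simp: duality_map_def powr_diff power2_norm_eq_inner[symmetric])

lemma conj_exponent:
  fixes p q :: real
  assumes "1 < p" "q = p / (p - 1)"
  shows "1 < q" "1 / p + 1 / q = 1" "(p - 1) * q = p" "p / q = p - 1"
proof -
  show "1 < q" using assms by (simp add: less_divide_eq)
qed (use assms in \<open>auto simp: divide_simps algebra_simps\<close>)

lemma duality_map_inverse:
  assumes "1 < p" "q = p / (p - 1)"
  shows "duality_map q (duality_map p x) = x"
proof (cases "x = 0")
  case False
  have e: "(p - 1) * (q - 2) + (p - 2) = 0"
    using assms by (simp add: field_simps)
  have "norm (duality_map p x) powr (q - 2) * norm x powr (p - 2)
      = norm x powr ((p - 1) * (q - 2) + (p - 2))"
    using assms by (simp add: norm_duality_map powr_powr powr_add)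
  also have "\<dots> = 1" using e False by simp
  finally show ?thesis by (simp add: duality_map_def[of q] duality_map_def[of p x])
qed (simp add: duality_map_def)

text \<open>Write \<open>A = norm x powr (q - 2)\<close>, \<open>B = norm y powr (q - 2)\<close>. The right-hand side equals
  \<open>(A + B) / 2 * (norm (x - y))\<^sup>2 + (A - B) / 2 * ((norm x)\<^sup>2 - (norm y)\<^sup>2)\<close>. For \<open>q \<ge> 2\<close> the second
  summand is non-negative, and \<open>norm (x - y) powr (q - 2)\<close> is at most a multiple of \<open>A + B\<close>. The
  estimate is homogeneous of degree \<open>q\<close>, so that it integrates to a bound of the \<open>L\<^sup>q\<close> distance.\<close>

lemma duality_map_strongly_monotone:
  fixes x y :: "'b::real_inner"
  assumes "2 \<le> q"
  shows "2 powr (1 - q) * norm (x - y) powr q \<le> (duality_map q x - duality_map q y) \<bullet> (x - y)"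
proof (cases "x = y")
  case False
  define A B N where "A = norm x powr (q - 2)" and "B = norm y powr (q - 2)" and "N = norm (x - y)"
  have N: "0 < N" using False by (simp add: N_def)
  have "N powr (q - 2) \<le> (2 * max (norm x) (norm y)) powr (q - 2)"
    using norm_triangle_ineq4[of x y] assms by (intro powr_mono2) (auto simp: N_def)
  also have "\<dots> = 2 powr (q - 2) * max (norm x) (norm y) powr (q - 2)"
    by (simp add: powr_mult)
  also have "\<dots> \<le> 2 powr (q - 2) * (A + B)"
    by (intro mult_left_mono) (auto simp: A_def B_def max_def)
  finally have N': "N powr (q - 2) \<le> 2 powr (q - 2) * (A + B)" .
  have "2 powr (1 - q) * N powr q = 2 powr (1 - q) * (N powr (q - 2) * N\<^sup>2)"
    using N by (simp add: powr_diff)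
  also have "\<dots> \<le> 2 powr (1 - q) * ((2 powr (q - 2) * (A + B)) * N\<^sup>2)"
    by (intro mult_left_mono mult_right_mono N') auto
  also have "\<dots> = (2 powr (1 - q) * 2 powr (q - 2)) * (A + B) * N\<^sup>2" by simp
  also have "2 powr (1 - q) * 2 powr (q - 2) = 1 / 2"
    by (simp add: powr_add[symmetric] powr_minus_divide)
  finally have 1: "2 powr (1 - q) * N powr q \<le> 1 / 2 * (A + B) * N\<^sup>2" .
  have "0 \<le> (A - B) * ((norm x)\<^sup>2 - (norm y)\<^sup>2)"
  proof (cases "norm x \<le> norm y")
    case True
    then have "A \<le> B" "(norm x)\<^sup>2 \<le> (norm y)\<^sup>2"
      using assms by (auto simp: A_def B_def intro!: powr_mono2 power_mono)
    then show ?thesis by (simp add: mult_nonpos_nonpos)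
  next
    case False
    then have "B \<le> A" "(norm y)\<^sup>2 \<le> (norm x)\<^sup>2"
      using assms by (auto simp: A_def B_def intro!: powr_mono2 power_mono)
    then show ?thesis by simp
  qed
  then have 2: "1 / 2 * (A + B) * N\<^sup>2 \<le> (A *\<^sub>R x - B *\<^sub>R y) \<bullet> (x - y)"
    unfolding N_def power2_norm_eq_inner
    by (simp add: inner_diff_left inner_diff_right inner_commute[of y x] field_simps)
  show ?thesis using 1 2 by (simp add: duality_map_def A_def B_def N_def)
qed simp

text \<open>Strong monotonicity of the inverse \<open>duality_map q\<close> and the Cauchy--Schwarz inequality bound the
  \<open>(q - 1)\<close>-th power of the left-hand side by \<open>2 powr (q - 1) * norm (x - y)\<close>, and
  \<open>(q - 1) * (p - 1) = 1\<close>.\<close>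

lemma duality_map_holder:
  fixes x y :: "'b::real_inner"
  assumes "1 < p" "p \<le> 2"
  shows "norm (duality_map p x - duality_map p y) \<le> 2 * norm (x - y) powr (p - 1)"
proof (cases "duality_map p x = duality_map p y")
  case False
  define q where "q = p / (p - 1)"
  have q: "2 \<le> q" using assms by (simp add: q_def field_simps)
  define N where "N = norm (duality_map p x - duality_map p y)"
  have N: "0 < N" using False by (simp add: N_def)
  have "2 powr (1 - q) * N powr q \<le> (x - y) \<bullet> (duality_map p x - duality_map p y)"
    using duality_map_strongly_monotone[OF q, of "duality_map p x" "duality_map p y"]
    by (simp add: N_def duality_map_inverse[OF assms(1) q_def])
  also have "\<dots> \<le> norm (x - y) * N" unfolding N_def by (rule norm_cauchy_schwarz)
  finally have "2 powr (1 - q) * N powr (q - 1) \<le> norm (x - y)"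
    using N by (simp add: powr_diff field_simps)
  then have "2 powr (q - 1) * (2 powr (1 - q) * N powr (q - 1)) \<le> 2 powr (q - 1) * norm (x - y)"
    by (intro mult_left_mono) auto
  moreover have "2 powr (q - 1) * 2 powr (1 - q) = 1" by (simp add: powr_add[symmetric])
  ultimately have "N powr (q - 1) \<le> 2 powr (q - 1) * norm (x - y)"
    by (simp add: mult.assoc[symmetric])
  then have "(N powr (q - 1)) powr (p - 1) \<le> (2 powr (q - 1) * norm (x - y)) powr (p - 1)"
    using assms by (intro powr_mono2) auto
  moreover have "(q - 1) * (p - 1) = 1" using assms by (simp add: q_def field_simps)
  ultimately show ?thesis using N by (simp add: powr_powr powr_mult N_def)
qed simp

text \<open>Young's inequality for \<open>duality_map p c \<bullet> a\<close>. Integrated, this is also Jensen's inequality for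
  \<open>norm _ powr p\<close>: take for \<open>c\<close> the mean of \<open>a\<close>.\<close>

lemma powr_norm_subgradient:
  fixes a c :: "'b::real_inner"
  assumes "1 < p"
  shows "norm c powr p + p * (duality_map p c \<bullet> (a - c)) \<le> norm a powr p"
proof -
  define q where "q = p / (p - 1)"
  note e = conj_exponent[OF assms q_def]
  have "duality_map p c \<bullet> a \<le> norm a * norm (duality_map p c)"
    using norm_cauchy_schwarz[of "duality_map p c" a] by (simp add: mult.commute)
  also have "\<dots> = norm a * norm c powr (p - 1)" using assms by (simp add: norm_duality_map)
  also have "\<dots> \<le> norm a powr p / p + (norm c powr (p - 1)) powr q / q"
    using assms e(1,2) by (intro Youngs_inequality) auto
  also have "(norm c powr (p - 1)) powr q = norm c powr p" by (simp add: powr_powr e(3))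
  finally have "p * (duality_map p c \<bullet> a) \<le> p * (norm a powr p / p + norm c powr p / q)"
    using assms by (intro mult_left_mono) auto
  also have "\<dots> = norm a powr p + (p / q) * norm c powr p" using assms by (simp add: field_simps)
  also have "p / q = p - 1" by (rule e(4))
  finally show ?thesis
    using assms duality_map_inner_self[of p c] by (simp add: inner_diff_right algebra_simps)
qed

text \<open>The subgradient inequality at \<open>a + b\<close>, in which Hoelder continuity allows to replace
  \<open>duality_map p (a + b)\<close> by \<open>duality_map p a\<close>.\<close>

lemma powr_norm_upper_expansion:
  fixes a b :: "'b::real_inner"
  assumes "1 < p" "p \<le> 2"
  shows "norm (a + b) powr p \<le> norm a powr p + p * (duality_map p a \<bullet> b) + 2 * p * norm b powr p"
proof -
  have "norm (a + b) powr p + p * (duality_map p (a + b) \<bullet> (a - (a + b))) \<le> norm a powr p"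
    by (rule powr_norm_subgradient[OF assms(1)])
  then have 1: "norm (a + b) powr p \<le> norm a powr p + p * (duality_map p a \<bullet> b)
      + p * ((duality_map p (a + b) - duality_map p a) \<bullet> b)"
    by (simp add: inner_diff_left algebra_simps)
  have "(duality_map p (a + b) - duality_map p a) \<bullet> b
      \<le> norm (duality_map p (a + b) - duality_map p a) * norm b"
    by (rule norm_cauchy_schwarz)
  also have "\<dots> \<le> 2 * norm b powr (p - 1) * norm b"
    using duality_map_holder[OF assms, of "a + b" a] by (intro mult_right_mono) auto
  also have "\<dots> = 2 * norm b powr p" by (cases "b = 0") (auto simp: powr_diff)
  finally have "p * ((duality_map p (a + b) - duality_map p a) \<bullet> b) \<le> p * (2 * norm b powr p)"
    using assms by (intro mult_left_mono) auto
  with 1 show ?thesis by (simp add: algebra_simps)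
qed

lemma norm_add_powr_le:
  fixes a b :: "'b::real_normed_vector"
  assumes "0 \<le> p"
  shows "norm (a + b) powr p \<le> 2 powr p * (norm a powr p + norm b powr p)"
proof -
  have "norm (a + b) powr p \<le> (2 * max (norm a) (norm b)) powr p"
    using norm_triangle_ineq[of a b] assms by (intro powr_mono2) auto
  also have "\<dots> = 2 powr p * max (norm a) (norm b) powr p" by (simp add: powr_mult)
  also have "\<dots> \<le> 2 powr p * (norm a powr p + norm b powr p)"
    by (intro mult_left_mono) (auto simp: max_def)
  finally show ?thesis .
qed

lemma inner_le_powr_sum:
  fixes a b :: "'b::real_inner"
  assumes "1 < p" "q = p / (p - 1)"
  shows "\<bar>a \<bullet> b\<bar> \<le> norm a powr q + norm b powr p"
proof -
  note e = conj_exponent[OF assms]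
  have "\<bar>a \<bullet> b\<bar> \<le> norm b * norm a" using Cauchy_Schwarz_ineq2[of a b] by (simp add: mult.commute)
  also have "\<dots> \<le> norm b powr p / p + norm a powr q / q"
    using assms e(1,2) by (intro Youngs_inequality) auto
  also have "\<dots> \<le> norm b powr p + norm a powr q"
    using assms(1) e(1) by (intro add_mono) (auto simp: divide_le_eq mult_le_cancel_left1)
  finally show ?thesis by simp
qed


section \<open>Bounded functionals on subspaces of \<open>L\<^sup>p\<close>\<close>

lemma integrable_powr_norm_add:
  fixes u v :: "'a \<Rightarrow> 'b::euclidean_space"
  assumes "0 \<le> p" and [measurable]: "u \<in> borel_measurable M" "v \<in> borel_measurable M"
    and u: "integrable M (\<lambda>x. norm (u x) powr p)" and v: "integrable M (\<lambda>x. norm (v x) powr p)"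
  shows "integrable M (\<lambda>x. norm (u x + v x) powr p)"
proof (rule Bochner_Integration.integrable_bound)
  show "integrable M (\<lambda>x. 2 powr p * (norm (u x) powr p + norm (v x) powr p))"
    using u v by auto
  show "AE x in M. norm (norm (u x + v x) powr p)
      \<le> norm (2 powr p * (norm (u x) powr p + norm (v x) powr p))"
    using norm_add_powr_le[OF assms(1)] by (auto intro!: AE_I2)
qed simp

lemma integrable_powr_norm_scale:
  fixes u :: "'a \<Rightarrow> 'b::euclidean_space"
  assumes "integrable M (\<lambda>x. norm (u x) powr p)"
  shows "integrable M (\<lambda>x. norm (c *\<^sub>R u x) powr p)"
  using assms by (simp add: powr_mult)

lemma integrable_inner_conj:
  fixes u v :: "'a \<Rightarrow> 'b::euclidean_space"
  assumes "1 < p" "q = p / (p - 1)"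
    and [measurable]: "u \<in> borel_measurable M" "v \<in> borel_measurable M"
    and u: "integrable M (\<lambda>x. norm (u x) powr q)" and v: "integrable M (\<lambda>x. norm (v x) powr p)"
  shows "integrable M (\<lambda>x. u x \<bullet> v x)"
proof (rule Bochner_Integration.integrable_bound)
  show "integrable M (\<lambda>x. norm (u x) powr q + norm (v x) powr p)"
    using u v by auto
  show "AE x in M. norm (u x \<bullet> v x) \<le> norm (norm (u x) powr q + norm (v x) powr p)"
    using inner_le_powr_sum[OF assms(1,2)] by (auto intro!: AE_I2)
qed simp

text \<open>Young's inequality for \<open>k *\<^sub>R z n x\<close> and \<open>inverse k *\<^sub>R v x\<close>: a large \<open>k\<close> makes the contribution of
  \<open>v\<close> small, after which \<open>n\<close> can be chosen.\<close>

lemma tendsto_integral_inner: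
  fixes z :: "nat \<Rightarrow> 'a \<Rightarrow> 'b::euclidean_space"
  assumes p: "1 < p" "q = p / (p - 1)"
    and zm [measurable]: "\<And>n. z n \<in> borel_measurable M"
    and vm [measurable]: "v \<in> borel_measurable M"
    and z: "\<And>n. integrable M (\<lambda>x. norm (z n x) powr q)" and v: "integrable M (\<lambda>x. norm (v x) powr p)"
    and lim: "(\<lambda>n. \<integral>x. norm (z n x) powr q \<partial>M) \<longlonglongrightarrow> 0"
  shows "(\<lambda>n. \<integral>x. z n x \<bullet> v x \<partial>M) \<longlonglongrightarrow> 0"
proof (rule LIMSEQ_I)
  fix e :: real assume e: "0 < e"
  define I where "I = (\<integral>x. norm (v x) powr p \<partial>M)"
  have I: "0 \<le> I" by (simp add: I_def)
  define k where "k = (2 * (I + 1) / e) powr (1 / p)"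
  have k: "0 < k" using e I by (simp add: k_def)
  have kp: "k powr (- p) = e / (2 * (I + 1))"
    using e I p by (simp add: k_def powr_powr powr_minus)
  have bound: "\<bar>\<integral>x. z n x \<bullet> v x \<partial>M\<bar> \<le> k powr q * (\<integral>x. norm (z n x) powr q \<partial>M) + k powr (- p) * I" for n
  proof -
    have "\<bar>\<integral>x. z n x \<bullet> v x \<partial>M\<bar> \<le> (\<integral>x. \<bar>z n x \<bullet> v x\<bar> \<partial>M)"
      by (rule integral_abs_bound)
    also have "\<dots> \<le> (\<integral>x. k powr q * norm (z n x) powr q + k powr (- p) * norm (v x) powr p \<partial>M)"
    proof (rule integral_mono)
      show "integrable M (\<lambda>x. \<bar>z n x \<bullet> v x\<bar>)"
        using integrable_inner_conj[OF p zm vm z v] by (rule integrable_abs)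
      fix x
      have "\<bar>(k *\<^sub>R z n x) \<bullet> (inverse k *\<^sub>R v x)\<bar>
          \<le> norm (k *\<^sub>R z n x) powr q + norm (inverse k *\<^sub>R v x) powr p"
        by (rule inner_le_powr_sum[OF p])
      then show "\<bar>z n x \<bullet> v x\<bar> \<le> k powr q * norm (z n x) powr q + k powr (- p) * norm (v x) powr p"
        using k by (simp add: powr_mult powr_minus inverse_powr mult.assoc[symmetric])
    qed (use z v in auto)
    also have "\<dots> = k powr q * (\<integral>x. norm (z n x) powr q \<partial>M) + k powr (- p) * I"
      using z v by (simp add: I_def)
    finally show ?thesis .
  qed
  have "\<forall>\<^sub>F n in sequentially. (\<integral>x. norm (z n x) powr q \<partial>M) < e / 2 / k powr q"
    using lim e k by (intro order_tendstoD) auto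
  then obtain N where N: "\<And>n. n \<ge> N \<Longrightarrow> (\<integral>x. norm (z n x) powr q \<partial>M) < e / 2 / k powr q"
    by (auto simp: eventually_sequentially)
  have "norm ((\<integral>x. z n x \<bullet> v x \<partial>M) - 0) < e" if "n \<ge> N" for n
  proof -
    have "k powr q * (\<integral>x. norm (z n x) powr q \<partial>M) < e / 2"
      using N[OF that] k by (simp add: field_simps)
    moreover have "k powr (- p) * I \<le> e / 2"
      unfolding kp using e I by (simp add: field_simps)
    ultimately show ?thesis using bound[of n] by simp
  qed
  then show "\<exists>N. \<forall>n\<ge>N. norm ((\<integral>x. z n x \<bullet> v x \<partial>M) - 0) < e" by blast
qed

text \<open>Compares the \<open>L\<^sup>1\<close> norm with the \<open>q\<close>-th power of the \<open>L\<^sup>q\<close> norm on a finite measure space. The free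
  scale \<open>d\<close> makes the first summand small.\<close>

lemma le_add_powr_scaled:
  fixes s d :: real
  assumes "0 \<le> s" "0 < d" "1 \<le> q"
  shows "s \<le> d + d powr (1 - q) * s powr q"
proof (cases "s \<le> d")
  case False
  have "s = d powr (1 - q) * d powr (q - 1) * s"
    using assms by (simp add: powr_add[symmetric])
  also have "\<dots> \<le> d powr (1 - q) * s powr (q - 1) * s"
    using False assms by (intro mult_right_mono mult_left_mono powr_mono2) auto
  also have "\<dots> = d powr (1 - q) * s powr q" using False assms by (simp add: powr_diff)
  finally show ?thesis using assms by simp
qed (use assms in \<open>simp add: add_increasing2\<close>)

text \<open>On a finite measure space an \<open>L\<^sup>q\<close> Cauchy sequence is Cauchy in \<open>L\<^sup>1\<close>, hence converges almost
  everywhere along a subsequence; Fatou's lemma turns this limit into a limit in \<open>L\<^sup>q\<close>.\<close>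

lemma (in finite_measure) Lq_complete:
  fixes w :: "nat \<Rightarrow> 'a \<Rightarrow> 'b::euclidean_space"
  assumes q: "1 \<le> q"
    and wm [measurable]: "\<And>n. w n \<in> borel_measurable M"
    and wi: "\<And>n. integrable M (\<lambda>x. norm (w n x) powr q)"
    and cauchy: "\<And>m n. (\<integral>x. norm (w m x - w n x) powr q \<partial>M) \<le> \<eta> m + \<eta> n"
    and lim: "\<eta> \<longlonglongrightarrow> 0"
  obtains w' where "w' \<in> borel_measurable M" "integrable M (\<lambda>x. norm (w' x) powr q)"
    "(\<lambda>n. \<integral>x. norm (w n x - w' x) powr q \<partial>M) \<longlonglongrightarrow> 0"
proof -
  have di: "integrable M (\<lambda>x. norm (w m x - w n x) powr q)" for m n
    using integrable_powr_norm_add[of q "w m" M "\<lambda>x. - w n x"] q wi by simp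
  have bd: "integrable M (\<lambda>x. norm (w m x - w n x))"
    "(\<integral>x. norm (w m x - w n x) \<partial>M) \<le> d * measure M (space M) + d powr (1 - q) * (\<eta> m + \<eta> n)"
    if "0 < d" for m n d
  proof -
    let ?b = "\<lambda>x. d + d powr (1 - q) * norm (w m x - w n x) powr q"
    have bi: "integrable M ?b" using di by auto
    show 1: "integrable M (\<lambda>x. norm (w m x - w n x))"
    proof (rule Bochner_Integration.integrable_bound[OF bi])
      show "AE x in M. norm (norm (w m x - w n x)) \<le> norm (?b x)"
        using le_add_powr_scaled[OF norm_ge_zero that q] that
        by (intro AE_I2) (simp add: add_nonneg_nonneg)
    qed simp
    have "(\<integral>x. norm (w m x - w n x) \<partial>M) \<le> (\<integral>x. ?b x \<partial>M)"
      using le_add_powr_scaled[OF norm_ge_zero that q] by (intro integral_mono 1 bi) auto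
    also have "\<dots> = d * measure M (space M) + d powr (1 - q) * (\<integral>x. norm (w m x - w n x) powr q \<partial>M)"
      using di by simp
    also have "\<dots> \<le> d * measure M (space M) + d powr (1 - q) * (\<eta> m + \<eta> n)"
      using cauchy by (intro add_left_mono mult_left_mono) auto
    finally show "(\<integral>x. norm (w m x - w n x) \<partial>M) \<le> d * measure M (space M) + d powr (1 - q) * (\<eta> m + \<eta> n)" .
  qed
  have w1: "integrable M (w n)" for n
  proof -
    have bi: "integrable M (\<lambda>x. 1 + 1 powr (1 - q) * norm (w n x) powr q)" using wi by auto
    show ?thesis
      by (rule Bochner_Integration.integrable_bound[OF bi])
        (use le_add_powr_scaled[OF norm_ge_zero, of 1 q] q in
          \<open>auto intro!: AE_I2 simp: add_nonneg_nonneg\<close>)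
  qed
  obtain r where r: "strict_mono r" and AEc: "AE x in M. Cauchy (\<lambda>i. w (r i) x)"
  proof (rule cauchy_L1_AE_cauchy_subseq[of M w, OF w1])
    fix e :: real assume e: "0 < e"
    define d where "d = e / (2 * (measure M (space M) + 1))"
    have d: "0 < d" using e by (simp add: d_def add_nonneg_pos)
    have "measure M (space M) + 1 \<noteq> 0" using measure_nonneg[of M "space M"] by linarith
    then have "d * (measure M (space M) + 1) = e / 2" by (simp add: d_def divide_simps)
    then have dM: "d * measure M (space M) < e / 2" using d by (simp add: distrib_left)
    have "\<forall>\<^sub>F n in sequentially. \<eta> n < e / 4 / d powr (1 - q)"
      using lim e d by (intro order_tendstoD) auto
    then obtain N where N: "\<And>n. n \<ge> N \<Longrightarrow> \<eta> n < e / 4 / d powr (1 - q)"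
      by (auto simp: eventually_sequentially)
    have "(\<integral>x. norm (w i x - w j x) \<partial>M) < e" if "i \<ge> N" "j \<ge> N" for i j
    proof -
      have "d powr (1 - q) * \<eta> i < e / 4" "d powr (1 - q) * \<eta> j < e / 4"
        using N[OF that(1)] N[OF that(2)] d by (simp_all add: field_simps)
      then show ?thesis using bd(2)[OF d, of i j] dM by (simp add: distrib_left)
    qed
    then show "\<exists>N. \<forall>i\<ge>N. \<forall>j\<ge>N. (\<integral>x. norm (w i x - w j x) \<partial>M) < e" by blast
  qed blast
  define w' where "w' = (\<lambda>x. lim (\<lambda>i. w (r i) x))"
  have w'm [measurable]: "w' \<in> borel_measurable M"
    unfolding w'_def by (rule borel_measurable_lim_metric) simp
  have AEl: "AE x in M. (\<lambda>i. w (r i) x) \<longlonglongrightarrow> w' x"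
    using AEc by eventually_elim (simp add: w'_def Cauchy_convergent_iff convergent_LIMSEQ_iff)
  have fatou: "(\<integral>\<^sup>+x. ennreal (norm (w n x - w' x) powr q) \<partial>M) \<le> ennreal (\<eta> n)" for n
  proof -
    have "(\<integral>\<^sup>+x. ennreal (norm (w n x - w' x) powr q) \<partial>M)
        = (\<integral>\<^sup>+x. liminf (\<lambda>i. ennreal (norm (w n x - w (r i) x) powr q)) \<partial>M)"
    proof (rule nn_integral_cong_AE, use AEl in eventually_elim)
      case (elim x)
      have "(\<lambda>i. ennreal (norm (w n x - w (r i) x) powr q)) \<longlonglongrightarrow> ennreal (norm (w n x - w' x) powr q)"
        using q by (intro tendsto_intros tendsto_powr' elim) auto
      from lim_imp_Liminf[OF sequentially_bot this] show ?case by simp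
    qed
    also have "\<dots> \<le> liminf (\<lambda>i. \<integral>\<^sup>+x. ennreal (norm (w n x - w (r i) x) powr q) \<partial>M)"
      by (rule nn_integral_liminf) simp
    also have "\<dots> \<le> liminf (\<lambda>i. ennreal (\<eta> n + \<eta> (r i)))"
      by (intro Liminf_mono always_eventually allI)
        (simp add: nn_integral_eq_integral[OF di] cauchy ennreal_leI)
    also have "\<dots> = ennreal (\<eta> n + 0)"
      using LIMSEQ_subseq_LIMSEQ[OF lim r]
      by (intro lim_imp_Liminf tendsto_intros) (auto simp: comp_def)
    finally show ?thesis by simp
  qed
  have di': "integrable M (\<lambda>x. norm (w n x - w' x) powr q)" for n
    by (rule integrableI_nonneg) (use le_less_trans[OF fatou[of n]] in auto)
  have le: "(\<integral>x. norm (w n x - w' x) powr q \<partial>M) \<le> max 0 (\<eta> n)" for n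
    using fatou[of n] unfolding nn_integral_eq_integral[OF di' AE_I2[OF powr_ge_zero]]
    by (auto simp: ennreal_le_iff2 max_def)
  show ?thesis
  proof
    show "integrable M (\<lambda>x. norm (w' x) powr q)"
      using integrable_powr_norm_add[of q "\<lambda>x. w' x - w 0 x" M "w 0"] q wi[of 0] di'[of 0]
      by (simp add: norm_minus_commute)
    have m0: "(\<lambda>n. max 0 (\<eta> n)) \<longlonglongrightarrow> 0" using tendsto_max[OF tendsto_const[of 0] lim] by simp
    show "(\<lambda>n. \<integral>x. norm (w n x - w' x) powr q \<partial>M) \<longlonglongrightarrow> 0"
      by (rule tendsto_sandwich[OF _ _ tendsto_const m0]) (use le in auto)
  qed simp
qed


text \<open>Hahn--Banach and Riesz representation in one: a bounded functional on a subspace of \<open>L\<^sup>p\<close> is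
  integration against an \<open>L\<^sup>q\<close> function. The functional is given by its graph \<open>X\<close>; since elements of
  \<open>L\<^sup>p\<close> are functions instead of classes, this spares a proof that it is well defined.

  Formally, if \<open>g\<close> minimizes \<open>J (l, g) = (\<integral>x. norm (g x) powr p \<partial>M) / p - l\<close> over \<open>X\<close>, then the
  Euler--Lagrange equation says that \<open>w x = duality_map p (g x)\<close> represents the functional. The
  minimum need not be attained in \<open>X\<close>, so a minimizing sequence \<open>g n\<close> is used. Expanding \<open>J\<close> around
  \<open>g n\<close> shows that \<open>w n x = duality_map p (g n x)\<close> represents the functional up to an error \<open>\<eta> n\<close>.
  Testing with \<open>g m - g n\<close>, strong monotonicity of \<open>duality_map q\<close> shows that \<open>w\<close> is a Cauchy
  sequence in \<open>L\<^sup>q\<close>, and its limit represents the functional exactly.\<close>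

theorem bounded_functional_on_Lp_subspace:
  fixes X :: "(real \<times> ('a \<Rightarrow> 'b::euclidean_space)) set"
  assumes "finite_measure M" and p: "1 < p" "p \<le> 2" and q: "q = p / (p - 1)"
    and lin: "\<And>l g l' g' a b. (l, g) \<in> X \<Longrightarrow> (l', g') \<in> X \<Longrightarrow>
      (a * l + b * l', \<lambda>x. a *\<^sub>R g x + b *\<^sub>R g' x) \<in> X"
    and meas: "\<And>l g. (l, g) \<in> X \<Longrightarrow> g \<in> borel_measurable M"
    and int: "\<And>l g. (l, g) \<in> X \<Longrightarrow> integrable M (\<lambda>x. norm (g x) powr p)"
    and bound: "\<And>l g. (l, g) \<in> X \<Longrightarrow> \<bar>l\<bar> \<le> C * (\<integral>x. norm (g x) powr p \<partial>M) powr (1 / p)"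
  obtains w where "w \<in> borel_measurable M" "integrable M (\<lambda>x. norm (w x) powr q)"
    "\<And>l g. (l, g) \<in> X \<Longrightarrow> l = (\<integral>x. w x \<bullet> g x \<partial>M)"
proof (cases "X = {}")
  case True
  show ?thesis by (rule that[of "\<lambda>_. 0"]) (use True in auto)
next
  case False
  interpret finite_measure M by fact
  note e = conj_exponent[OF p(1) q]
  have q2: "2 \<le> q" using p by (simp add: q le_divide_eq)
  define I where "I g = (\<integral>x. norm (g x :: 'b) powr p \<partial>M)" for g
  define J where "J = (\<lambda>(l, g). I g / p - l)"
  have I0: "0 \<le> I g" for g by (simp add: I_def)
  have I_scale: "I (\<lambda>x. t *\<^sub>R g x) = \<bar>t\<bar> powr p * I g" for t g
    by (simp add: I_def powr_mult)
  have I_diff: "I (\<lambda>x. g x - g' x) \<le> 2 powr p * (I g + I g')" if "(l, g) \<in> X" "(l', g') \<in> X" for l l' g g'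
  proof -
    have "I (\<lambda>x. g x - g' x) \<le> (\<integral>x. 2 powr p * (norm (g x) powr p + norm (g' x) powr p) \<partial>M)"
      unfolding I_def
    proof (rule integral_mono)
      show "integrable M (\<lambda>x. norm (g x - g' x) powr p)"
        using integrable_powr_norm_add[of p g M "\<lambda>x. - g' x"] p meas[OF that(1)] meas[OF that(2)]
          int[OF that(1)] int[OF that(2)] by simp
      show "norm (g x - g' x) powr p \<le> 2 powr p * (norm (g x) powr p + norm (g' x) powr p)" for x
        using norm_add_powr_le[of p "g x" "- g' x"] p by simp
    qed (use int[OF that(1)] int[OF that(2)] in auto)
    also have "\<dots> = 2 powr p * (I g + I g')"
      using int[OF that(1)] int[OF that(2)] by (simp add: I_def)
    finally show ?thesis .
  qed
  define C' where "C' = \<bar>C\<bar>"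
  define K where "K = (2 powr (1 / p) * C') powr q"
  have coercive: "l \<le> I g / (2 * p) + K" if "(l, g) \<in> X" for l g
  proof -
    have "C * I g powr (1 / p) \<le> C' * I g powr (1 / p)"
      by (intro mult_right_mono) (auto simp: C'_def)
    then have "l \<le> C' * I g powr (1 / p)" using bound[OF that] by (simp add: I_def)
    also have "\<dots> = (I g / 2) powr (1 / p) * (2 powr (1 / p) * C')"
      using I0[of g] by (simp add: powr_divide)
    also have "\<dots> \<le> ((I g / 2) powr (1 / p)) powr p / p + (2 powr (1 / p) * C') powr q / q"
      using p e(1,2) by (intro Youngs_inequality) (auto simp: C'_def)
    also have "((I g / 2) powr (1 / p)) powr p = I g / 2"
      using p I0[of g] by (simp add: powr_powr)
    finally have "l \<le> I g / (2 * p) + (2 powr (1 / p) * C') powr q / q" by simp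
    moreover have "(2 powr (1 / p) * C') powr q / q \<le> K"
      using e(1) by (auto simp: K_def divide_le_eq mult_le_cancel_left1)
    ultimately show ?thesis by linarith
  qed
  define \<mu> where "\<mu> = Inf (J ` X)"
  have below: "- K + I g / (2 * p) \<le> J (l, g)" if "(l, g) \<in> X" for l g
  proof -
    have "I g / p = I g / (2 * p) + I g / (2 * p)" using p by (simp add: field_simps)
    then show ?thesis using coercive[OF that] by (simp add: J_def)
  qed
  have "- K \<le> J y" if "y \<in> X" for y
    using below[of "fst y" "snd y"] that I0[of "snd y"] p
    by (smt (verit) divide_nonneg_pos prod.collapse)
  then have bdd: "bdd_below (J ` X)" by (rule bdd_belowI2)
  have \<mu>_le: "\<mu> \<le> J (l, g)" if "(l, g) \<in> X" for l g
    unfolding \<mu>_def using that by (intro cInf_lower bdd) auto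
  define \<eta> :: "nat \<Rightarrow> real" where "\<eta> = (\<lambda>n. 1 / real (Suc n))"
  have \<eta>0: "0 < \<eta> n" "\<eta> n \<le> 1" for n by (auto simp: \<eta>_def)
  \<comment> \<open>The defect \<open>\<eta> n powr q\<close> from the infimum leads to the error \<open>\<eta> n\<close> in the Euler--Lagrange equation.\<close>
  have "\<exists>y\<in>X. J y < \<mu> + \<eta> n powr q" for n
    using cInf_lessD[of "J ` X" "\<mu> + \<eta> n powr q"] False \<eta>0[of n] by (auto simp: \<mu>_def)
  then obtain y where y: "\<And>n. y n \<in> X" "\<And>n. J (y n) < \<mu> + \<eta> n powr q" by metis
  define l g where "l = fst \<circ> y" and "g = snd \<circ> y"
  have X: "(l n, g n) \<in> X" and J: "J (l n, g n) < \<mu> + \<eta> n powr q" for n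
    using y by (auto simp: l_def g_def)
  define w where "w = (\<lambda>n x. duality_map p (g n x))"
  have gm [measurable]: "g n \<in> borel_measurable M" for n by (rule meas[OF X])
  have wm [measurable]: "w n \<in> borel_measurable M" for n by (simp add: w_def duality_map_def)
  have wq: "norm (w n x) powr q = norm (g n x) powr p" for n x
    using p e by (simp add: w_def norm_duality_map powr_powr)
  have wi: "integrable M (\<lambda>x. norm (w n x) powr q)" for n
    unfolding wq by (rule int[OF X])
  note wv = integrable_inner_conj[OF p(1) q wm _ wi]
  \<comment> \<open>Perturb the near-minimizer by \<open>t v\<close>. With this \<open>t\<close> the defect \<open>\<eta> n powr q\<close> and the remainder, a
    multiple of \<open>t powr p\<close>, are of the same order \<open>t * \<eta> n\<close>.\<close>
  have half: "l' - (\<integral>x. w n x \<bullet> v x \<partial>M) \<le> \<eta> n * (1 + 2 * I v)" if v: "(l', v) \<in> X" for l' v n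
  proof -
    note [measurable] = meas[OF v]
    define t where "t = \<eta> n powr (q - 1)"
    have t: "0 < t" using \<eta>0[of n] by (simp add: t_def)
    have "(q - 1) * p = q" using p q by (simp add: field_simps)
    then have tp: "t powr p = \<eta> n powr q" by (simp add: t_def powr_powr)
    have tq: "\<eta> n powr q = t * \<eta> n" using \<eta>0[of n] by (simp add: t_def powr_diff)
    have Xt: "(l n + t * l', \<lambda>x. g n x + t *\<^sub>R v x) \<in> X"
      using lin[OF X[of n] v, of 1 t] by simp
    have "I (\<lambda>x. g n x + t *\<^sub>R v x)
        \<le> (\<integral>x. norm (g n x) powr p + p * (t * (w n x \<bullet> v x)) + 2 * p * (t powr p * norm (v x) powr p) \<partial>M)"
      unfolding I_def
    proof (rule integral_mono)
      show "integrable M (\<lambda>x. norm (g n x + t *\<^sub>R v x) powr p)" by (rule int[OF Xt])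
      show "integrable M (\<lambda>x. norm (g n x) powr p + p * (t * (w n x \<bullet> v x)) + 2 * p * (t powr p * norm (v x) powr p))"
        using int[OF X, of n] int[OF v] wv[OF meas[OF v] int[OF v], of n] by auto
      show "norm (g n x + t *\<^sub>R v x) powr p
          \<le> norm (g n x) powr p + p * (t * (w n x \<bullet> v x)) + 2 * p * (t powr p * norm (v x) powr p)" for x
        using powr_norm_upper_expansion[OF p, of "g n x" "t *\<^sub>R v x"] t by (simp add: w_def powr_mult)
    qed
    also have "\<dots> = I (g n) + p * (t * (\<integral>x. w n x \<bullet> v x \<partial>M)) + 2 * p * (t powr p * I v)"
      using int[OF X, of n] int[OF v] wv[OF meas[OF v] int[OF v], of n] by (simp add: I_def)
    finally have "I (\<lambda>x. g n x + t *\<^sub>R v x) / p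
        \<le> I (g n) / p + t * (\<integral>x. w n x \<bullet> v x \<partial>M) + 2 * (t powr p * I v)"
      using p by (simp add: field_simps)
    moreover have "\<mu> \<le> I (\<lambda>x. g n x + t *\<^sub>R v x) / p - (l n + t * l')"
      using \<mu>_le[OF Xt] by (simp add: J_def)
    ultimately have "t * (l' - (\<integral>x. w n x \<bullet> v x \<partial>M)) \<le> \<eta> n powr q + 2 * (\<eta> n powr q * I v)"
      using J[of n] unfolding tp by (simp add: J_def algebra_simps)
    also have "\<dots> = t * (\<eta> n * (1 + 2 * I v))" by (simp add: tq algebra_simps)
    finally show ?thesis using t by simp
  qed
  have near: "\<bar>l' - (\<integral>x. w n x \<bullet> v x \<partial>M)\<bar> \<le> \<eta> n * (1 + 2 * I v)" if v: "(l', v) \<in> X" for l' v n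
  proof -
    have "(- l', \<lambda>x. - v x) \<in> X" using lin[OF v v, of "-1" 0] by simp
    from half[OF this, of n] half[OF v, of n] show ?thesis by (simp add: I_def)
  qed
  \<comment> \<open>Coercivity bounds the minimizing sequence.\<close>
  define R where "R = 2 * p * (\<mu> + 1 + K)"
  have R: "I (g n) \<le> R" for n
  proof -
    have "\<eta> n powr q \<le> 1" using \<eta>0[of n] e by (intro powr_le1) auto
    then have "I (g n) / (2 * p) \<le> \<mu> + 1 + K" using below[OF X, of n] J[of n] by linarith
    then show ?thesis using p by (simp add: R_def field_simps)
  qed
  define S where "S = 2 powr (q - 1) * (1 + 2 * (2 powr p * (R + R)))"
  have S0: "0 \<le> S" using R[of 0] I0[of "g 0"] by (simp add: S_def)
  have cauchy: "(\<integral>x. norm (w m x - w n x) powr q \<partial>M) \<le> S * \<eta> m + S * \<eta> n" for m n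
  proof -
    let ?v = "\<lambda>x. g m x - g n x"
    have v: "(l m - l n, ?v) \<in> X" using lin[OF X[of m] X[of n], of 1 "-1"] by simp
    have Iv: "I ?v \<le> 2 powr p * (R + R)"
      by (rule order_trans[OF I_diff[OF X X]]) (intro mult_left_mono add_mono R, simp)
    have "2 powr (1 - q) * (\<integral>x. norm (w m x - w n x) powr q \<partial>M)
        = (\<integral>x. 2 powr (1 - q) * norm (w m x - w n x) powr q \<partial>M)" by simp
    also have "\<dots> \<le> (\<integral>x. w m x \<bullet> ?v x - w n x \<bullet> ?v x \<partial>M)"
    proof (rule integral_mono)
      show "integrable M (\<lambda>x. 2 powr (1 - q) * norm (w m x - w n x) powr q)"
        using integrable_powr_norm_add[of q "w m" M "\<lambda>x. - w n x"] e wi by simp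
      show "integrable M (\<lambda>x. w m x \<bullet> ?v x - w n x \<bullet> ?v x)"
        using wv[OF meas[OF v] int[OF v]] by auto
      show "2 powr (1 - q) * norm (w m x - w n x) powr q \<le> w m x \<bullet> ?v x - w n x \<bullet> ?v x" for x
        using duality_map_strongly_monotone[OF q2, of "w m x" "w n x"]
        by (simp add: w_def duality_map_inverse[OF p(1) q] inner_diff_left
              inner_diff_right inner_commute)
    qed
    also have "\<dots> = (\<integral>x. w m x \<bullet> ?v x \<partial>M) - (\<integral>x. w n x \<bullet> ?v x \<partial>M)"
      using wv[OF meas[OF v] int[OF v]] by (intro Bochner_Integration.integral_diff)
    also have "\<dots> \<le> (\<eta> m + \<eta> n) * (1 + 2 * I ?v)"
      using near[OF v, of m] near[OF v, of n] by (simp add: abs_le_iff distrib_right)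
    also have "\<dots> \<le> (\<eta> m + \<eta> n) * (1 + 2 * (2 powr p * (R + R)))"
      using \<eta>0[of m] \<eta>0[of n] Iv by (intro mult_left_mono add_left_mono) simp_all
    finally have "2 powr (q - 1) * (2 powr (1 - q) * (\<integral>x. norm (w m x - w n x) powr q \<partial>M))
        \<le> 2 powr (q - 1) * ((\<eta> m + \<eta> n) * (1 + 2 * (2 powr p * (R + R))))"
      by (intro mult_left_mono) auto
    moreover have "2 powr (q - 1) * 2 powr (1 - q) = 1" by (simp add: powr_add[symmetric])
    ultimately have "(\<integral>x. norm (w m x - w n x) powr q \<partial>M)
        \<le> 2 powr (q - 1) * ((\<eta> m + \<eta> n) * (1 + 2 * (2 powr p * (R + R))))"
      by (simp add: mult.assoc[symmetric])
    also have "\<dots> = S * \<eta> m + S * \<eta> n" by (simp add: S_def algebra_simps)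
    finally show ?thesis .
  qed
  have \<eta>lim: "\<eta> \<longlonglongrightarrow> 0" unfolding \<eta>_def by (rule LIMSEQ_Suc[OF lim_1_over_n])
  have S\<eta>: "(\<lambda>n. S * \<eta> n) \<longlonglongrightarrow> 0" using tendsto_mult_right_zero[OF \<eta>lim] .
  obtain w' where w': "w' \<in> borel_measurable M" "integrable M (\<lambda>x. norm (w' x) powr q)"
    "(\<lambda>n. \<integral>x. norm (w n x - w' x) powr q \<partial>M) \<longlonglongrightarrow> 0"
    using Lq_complete[OF less_imp_le[OF e(1)] wm wi cauchy S\<eta>] by blast
  note [measurable] = w'(1)
  show ?thesis
  proof (rule that[OF w'(1,2)])
    fix l' v assume v: "(l', v) \<in> X"
    note [measurable] = meas[OF v]
    have "(\<lambda>n. \<integral>x. (w n x - w' x) \<bullet> v x \<partial>M) \<longlonglongrightarrow> 0"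
    proof (rule tendsto_integral_inner[OF p(1) q _ meas[OF v] _ int[OF v] w'(3)])
      show "integrable M (\<lambda>x. norm (w n x - w' x) powr q)" for n
        using integrable_powr_norm_add[of q "w n" M "\<lambda>x. - w' x"] e wi w' by simp
    qed simp
    then have "(\<lambda>n. (\<integral>x. (w n x - w' x) \<bullet> v x \<partial>M) + (\<integral>x. w' x \<bullet> v x \<partial>M)) \<longlonglongrightarrow> 0 + (\<integral>x. w' x \<bullet> v x \<partial>M)"
      by (intro tendsto_intros)
    moreover have "(\<integral>x. (w n x - w' x) \<bullet> v x \<partial>M) + (\<integral>x. w' x \<bullet> v x \<partial>M) = (\<integral>x. w n x \<bullet> v x \<partial>M)" for n
      using wv[OF meas[OF v] int[OF v], of n] integrable_inner_conj[OF p(1) q w'(1) meas[OF v] w'(2) int[OF v]]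
      by (simp add: inner_diff_left)
    ultimately have 1: "(\<lambda>n. \<integral>x. w n x \<bullet> v x \<partial>M) \<longlonglongrightarrow> (\<integral>x. w' x \<bullet> v x \<partial>M)" by simp
    have 2: "(\<lambda>n. l' - (\<integral>x. w n x \<bullet> v x \<partial>M)) \<longlonglongrightarrow> 0"
    proof (rule Lim_null_comparison)
      show "(\<lambda>n. \<eta> n * (1 + 2 * I v)) \<longlonglongrightarrow> 0" using tendsto_mult_left_zero[OF \<eta>lim] .
      show "\<forall>\<^sub>F n in sequentially. norm (l' - (\<integral>x. w n x \<bullet> v x \<partial>M)) \<le> \<eta> n * (1 + 2 * I v)"
        using near[OF v] by simp
    qed
    have 3: "(\<lambda>n. l' - (\<integral>x. w n x \<bullet> v x \<partial>M)) \<longlonglongrightarrow> l' - (\<integral>x. w' x \<bullet> v x \<partial>M)"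
      by (intro tendsto_intros 1)
    show "l' = (\<integral>x. w' x \<bullet> v x \<partial>M)" using LIMSEQ_unique[OF 2 3] by simp
  qed
qed

section \<open>Smooth bump functions\<close>

lemma higher_differentiable_on_mono_Suc:
  "higher_differentiable_on S f (Suc k) \<Longrightarrow> higher_differentiable_on S f k"
proof (induction k arbitrary: f)
  case 0
  then show ?case
    by (auto intro!: continuous_at_imp_continuous_on differentiable_imp_continuous_within)
next
  case (Suc k)
  then show ?case by (meson higher_differentiable_on.simps(2))
qed

lemma higher_differentiable_on_UNIV_SucI:
  assumes "\<And>x. (f has_derivative f' x) (at x)"
    and "\<And>v. higher_differentiable_on UNIV (\<lambda>x. f' x v) k"
  shows "higher_differentiable_on UNIV f (Suc k)"
proof -
  have "(\<lambda>x. frechet_derivative f (at x) v) = (\<lambda>x. f' x v)" for v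
    using frechet_derivative_at[OF assms(1)] by (auto simp: fun_eq_iff)
  then show ?thesis using assms by (auto simp: differentiable_def)
qed

lemma higher_differentiable_on_SucD:
  assumes "higher_differentiable_on S f (Suc k)" "x \<in> S"
  shows "(f has_derivative frechet_derivative f (at x)) (at x)"
  using assms by (auto simp: frechet_derivative_works[symmetric])

lemma higher_differentiable_add:
  "higher_differentiable_on UNIV f k \<Longrightarrow> higher_differentiable_on UNIV g k \<Longrightarrow>
   higher_differentiable_on UNIV (\<lambda>x. f x + g x) k"
proof (induction k arbitrary: f g)
  case 0
  then show ?case by (auto intro: continuous_on_add)
next
  case (Suc k)
  note D = higher_differentiable_on_SucD[OF _ UNIV_I]
  show ?case
    by (rule higher_differentiable_on_UNIV_SucI[OF has_derivative_add[OF D[OF Suc.prems(1)] D[OF Suc.prems(2)]]])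
      (use Suc in auto)
qed

lemma higher_differentiable_mult:
  "higher_differentiable_on UNIV f k \<Longrightarrow> higher_differentiable_on UNIV g k \<Longrightarrow>
   higher_differentiable_on UNIV (\<lambda>x. f x * g x) k"
proof (induction k arbitrary: f g)
  case 0
  then show ?case by (auto intro: continuous_on_mult)
next
  case (Suc k)
  note D = higher_differentiable_on_SucD[OF _ UNIV_I]
  have "higher_differentiable_on UNIV (\<lambda>x. frechet_derivative f (at x) v) k"
    "higher_differentiable_on UNIV (\<lambda>x. frechet_derivative g (at x) v) k" for v
    using Suc.prems by auto
  then have "higher_differentiable_on UNIV (\<lambda>x. f x * frechet_derivative g (at x) v) k"
    "higher_differentiable_on UNIV (\<lambda>x. frechet_derivative f (at x) v * g x) k" for v
    by (intro Suc.IH Suc.prems[THEN higher_differentiable_on_mono_Suc]; blast)+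
  then show ?case
    by (intro higher_differentiable_on_UNIV_SucI[OF has_derivative_mult[OF D[OF Suc.prems(1)] D[OF Suc.prems(2)]]]
        higher_differentiable_add) auto
qed

lemma higher_differentiable_const: "higher_differentiable_on UNIV (\<lambda>x. c) k"
proof (induction k arbitrary: c)
  case (Suc k)
  show ?case by (rule higher_differentiable_on_UNIV_SucI[OF has_derivative_const]) (use Suc in auto)
qed (auto intro: continuous_intros)

lemma smooth_on_prod:
  assumes "\<And>i. i \<in> I \<Longrightarrow> smooth_on UNIV (f i)"
  shows "smooth_on UNIV (\<lambda>x. \<Prod>i\<in>I. f i x)"
  using assms
  by (induction I rule: infinite_finite_induct)
    (auto simp: smooth_on_def intro: higher_differentiable_const higher_differentiable_mult)

lemma tendsto_poly_times_exp_minus: "((\<lambda>y::real. poly R y * exp (- y)) \<longlongrightarrow> 0) at_top"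
proof -
  have "((\<lambda>y. \<Sum>i\<le>degree R. coeff R i * (y ^ i / exp y)) \<longlongrightarrow> (\<Sum>i\<le>degree R. coeff R i * 0)) at_top"
    by (intro tendsto_intros tendsto_power_div_exp_0)
  then show ?thesis by (simp add: poly_altdef exp_minus divide_inverse sum_distrib_right mult.assoc)
qed

text \<open>The functions \<open>P (1 / x) * exp (- 1 / x)\<close> on \<open>x > 0\<close>, extended by zero. Admitting polynomials \<open>P\<close>
  makes the family closed under differentiation, which proves smoothness by induction.\<close>

definition flat_function :: "real poly \<Rightarrow> real \<Rightarrow> real" where
  "flat_function P x = (if 0 < x then poly P (inverse x) * exp (- inverse x) else 0)"

lemma flat_function_nonpos: "t \<le> 0 \<Longrightarrow> flat_function P (real n * t) = 0"
  by (simp add: flat_function_def zero_less_mult_iff)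

text \<open>The only delicate point is \<open>x = 0\<close>, where the difference quotient from the right is
  \<open>y * P y * exp (- y)\<close> at \<open>y = 1 / x\<close> and \<open>y\<close> tends to infinity.\<close>

lemma flat_function_has_derivative:
  "(flat_function P has_field_derivative flat_function ([:0, 0, 1:] * (P - pderiv P)) x) (at x)"
proof -
  consider "0 < x" | "x < 0" | "x = 0" by linarith
  then show ?thesis
  proof cases
    case 1
    have "((\<lambda>x. poly P (inverse x) * exp (- inverse x)) has_field_derivative
        flat_function ([:0, 0, 1:] * (P - pderiv P)) x) (at x)"
      using 1 by (auto intro!: derivative_eq_intros DERIV_chain2[OF poly_DERIV]
          simp: flat_function_def algebra_simps power2_eq_square)
    then show ?thesis
      by (rule has_field_derivative_transform_within_open[where S = "{0<..}"])
        (use 1 in \<open>auto simp: flat_function_def\<close>)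
  next
    case 2
    have "((\<lambda>x. 0) has_field_derivative flat_function ([:0, 0, 1:] * (P - pderiv P)) x) (at x)"
      using 2 by (simp add: flat_function_def)
    then show ?thesis
      by (rule has_field_derivative_transform_within_open[where S = "{..<0}"])
        (use 2 in \<open>auto simp: flat_function_def\<close>)
  next
    case 3
    have "((\<lambda>h. flat_function P h / h) \<longlongrightarrow> 0) (at_right 0)"
    proof (rule Lim_transform_eventually)
      show "((\<lambda>h. poly (pCons 0 P) (inverse h) * exp (- inverse h)) \<longlongrightarrow> 0) (at_right 0)"
        using filterlim_compose[OF tendsto_poly_times_exp_minus filterlim_inverse_at_top_right] .
      show "\<forall>\<^sub>F h in at_right 0. poly (pCons 0 P) (inverse h) * exp (- inverse h) = flat_function P h / h"
        by (rule eventually_at_right_less[of 0, THEN eventually_mono])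
          (simp add: flat_function_def divide_inverse)
    qed
    moreover have "((\<lambda>h. flat_function P h / h) \<longlongrightarrow> 0) (at_left 0)"
    proof (rule Lim_transform_eventually[OF tendsto_const])
      show "\<forall>\<^sub>F h in at_left 0. 0 = flat_function P h / h"
        unfolding eventually_at_filter by (rule always_eventually) (auto simp: flat_function_def)
    qed
    ultimately have "((\<lambda>h. flat_function P h / h) \<longlongrightarrow> 0) (at 0)"
      by (rule filterlim_split_at[rotated])
    then show ?thesis using 3 by (simp add: DERIV_def flat_function_def)
  qed
qed

lemma smooth_flat_function_affine:
  "smooth_on UNIV (\<lambda>x. flat_function P (c * (x \<bullet> i) + d))"
  unfolding smooth_on_def
proof
  fix k show "higher_differentiable_on UNIV (\<lambda>x. flat_function P (c * (x \<bullet> i) + d)) k"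
  proof (induction k arbitrary: P)
    case 0
    have "continuous_on UNIV (flat_function P)"
      by (intro continuous_at_imp_continuous_on ballI DERIV_isCont[OF flat_function_has_derivative])
    then show ?case
      by (auto intro!: continuous_on_compose2[of UNIV "flat_function P"] continuous_intros)
  next
    case (Suc k)
    let ?Q = "[:0, 0, 1:] * (P - pderiv P)"
    show ?case
    proof (rule higher_differentiable_on_UNIV_SucI)
      fix x :: 'a
      show "((\<lambda>x. flat_function P (c * (x \<bullet> i) + d)) has_derivative
          (\<lambda>v. c * (v \<bullet> i) * flat_function ?Q (c * (x \<bullet> i) + d))) (at x)"
        by (rule has_derivative_eq_rhs, rule has_derivative_compose[OF _
              flat_function_has_derivative[unfolded has_field_derivative_def]])
          (auto intro!: derivative_eq_intros simp: algebra_simps)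
      show "higher_differentiable_on UNIV (\<lambda>x. c * (v \<bullet> i) * flat_function ?Q (c * (x \<bullet> i) + d)) k" for v
        by (intro higher_differentiable_mult higher_differentiable_const Suc)
    qed
  qed
qed

text \<open>Since \<open>flat_function 1 (n * t) = exp (- 1 / (n * t))\<close> tends to \<open>1\<close> for \<open>t > 0\<close>, these smooth functions
  approximate the indicator of an open box pointwise.\<close>

definition box_bump :: "nat \<Rightarrow> 'a::euclidean_space \<Rightarrow> 'a \<Rightarrow> 'a \<Rightarrow> real" where
  "box_bump n a b x = (\<Prod>i\<in>Basis.
     flat_function 1 (real n * (x \<bullet> i - a \<bullet> i)) * flat_function 1 (real n * (b \<bullet> i - x \<bullet> i)))"

lemma box_bump_test_function:
  assumes "cbox a b \<subseteq> \<Omega>"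
  shows "box_bump n a b \<in> test_functions \<Omega>"
proof -
  have "smooth_on UNIV (\<lambda>x. flat_function 1 (real n * (x \<bullet> i - a \<bullet> i)) * flat_function 1 (real n * (b \<bullet> i - x \<bullet> i)))"
    for i
    using smooth_flat_function_affine[of 1 "real n" i "- (real n * (a \<bullet> i))"]
      smooth_flat_function_affine[of 1 "- real n" i "real n * (b \<bullet> i)"]
    unfolding smooth_on_def by (auto intro: higher_differentiable_mult simp: algebra_simps)
  then have "smooth_on UNIV (box_bump n a b)"
    unfolding box_bump_def by (rule smooth_on_prod)
  moreover have "box_bump n a b x = 0" if "x \<notin> cbox a b" for x
  proof -
    have "\<not> (\<forall>i\<in>Basis. a \<bullet> i \<le> x \<bullet> i \<and> x \<bullet> i \<le> b \<bullet> i)"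
      using that unfolding mem_box .
    then obtain i where i: "i \<in> Basis" "x \<bullet> i \<le> a \<bullet> i \<or> b \<bullet> i \<le> x \<bullet> i"
      by (meson le_cases)
    then have "flat_function 1 (real n * (x \<bullet> i - a \<bullet> i)) * flat_function 1 (real n * (b \<bullet> i - x \<bullet> i)) = 0"
      using flat_function_nonpos[of "x \<bullet> i - a \<bullet> i" 1 n] flat_function_nonpos[of "b \<bullet> i - x \<bullet> i" 1 n]
      by (elim disjE) simp_all
    then show ?thesis unfolding box_bump_def using i(1) by (intro prod_zero bexI[of _ i]) simp_all
  qed
  ultimately show ?thesis
    unfolding test_functions_def using assms by (auto intro!: exI[of _ "cbox a b"])
qed

lemma box_bump_bounds: "0 \<le> box_bump n a b x" "box_bump n a b x \<le> 1"
proof -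
  have "0 \<le> flat_function 1 t" "flat_function 1 t \<le> 1" for t by (auto simp: flat_function_def)
  then show "0 \<le> box_bump n a b x" "box_bump n a b x \<le> 1"
    unfolding box_bump_def by (auto intro!: prod_nonneg prod_le_1 mult_le_one)
qed

lemma box_bump_tendsto_indicator: "(\<lambda>n. box_bump n a b x) \<longlonglongrightarrow> indicator (box a b) x"
proof -
  have flat: "(\<lambda>n. flat_function 1 (real n * t)) \<longlonglongrightarrow> indicator {0<..} t" for t
  proof (cases "0 < t")
    case True
    have "(\<lambda>n. exp (- (inverse (real n) * inverse t))) \<longlonglongrightarrow> exp (- (0 * inverse t))"
      by (intro tendsto_intros lim_inverse_n)
    then have "(\<lambda>n. exp (- (inverse (real n) * inverse t))) \<longlonglongrightarrow> indicator {0<..} t"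
      using True by simp
    then show ?thesis
      by (rule Lim_transform_eventually)
        (use True in \<open>auto intro!: eventually_mono[OF eventually_gt_at_top[of 0]] simp: flat_function_def\<close>)
  next
    case False
    then have "flat_function 1 (real n * t) = 0" for n by (intro flat_function_nonpos) auto
    then show ?thesis using False by simp
  qed
  have "(\<lambda>n. box_bump n a b x) \<longlonglongrightarrow>
      (\<Prod>i\<in>Basis. indicator {0<..} (x \<bullet> i - a \<bullet> i) * indicator {0<..} (b \<bullet> i - x \<bullet> i))"
    unfolding box_bump_def by (intro tendsto_intros flat)
  also have "(\<Prod>i\<in>Basis. indicator {0<..} (x \<bullet> i - a \<bullet> i) * indicator {0<..} (b \<bullet> i - x \<bullet> i))
      = (indicator (box a b) x :: real)"
  proof (cases "x \<in> box a b")
    case True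
    then show ?thesis by (simp add: mem_box)
  next
    case False
    then have "\<not> (\<forall>i\<in>Basis. a \<bullet> i < x \<bullet> i \<and> x \<bullet> i < b \<bullet> i)"
      unfolding mem_box .
    then obtain i where i: "i \<in> Basis" "x \<bullet> i \<le> a \<bullet> i \<or> b \<bullet> i \<le> x \<bullet> i"
      by (meson not_less)
    then have "indicator {0<..} (x \<bullet> i - a \<bullet> i) * indicator {0<..} (b \<bullet> i - x \<bullet> i) = (0::real)"
      by (auto simp: indicator_def)
    then show ?thesis using False i(1) by (auto intro!: prod_zero)
  qed
  finally show ?thesis .
qed

section \<open>Test functions and the fundamental lemma\<close>

text \<open>A test function vanishes identically near every point outside its support, hence so does its
  derivative.\<close>

lemma test_functionsE:
  assumes "\<phi> \<in> test_functions \<Omega>"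
  obtains K where "compact K" "K \<subseteq> \<Omega>" "\<And>x. x \<notin> K \<Longrightarrow> \<phi> x = 0"
    "\<And>x v. x \<notin> K \<Longrightarrow> frechet_derivative \<phi> (at x) v = 0"
proof -
  obtain K where K: "compact K" "K \<subseteq> \<Omega>" "\<And>x. x \<notin> K \<Longrightarrow> \<phi> x = 0"
    using assms by (auto simp: test_functions_def)
  have "frechet_derivative \<phi> (at x) v = 0" if "x \<notin> K" for x v
  proof -
    have "((\<lambda>_. 0) has_derivative (\<lambda>_. 0)) (at x)" by simp
    then have "(\<phi> has_derivative (\<lambda>_. 0)) (at x)"
      by (rule has_derivative_transform_within_open[where s = "- K"])
        (use K that in \<open>auto simp: compact_imp_closed\<close>)
    from frechet_derivative_at[OF this, symmetric] show ?thesis by simp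
  qed
  with K that show ?thesis by blast
qed

lemma test_function_derivative:
  assumes "\<phi> \<in> test_functions \<Omega>"
  shows "(\<phi> has_derivative frechet_derivative \<phi> (at x)) (at x)"
proof (rule higher_differentiable_on_SucD[of UNIV _ 0])
  show "higher_differentiable_on UNIV \<phi> (Suc 0)"
    using assms unfolding test_functions_def smooth_on_def by blast
qed simp

lemma test_function_continuous:
  assumes "\<phi> \<in> test_functions \<Omega>"
  shows "continuous_on A \<phi>" "continuous_on A (\<lambda>x. frechet_derivative \<phi> (at x) v)"
proof -
  have "higher_differentiable_on UNIV \<phi> 0" "higher_differentiable_on UNIV \<phi> (Suc 0)"
    using assms unfolding test_functions_def smooth_on_def by blast+
  then have "continuous_on UNIV \<phi>" "continuous_on UNIV (\<lambda>x. frechet_derivative \<phi> (at x) v)"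
    by auto
  then show "continuous_on A \<phi>" "continuous_on A (\<lambda>x. frechet_derivative \<phi> (at x) v)"
    by (auto intro: continuous_on_subset)
qed

lemma bounded_compactly_supported:
  fixes \<psi> :: "'a::euclidean_space \<Rightarrow> real"
  assumes "continuous_on UNIV \<psi>" "compact K" "\<And>x. x \<notin> K \<Longrightarrow> \<psi> x = 0"
  obtains B where "0 \<le> B" "\<And>x. \<bar>\<psi> x\<bar> \<le> B"
proof -
  have "bounded (\<psi> ` K)"
    using assms by (intro compact_imp_bounded compact_continuous_image) (auto intro: continuous_on_subset)
  then obtain B where "\<And>x. x \<in> K \<Longrightarrow> \<bar>\<psi> x\<bar> \<le> B" by (auto simp: bounded_iff)
  then have "\<bar>\<psi> x\<bar> \<le> max 0 B" for x using assms(3)[of x] by (cases "x \<in> K") (auto simp: le_max_iff_disj)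
  then show ?thesis by (intro that[of "max 0 B"]) auto
qed

lemma locally_integrable_times_compactly_supported:
  fixes u :: "'a::euclidean_space \<Rightarrow> real"
  assumes "open \<Omega>" "locally_integrable \<Omega> u"
    and \<psi>: "continuous_on UNIV \<psi>" "compact K" "K \<subseteq> \<Omega>" "\<And>x. x \<notin> K \<Longrightarrow> \<psi> x = 0"
  shows "integrable lebesgue (\<lambda>x. u x * \<psi> x)" "integrable (lebesgue_on \<Omega>) (\<lambda>x. u x * \<psi> x)"
    "(LINT x|lebesgue_on \<Omega>. u x * \<psi> x) = (LINT x|lebesgue. u x * \<psi> x)"
proof -
  obtain B where B: "0 \<le> B" "\<And>x. \<bar>\<psi> x\<bar> \<le> B"
    using bounded_compactly_supported[OF \<psi>(1,2,4)] by blast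
  have u: "integrable lebesgue (\<lambda>x. indicator K x *\<^sub>R u x)"
    using assms by (auto simp: locally_integrable_def set_integrable_def)
  have \<psi>m: "\<psi> \<in> borel_measurable lebesgue"
    using borel_measurable_continuous_onI[OF \<psi>(1)] by (simp add: measurable_completion)
  have "integrable lebesgue (\<lambda>x. (indicator K x *\<^sub>R u x) * \<psi> x)"
  proof (rule Bochner_Integration.integrable_bound)
    show "integrable lebesgue (\<lambda>x. B * (indicator K x *\<^sub>R u x))" using u by auto
    show "AE x in lebesgue. norm ((indicator K x *\<^sub>R u x) * \<psi> x) \<le> norm (B * (indicator K x *\<^sub>R u x))"
      using B by (intro AE_I2) (auto simp: abs_mult mult.commute[of _ "\<psi> _"] intro!: mult_right_mono)
    show "(\<lambda>x. (indicator K x *\<^sub>R u x) * \<psi> x) \<in> borel_measurable lebesgue"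
      using borel_measurable_integrable[OF u] \<psi>m by measurable
  qed
  moreover have "(indicator K x *\<^sub>R u x) * \<psi> x = u x * \<psi> x" for x
    using \<psi>(4)[of x] by (cases "x \<in> K") auto
  ultimately show 1: "integrable lebesgue (\<lambda>x. u x * \<psi> x)" by (simp only:)
  have ind: "(\<lambda>x. indicator \<Omega> x *\<^sub>R (u x * \<psi> x)) = (\<lambda>x. u x * \<psi> x)"
  proof
    show "indicator \<Omega> x *\<^sub>R (u x * \<psi> x) = u x * \<psi> x" for x
      using \<psi>(3) \<psi>(4)[of x] by (cases "x \<in> \<Omega>") auto
  qed
  show "integrable (lebesgue_on \<Omega>) (\<lambda>x. u x * \<psi> x)"
    "(LINT x|lebesgue_on \<Omega>. u x * \<psi> x) = (LINT x|lebesgue. u x * \<psi> x)"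
    using 1 assms(1)
    by (simp_all add: integrable_restrict_space integral_restrict_space ind borel_open
        del: real_scaleR_def)
qed

lemma locally_integrable_test_function:
  fixes u :: "'a::euclidean_space \<Rightarrow> real"
  assumes "open \<Omega>" "locally_integrable \<Omega> u" "\<phi> \<in> test_functions \<Omega>"
  shows "integrable (lebesgue_on \<Omega>) (\<lambda>x. u x * \<phi> x)"
    "integrable (lebesgue_on \<Omega>) (\<lambda>x. u x * frechet_derivative \<phi> (at x) v)"
    "(LINT x|lebesgue_on \<Omega>. u x * \<phi> x) = (LINT x|lebesgue. u x * \<phi> x)"
    "(LINT x|lebesgue_on \<Omega>. u x * frechet_derivative \<phi> (at x) v)
     = (LINT x|lebesgue. u x * frechet_derivative \<phi> (at x) v)"
proof -
  obtain K where K: "compact K" "K \<subseteq> \<Omega>" "\<And>x. x \<notin> K \<Longrightarrow> \<phi> x = 0"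
    "\<And>x v. x \<notin> K \<Longrightarrow> frechet_derivative \<phi> (at x) v = 0"
    using test_functionsE[OF assms(3)] by blast
  note * = locally_integrable_times_compactly_supported[OF assms(1,2) _ K(1,2)]
  note c = test_function_continuous[OF assms(3)]
  show "integrable (lebesgue_on \<Omega>) (\<lambda>x. u x * \<phi> x)"
    "integrable (lebesgue_on \<Omega>) (\<lambda>x. u x * frechet_derivative \<phi> (at x) v)"
    "(LINT x|lebesgue_on \<Omega>. u x * \<phi> x) = (LINT x|lebesgue. u x * \<phi> x)"
    "(LINT x|lebesgue_on \<Omega>. u x * frechet_derivative \<phi> (at x) v)
     = (LINT x|lebesgue. u x * frechet_derivative \<phi> (at x) v)"
    using *[OF c(1) K(3)] *[OF c(2) K(4)] by blast+
qed

text \<open>The boxes are an intersection-stable generator of the Borel sets, so the integral of \<open>f\<close> vanishes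
  over every Borel set.\<close>

lemma AE_zero_if_integral_boxes_zero:
  fixes f :: "'a::euclidean_space \<Rightarrow> real"
  assumes f: "integrable lborel f" and tot: "(LINT x|lborel. f x) = 0"
    and box: "\<And>a b. (LINT x:box a b|lborel. f x) = 0"
  shows "AE x in lborel. f x = 0"
proof (rule sigma_finite_measure.density_zero[OF sigma_finite_lborel f])
  have si: "set_integrable lborel A f" if "A \<in> sets lborel" for A
    using f that unfolding set_integrable_def by (intro integrable_mult_indicator)
  fix A :: "'a set" assume "A \<in> sets lborel"
  then have A: "A \<in> sigma_sets UNIV (range (\<lambda>(a, b). box a b :: 'a set))"
    by (simp add: borel_eq_box sets_measure_of)
  have stable: "Int_stable (range (\<lambda>(a, b). box a b :: 'a set))"
    by (auto simp: Int_stable_def box_Int_box)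
  have "range (\<lambda>(a, b). box a b :: 'a set) \<subseteq> Pow UNIV" by simp
  from stable this A show "(LINT x:A|lborel. f x) = 0"
  proof (induction rule: sigma_sets_induct_disjoint)
    case (basic A)
    then show ?case using box by auto
  next
    case empty
    show ?case by (simp add: set_lebesgue_integral_def)
  next
    case (compl A)
    have A: "A \<in> sets lborel" using compl(1) by (simp add: borel_eq_box sets_measure_of)
    have "(LINT x:UNIV - A|lborel. f x) + (LINT x:A|lborel. f x) = (LINT x:(UNIV - A) \<union> A|lborel. f x)"
      by (rule set_integral_Un[symmetric]) (use A si in auto)
    also have "\<dots> = 0" using tot by (simp add: set_lebesgue_integral_def)
    finally show ?case using compl by simp
  next
    case (union A)
    have A: "A i \<in> sets lborel" for i using union(2) by (simp add: borel_eq_box sets_measure_of image_subset_iff)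
    have "(LINT x:(\<Union>i. A i)|lborel. f x) = (\<Sum>i. (LINT x:A i|lborel. f x))"
      by (rule lebesgue_integral_countable_add) (use A union(1) si in \<open>auto simp: disjoint_family_on_def\<close>)
    then show ?case using union by simp
  qed
qed

text \<open>Testing with the bumps \<open>box_bump n a b\<close> and passing to the limit, the integral of \<open>k\<close> vanishes over
  every box with closure in \<open>\<Omega>\<close>. This makes \<open>k\<close> zero almost everywhere on each such box, and countably
  many of them cover \<open>\<Omega>\<close>.\<close>

theorem fundamental_lemma_calculus_of_variations:
  fixes k :: "'a::euclidean_space \<Rightarrow> real"
  assumes \<Omega>: "open \<Omega>" and k: "locally_integrable \<Omega> k"
    and zero: "\<And>\<phi>. \<phi> \<in> test_functions \<Omega> \<Longrightarrow> (LINT x|lebesgue_on \<Omega>. k x * \<phi> x) = 0"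
  shows "AE x in lebesgue_on \<Omega>. k x = 0"
proof -
  have int_cbox: "integrable lebesgue (\<lambda>x. indicator (cbox a b) x * k x)" if "cbox a b \<subseteq> \<Omega>" for a b
    using k that by (auto simp: locally_integrable_def set_integrable_def)
  have box: "(LINT x|lebesgue. indicator (box a b) x * k x) = 0" if ab: "cbox a b \<subseteq> \<Omega>" for a b
  proof -
    have km: "(\<lambda>x. indicator (cbox a b) x * k x) \<in> borel_measurable lebesgue"
      using int_cbox[OF ab] by auto
    have bm: "box_bump n a b \<in> borel_measurable lebesgue" for n
      using borel_measurable_continuous_onI[OF test_function_continuous(1)[OF box_bump_test_function[OF ab]]]
      by (simp add: measurable_completion)
    have supp: "k x * box_bump n a b x = (indicator (cbox a b) x * k x) * box_bump n a b x" for n x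
    proof (cases "x \<in> cbox a b")
      case False
      then have "box_bump n a b x = 0"
        using box_bump_test_function[of a b "cbox a b" n] by (auto simp: test_functions_def)
      then show ?thesis by simp
    qed simp
    have "(\<lambda>n. LINT x|lebesgue. (indicator (cbox a b) x * k x) * box_bump n a b x) \<longlonglongrightarrow>
        (LINT x|lebesgue. (indicator (cbox a b) x * k x) * indicator (box a b) x)"
    proof (rule integral_dominated_convergence[where w = "\<lambda>x. \<bar>indicator (cbox a b) x * k x\<bar>"])
      show "AE x in lebesgue. (\<lambda>n. (indicator (cbox a b) x * k x) * box_bump n a b x)
          \<longlonglongrightarrow> (indicator (cbox a b) x * k x) * indicator (box a b) x"
        by (intro AE_I2 tendsto_intros box_bump_tendsto_indicator)
      show "AE x in lebesgue. norm ((indicator (cbox a b) x * k x) * box_bump n a b x)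
          \<le> \<bar>indicator (cbox a b) x * k x\<bar>" for n
        using box_bump_bounds[of n a b] by (intro AE_I2) (simp add: abs_mult mult_left_le)
      show "(\<lambda>x. (indicator (cbox a b) x * k x) * indicator (box a b) x) \<in> borel_measurable lebesgue"
        by (intro borel_measurable_times km borel_measurable_indicator) auto
      show "(\<lambda>x. (indicator (cbox a b) x * k x) * box_bump n a b x) \<in> borel_measurable lebesgue" for n
        by (intro borel_measurable_times km bm)
      show "integrable lebesgue (\<lambda>x. \<bar>indicator (cbox a b) x * k x\<bar>)"
        by (intro integrable_abs int_cbox[OF ab])
    qed
    moreover have "(LINT x|lebesgue. (indicator (cbox a b) x * k x) * box_bump n a b x) = 0" for n
      using zero[OF box_bump_test_function[OF ab, of n]]
        locally_integrable_test_function(3)[OF \<Omega> k box_bump_test_function[OF ab, of n]]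
      by (simp add: supp)
    ultimately have "(LINT x|lebesgue. (indicator (cbox a b) x * k x) * indicator (box a b) x) = 0"
      by (simp only: LIMSEQ_const_iff)
    moreover have "(indicator (cbox a b) x * k x) * indicator (box a b) x = indicator (box a b) x * k x" for x
      using box_subset_cbox[of a b] by (auto simp: indicator_def)
    ultimately show ?thesis by simp
  qed
  have AE_cbox: "AE x in lebesgue. x \<in> cbox c d \<longrightarrow> k x = 0" if cd: "cbox c d \<subseteq> \<Omega>" for c d
  proof -
    let ?f = "\<lambda>x. indicator (box c d) x * k x"
    have f: "integrable lebesgue ?f"
    proof -
      have "integrable lebesgue (\<lambda>x. indicator (box c d) x *\<^sub>R (indicator (cbox c d) x * k x))"
        by (intro integrable_mult_indicator int_cbox[OF cd]) auto
      moreover have "indicator (box c d) x *\<^sub>R (indicator (cbox c d) x * k x) = ?f x" for x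
        using box_subset_cbox[of c d] by (auto simp: indicator_def)
      ultimately show ?thesis by (simp only:)
    qed
    \<comment> \<open>The criterion for boxes concerns Borel functions; pass to a Borel version of \<open>?f\<close>.\<close>
    obtain f' where f': "f' \<in> borel_measurable lborel" "AE x in lborel. ?f x = f' x"
      using completion_ex_borel_measurable_real[of ?f lborel] borel_measurable_integrable[OF f] by auto
    have f'_int: "integrable lborel f'"
    proof -
      have "integrable lebesgue f'"
        using f f' by (subst integrable_cong_AE[of f' _ ?f]) (auto intro: AE_completion measurable_completion)
      then show ?thesis using f'(1) by (simp add: integrable_completion)
    qed
    have boxes: "(LINT x:box a b|lborel. f' x) = (LINT x|lebesgue. indicator (box a b) x * ?f x)" for a b
    proof -
      have "(LINT x:box a b|lborel. f' x) = (LINT x|lebesgue. indicator (box a b) x * f' x)"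
        unfolding set_lebesgue_integral_def using f'(1) by (subst integral_completion) auto
      also have "\<dots> = (LINT x|lebesgue. indicator (box a b) x * ?f x)"
      proof (rule integral_cong_AE)
        show "(\<lambda>x. indicator (box a b) x * f' x) \<in> borel_measurable lebesgue"
          using f'(1) by (intro measurable_completion) auto
        show "(\<lambda>x. indicator (box a b) x * ?f x) \<in> borel_measurable lebesgue"
          by (rule borel_measurable_times[OF _ borel_measurable_integrable[OF f]])
            (auto intro: borel_measurable_indicator)
        show "AE x in lebesgue. indicator (box a b) x * f' x = indicator (box a b) x * ?f x"
          using AE_completion[OF f'(2)] by eventually_elim simp
      qed
      finally show ?thesis .
    qed
    have sub: "(LINT x|lebesgue. indicator (box a b) x * ?f x) = 0" for a b
    proof -
      obtain a' b' where ab': "box a b \<inter> box c d = box a' b'" by (simp add: box_Int_box)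
      have "indicator (box a b) x * ?f x = indicator (box a' b') x * k x" for x
        by (simp add: ab'[symmetric] indicator_inter_arith mult.assoc)
      moreover have "(LINT x|lebesgue. indicator (box a' b') x * k x) = 0"
      proof (cases "box a' b' = {}")
        case False
        then have "cbox a' b' \<subseteq> cbox c d"
          using closure_mono[of "box a' b'" "cbox c d"] ab' box_subset_cbox[of c d] by (auto simp: closure_box)
        then show ?thesis using cd by (intro box) auto
      qed simp
      ultimately show ?thesis by (simp only:)
    qed
    have "(LINT x|lborel. f' x) = (LINT x|lebesgue. f' x)"
      using f'(1) by (simp add: integral_completion)
    also have "\<dots> = (LINT x|lebesgue. ?f x)"
      using f f' by (intro integral_cong_AE) (auto intro: AE_completion measurable_completion)
    also have "\<dots> = 0" by (rule box[OF cd])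
    finally have "AE x in lborel. f' x = 0"
      using AE_zero_if_integral_boxes_zero[OF f'_int] boxes sub by simp
    with f'(2) have "AE x in lborel. ?f x = 0" by eventually_elim simp
    then have "AE x in lebesgue. ?f x = 0" by (rule AE_completion)
    moreover have "AE x in lebesgue. x \<notin> cbox c d - box c d"
      using negligible_frontier_interval[of c d] by (intro AE_not_in) (simp add: negligible_iff_null_sets)
    ultimately show ?thesis
      by eventually_elim (auto simp: indicator_def split: if_splits)
  qed
  obtain \<D> where D: "countable \<D>" "\<D> \<subseteq> Pow \<Omega>" "\<And>X. X \<in> \<D> \<Longrightarrow> \<exists>a b. X = cbox a b" "\<Union>\<D> = \<Omega>"
    using open_countable_Union_open_cbox[OF \<Omega>] by metis
  have "AE x in lebesgue. \<forall>X\<in>\<D>. x \<in> X \<longrightarrow> k x = 0"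
  proof (subst AE_ball_countable[OF D(1)], intro ballI)
    fix X assume "X \<in> \<D>"
    then show "AE x in lebesgue. x \<in> X \<longrightarrow> k x = 0" using D AE_cbox by (metis PowD subsetD)
  qed
  then have "AE x in lebesgue. x \<in> \<Omega> \<longrightarrow> k x = 0"
    by eventually_elim (use D(4) in auto)
  then show ?thesis using \<Omega> by (simp add: AE_restrict_space_iff borel_open)
qed


lemma lborel_shift:
  fixes c :: "'a::euclidean_space"
  shows integral_lborel_shift:
      "f \<in> borel_measurable borel \<Longrightarrow> (LINT x|lborel. f (x + c)) = (LINT x|lborel. (f x :: real))"
    and integrable_lborel_shift:
      "f \<in> borel_measurable borel \<Longrightarrow> integrable lborel (\<lambda>x. f (x + c)) \<longleftrightarrow> integrable lborel f"
    and nn_integral_lborel_shift: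
      "e \<in> borel_measurable borel \<Longrightarrow> (\<integral>\<^sup>+x. e (x + c) \<partial>lborel) = (\<integral>\<^sup>+x. e x \<partial>lborel)"
proof -
  have c: "(+) c \<in> measurable lborel borel" by simp
  show "(LINT x|lborel. f (x + c)) = (LINT x|lborel. f x)" if "f \<in> borel_measurable borel"
    using integral_distr[OF c that] by (simp add: lborel_distr_plus add.commute)
  show "integrable lborel (\<lambda>x. f (x + c)) \<longleftrightarrow> integrable lborel f" if "f \<in> borel_measurable borel"
    using integrable_distr_eq[OF c that] by (simp add: lborel_distr_plus add.commute)
  show "(\<integral>\<^sup>+x. e (x + c) \<partial>lborel) = (\<integral>\<^sup>+x. e x \<partial>lborel)" if "e \<in> borel_measurable borel"
    using nn_integral_distr[OF c, of e] that by (simp add: lborel_distr_plus add.commute)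
qed

lemma test_function_line_derivative:
  assumes "\<phi> \<in> test_functions \<Omega>"
  shows "((\<lambda>t. \<phi> (x + t *\<^sub>R v)) has_real_derivative frechet_derivative \<phi> (at (x + t *\<^sub>R v)) v) (at t)"
proof -
  let ?D = "frechet_derivative \<phi> (at (x + t *\<^sub>R v))"
  have D: "(\<phi> has_derivative ?D) (at (x + t *\<^sub>R v))" by (rule test_function_derivative[OF assms])
  have "((\<lambda>t. x + t *\<^sub>R v) has_derivative (\<lambda>s. s *\<^sub>R v)) (at t)"
    by (auto intro!: derivative_eq_intros)
  from has_derivative_compose[OF this D]
  have "((\<lambda>t. \<phi> (x + t *\<^sub>R v)) has_derivative (\<lambda>s. ?D (s *\<^sub>R v))) (at t)" .
  moreover have "?D (s *\<^sub>R v) = ?D v * s" for s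
    using has_derivative_linear[OF D] by (simp add: linear_cmul)
  ultimately show ?thesis by (simp add: has_field_derivative_def)
qed

text \<open>Translation invariance makes the integral of every difference quotient zero; the mean value theorem
  dominates them by the supremum of the derivative on a fixed ball.\<close>

lemma integral_test_function_derivative:
  fixes \<phi> :: "'a::euclidean_space \<Rightarrow> real"
  assumes \<phi>: "\<phi> \<in> test_functions \<Omega>"
  shows "(LINT x|lborel. frechet_derivative \<phi> (at x) v) = 0"
proof -
  obtain K where K: "compact K" "\<And>x. x \<notin> K \<Longrightarrow> \<phi> x = 0"
    "\<And>x. x \<notin> K \<Longrightarrow> frechet_derivative \<phi> (at x) v = 0"
    using test_functionsE[OF \<phi>] by metis
  let ?d = "\<lambda>x. frechet_derivative \<phi> (at x) v"
  have m [measurable]: "\<phi> \<in> borel_measurable borel" "?d \<in> borel_measurable borel"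
    by (intro borel_measurable_continuous_onI test_function_continuous[OF \<phi>])+
  obtain B where B: "0 \<le> B" "\<And>x. \<bar>?d x\<bar> \<le> B"
    using bounded_compactly_supported[OF test_function_continuous(2)[OF \<phi>] K(1,3)] by blast
  obtain R where R: "0 < R" "\<And>x. x \<in> K \<Longrightarrow> norm x \<le> R"
    using compact_imp_bounded[OF K(1)] by (auto simp: bounded_pos)
  have \<phi>int: "integrable lborel \<phi>"
  proof -
    have "integrable lborel (\<lambda>x. indicator K x *\<^sub>R \<phi> x)"
      by (intro borel_integrable_compact K(1) test_function_continuous[OF \<phi>])
    moreover have "indicator K x *\<^sub>R \<phi> x = \<phi> x" for x using K(2)[of x] by (cases "x \<in> K") auto
    ultimately show ?thesis by (simp only:)
  qed
  define s where "s n x = real (Suc n) * (\<phi> (x + (1 / real (Suc n)) *\<^sub>R v) - \<phi> x)" for n x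
  have sm [measurable]: "s n \<in> borel_measurable borel" for n unfolding s_def by measurable
  have s_eq: "\<exists>t\<in>{0..1}. s n x = ?d (x + t *\<^sub>R v)" for n x
  proof -
    let ?h = "1 / real (Suc n)"
    have "0 < ?h" by simp
    from MVT2[OF this test_function_line_derivative[OF \<phi>, of x v]]
    obtain z where z: "0 < z" "z < ?h" "\<phi> (x + ?h *\<^sub>R v) - \<phi> (x + 0 *\<^sub>R v) = (?h - 0) * ?d (x + z *\<^sub>R v)"
      by blast
    have "?h \<le> 1" by simp
    with z(1,2) have "z \<in> {0..1}" unfolding atLeastAtMost_iff by linarith
    moreover have "s n x = ?d (x + z *\<^sub>R v)" unfolding s_def using z(3) by (simp del: of_nat_Suc)
    ultimately show ?thesis by blast
  qed
  have s_bound: "\<bar>s n x\<bar> \<le> B * indicator (cball 0 (R + norm v)) x" for n x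
  proof -
    obtain t where t: "t \<in> {0..1}" "s n x = ?d (x + t *\<^sub>R v)" using s_eq by blast
    show ?thesis
    proof (cases "x + t *\<^sub>R v \<in> K")
      case True
      have "norm x \<le> norm (x + t *\<^sub>R v) + norm (t *\<^sub>R v)"
        using norm_triangle_ineq4[of "x + t *\<^sub>R v" "t *\<^sub>R v"] by simp
      also have "norm (t *\<^sub>R v) \<le> norm v" using t(1) by (simp add: mult_left_le_one_le)
      finally have "x \<in> cball 0 (R + norm v)" using R(2)[OF True] by simp
      then show ?thesis using B(2) t(2) by simp
    next
      case False
      then show ?thesis using K(3) t(2) B(1) by simp
    qed
  qed
  have "(\<lambda>n. LINT x|lborel. s n x) \<longlonglongrightarrow> (LINT x|lborel. ?d x)"
  proof (rule integral_dominated_convergence[where w = "\<lambda>x. B * indicator (cball 0 (R + norm v)) x"])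
    show "integrable lborel (\<lambda>x. B * indicator (cball 0 (R + norm v)) x)"
      by (intro integrable_mult_right integrable_real_indicator) (simp_all add: emeasure_lborel_cball_finite[simplified])
    show "AE x in lborel. (\<lambda>n. s n x) \<longlonglongrightarrow> ?d x"
    proof (rule AE_I2)
      fix x
      have "((\<lambda>h. (\<phi> (x + h *\<^sub>R v) - \<phi> x) / h) \<longlongrightarrow> ?d x) (at 0)"
        using test_function_line_derivative[OF \<phi>, of x v 0] by (simp add: DERIV_def)
      moreover have "filterlim (\<lambda>n. 1 / real (Suc n)) (at 0) sequentially"
        unfolding filterlim_at using LIMSEQ_Suc[OF lim_1_over_n] by auto
      ultimately have "(\<lambda>n. (\<phi> (x + (1 / real (Suc n)) *\<^sub>R v) - \<phi> x) / (1 / real (Suc n))) \<longlonglongrightarrow> ?d x"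
        by (rule filterlim_compose)
      then show "(\<lambda>n. s n x) \<longlonglongrightarrow> ?d x" by (simp add: s_def mult.commute)
    qed
    show "AE x in lborel. norm (s n x) \<le> B * indicator (cball 0 (R + norm v)) x" for n
      using s_bound by auto
  qed auto
  moreover have "(LINT x|lborel. s n x) = 0" for n
    using \<phi>int by (simp add: s_def integral_lborel_shift integrable_lborel_shift)
  ultimately show ?thesis by (simp add: LIMSEQ_const_iff)
qed

section \<open>Weak gradients\<close>

lemma locally_integrable_inner:
  "locally_integrable \<Omega> g \<Longrightarrow> locally_integrable \<Omega> (\<lambda>x. g x \<bullet> i)"
  unfolding locally_integrable_def set_integrable_def
proof (intro allI impI)
  fix K assume "\<forall>K. compact K \<and> K \<subseteq> \<Omega> \<longrightarrow> integrable lebesgue (\<lambda>x. indicat_real K x *\<^sub>R g x)" "compact K \<and> K \<subseteq> \<Omega>"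
  then have "integrable lebesgue (\<lambda>x. (indicat_real K x *\<^sub>R g x) \<bullet> i)" by (intro integrable_inner_left) auto
  then show "integrable lebesgue (\<lambda>x. indicat_real K x *\<^sub>R (g x \<bullet> i))" by simp
qed

lemma locally_integrable_lincomb:
  "locally_integrable \<Omega> u \<Longrightarrow> locally_integrable \<Omega> v \<Longrightarrow>
   locally_integrable \<Omega> (\<lambda>x. a *\<^sub>R u x + b *\<^sub>R v x)"
  unfolding locally_integrable_def set_integrable_def
proof (intro allI impI)
  fix K assume *: "\<forall>K. compact K \<and> K \<subseteq> \<Omega> \<longrightarrow> integrable lebesgue (\<lambda>x. indicat_real K x *\<^sub>R u x)"
    "\<forall>K. compact K \<and> K \<subseteq> \<Omega> \<longrightarrow> integrable lebesgue (\<lambda>x. indicat_real K x *\<^sub>R v x)"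
    "compact K \<and> K \<subseteq> \<Omega>"
  then have "integrable lebesgue (\<lambda>x. a *\<^sub>R (indicat_real K x *\<^sub>R u x) + b *\<^sub>R (indicat_real K x *\<^sub>R v x))"
    by (intro Bochner_Integration.integrable_add integrable_scaleR_right) simp_all
  then show "integrable lebesgue (\<lambda>x. indicat_real K x *\<^sub>R (a *\<^sub>R u x + b *\<^sub>R v x))"
    by (simp add: scaleR_add_right mult.commute)
qed

lemma locally_integrable_const: "locally_integrable \<Omega> (\<lambda>_. c)"
  unfolding locally_integrable_def set_integrable_def
proof (intro allI impI integrable_scaleR_left integrable_real_indicator)
  fix K assume "compact K \<and> K \<subseteq> \<Omega>"
  then have "K \<in> lmeasurable" by (simp add: lmeasurable_compact)
  then show "K \<in> sets lebesgue" "emeasure lebesgue K < \<infinity>" unfolding fmeasurable_def by blast+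
qed

lemma weak_gradient_lincomb:
  assumes "open \<Omega>" and u: "weak_gradient \<Omega> u g" and v: "weak_gradient \<Omega> v h"
  shows "weak_gradient \<Omega> (\<lambda>x. a * u x + b * v x) (\<lambda>x. a *\<^sub>R g x + b *\<^sub>R h x)"
  unfolding weak_gradient_def
proof (intro conjI ballI)
  have li: "locally_integrable \<Omega> u" "locally_integrable \<Omega> v" "locally_integrable \<Omega> g" "locally_integrable \<Omega> h"
    using u v by (auto simp: weak_gradient_def)
  show "locally_integrable \<Omega> (\<lambda>x. a * u x + b * v x)"
    using locally_integrable_lincomb[OF li(1,2), of a b] by simp
  show "locally_integrable \<Omega> (\<lambda>x. a *\<^sub>R g x + b *\<^sub>R h x)"
    using locally_integrable_lincomb[OF li(3,4)] .
  fix \<phi> and i :: 'a assume \<phi>: "\<phi> \<in> test_functions \<Omega>" and i: "i \<in> Basis"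
  note I = locally_integrable_test_function[OF assms(1) _ \<phi>]
  let ?d = "\<lambda>x. frechet_derivative \<phi> (at x) i"
  have "(LINT x|lebesgue_on \<Omega>. (a * u x + b * v x) * ?d x)
      = a * (LINT x|lebesgue_on \<Omega>. u x * ?d x) + b * (LINT x|lebesgue_on \<Omega>. v x * ?d x)"
    using I(2)[OF li(1), of i] I(2)[OF li(2), of i] by (simp add: distrib_right mult.assoc)
  also have "\<dots> = - (a * (LINT x|lebesgue_on \<Omega>. (g x \<bullet> i) * \<phi> x) + b * (LINT x|lebesgue_on \<Omega>. (h x \<bullet> i) * \<phi> x))"
    using u v \<phi> i by (simp add: weak_gradient_def)
  also have "\<dots> = - (LINT x|lebesgue_on \<Omega>. ((a *\<^sub>R g x + b *\<^sub>R h x) \<bullet> i) * \<phi> x)"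
    using I(1)[OF locally_integrable_inner[OF li(3)], of i] I(1)[OF locally_integrable_inner[OF li(4)], of i]
    by (simp add: distrib_right mult.assoc inner_add_left)
  finally show "(LINT x|lebesgue_on \<Omega>. (a * u x + b * v x) * ?d x)
      = - (LINT x|lebesgue_on \<Omega>. ((a *\<^sub>R g x + b *\<^sub>R h x) \<bullet> i) * \<phi> x)" .
qed

lemma weak_gradient_unique:
  assumes "open \<Omega>" "weak_gradient \<Omega> u g" "weak_gradient \<Omega> u h"
  shows "AE x in lebesgue_on \<Omega>. g x = h x"
proof -
  have z: "weak_gradient \<Omega> (\<lambda>x. 0) (\<lambda>x. g x - h x)"
    using weak_gradient_lincomb[OF assms, of 1 "-1"] by simp
  have "AE x in lebesgue_on \<Omega>. (g x - h x) \<bullet> i = 0" if i: "i \<in> Basis" for i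
  proof (rule fundamental_lemma_calculus_of_variations[OF assms(1)])
    show "locally_integrable \<Omega> (\<lambda>x. (g x - h x) \<bullet> i)"
      using z by (intro locally_integrable_inner) (simp add: weak_gradient_def)
    show "(LINT x|lebesgue_on \<Omega>. (g x - h x) \<bullet> i * \<phi> x) = 0" if "\<phi> \<in> test_functions \<Omega>" for \<phi>
      using z that i by (simp add: weak_gradient_def)
  qed
  then have "AE x in lebesgue_on \<Omega>. \<forall>i\<in>Basis. (g x - h x) \<bullet> i = 0"
    by (simp add: AE_ball_countable countable_finite)
  then show ?thesis
  proof eventually_elim
    case (elim x)
    then show ?case by (subst euclidean_eq_iff) (simp add: inner_diff_left)
  qed
qed

text \<open>The integral of a derivative of a test function vanishes.\<close>

lemma weak_gradient_const:
  fixes \<Omega> :: "'a::euclidean_space set"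
  assumes "open \<Omega>"
  shows "weak_gradient \<Omega> (\<lambda>_. c) (\<lambda>_. 0)"
  unfolding weak_gradient_def
proof (intro conjI ballI locally_integrable_const)
  fix \<phi> and i :: 'a assume \<phi>: "\<phi> \<in> test_functions \<Omega>"
  have "(LINT x|lebesgue. c * frechet_derivative \<phi> (at x) i)
      = (LINT x|lborel. c * frechet_derivative \<phi> (at x) i)"
    using borel_measurable_continuous_onI[OF test_function_continuous(2)[OF \<phi>, of UNIV i]]
    by (intro integral_completion) simp
  then show "(LINT x|lebesgue_on \<Omega>. c * frechet_derivative \<phi> (at x) i) = - (LINT x|lebesgue_on \<Omega>. (0 \<bullet> i) * \<phi> x)"
    using locally_integrable_test_function(4)[OF assms locally_integrable_const[of \<Omega> c] \<phi>, of i]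
      integral_test_function_derivative[OF \<phi>, of i] by auto
qed

section \<open>Translates of a function with a weak gradient\<close>

text \<open>Jensen's inequality: integrate the subgradient inequality at the mean of \<open>f\<close>. The right-hand side may be
  infinite; if it is finite, \<open>f\<close> is integrable.\<close>

lemma powr_norm_integral_le:
  fixes f :: "'a \<Rightarrow> real"
  assumes N: "emeasure N (space N) = 1" and p: "1 < p" and f [measurable]: "f \<in> borel_measurable N"
  shows "ennreal (\<bar>\<integral>t. f t \<partial>N\<bar> powr p) \<le> (\<integral>\<^sup>+t. ennreal (\<bar>f t\<bar> powr p) \<partial>N)"
proof (cases "(\<integral>\<^sup>+t. ennreal (\<bar>f t\<bar> powr p) \<partial>N) = \<infinity>")
  case False
  interpret finite_measure N using N by (intro finite_measureI) simp
  have one: "measure N (space N) = 1" using N by (simp add: measure_def)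
  have fp: "integrable N (\<lambda>t. \<bar>f t\<bar> powr p)"
    using False by (intro integrableI_nonneg) (auto simp: less_top)
  have "integrable N (\<lambda>t. 1 + \<bar>f t\<bar> powr p)" using fp by auto
  then have fi: "integrable N f"
    by (rule Bochner_Integration.integrable_bound)
      (use le_add_powr_scaled[of "\<bar>f _\<bar>" 1 p] p in \<open>auto intro!: AE_I2 simp: add_nonneg_nonneg\<close>)
  define c where "c = (\<integral>t. f t \<partial>N)"
  have "\<bar>c\<bar> powr p = (\<integral>t. norm c powr p + p * (duality_map p c \<bullet> (f t - c)) \<partial>N)"
    using fi one by (simp add: c_def)
  also have "\<dots> \<le> (\<integral>t. norm (f t) powr p \<partial>N)"
    using fi fp powr_norm_subgradient[OF p, of c "f _"] by (intro integral_mono) auto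
  finally have "\<bar>c\<bar> powr p \<le> (\<integral>t. \<bar>f t\<bar> powr p \<partial>N)" by simp
  then show ?thesis
    by (subst nn_integral_eq_integral[OF fp]) (auto simp: c_def intro!: ennreal_leI)
qed simp

lemma higher_differentiable_shift:
  "higher_differentiable_on UNIV f k \<Longrightarrow> higher_differentiable_on UNIV (\<lambda>x. f (x + c)) k"
proof (induction k arbitrary: f)
  case 0
  then show ?case by (auto intro!: continuous_on_compose2[of UNIV f] continuous_intros)
next
  case (Suc k)
  show ?case
  proof (rule higher_differentiable_on_UNIV_SucI)
    fix x
    have "((\<lambda>x. x + c) has_derivative (\<lambda>h. h)) (at x)" by (auto intro!: derivative_eq_intros)
    from has_derivative_compose[OF this higher_differentiable_on_SucD[OF Suc.prems UNIV_I]]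
    show "((\<lambda>x. f (x + c)) has_derivative frechet_derivative f (at (x + c))) (at x)" .
    show "higher_differentiable_on UNIV (\<lambda>x. frechet_derivative f (at (x + c)) v) k" for v
      using Suc.prems by (intro Suc.IH) auto
  qed
qed

lemma test_function_shift:
  assumes \<phi>: "\<phi> \<in> test_functions V" and sub: "\<And>x. x \<in> V \<Longrightarrow> x + c \<in> \<Omega>"
  shows "(\<lambda>y. \<phi> (y - c)) \<in> test_functions \<Omega>"
    and "frechet_derivative (\<lambda>y. \<phi> (y - c)) (at y) = frechet_derivative \<phi> (at (y - c))"
proof -
  obtain K where K: "compact K" "K \<subseteq> V" "\<And>x. x \<notin> K \<Longrightarrow> \<phi> x = 0"
    using \<phi> by (auto simp: test_functions_def)
  have "smooth_on UNIV (\<lambda>y. \<phi> (y - c))"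
    using \<phi> higher_differentiable_shift[of \<phi> _ "- c"] by (auto simp: test_functions_def smooth_on_def)
  moreover have "compact ((\<lambda>x. x + c) ` K)"
    by (intro compact_continuous_image K(1) continuous_intros)
  moreover have "(\<lambda>x. x + c) ` K \<subseteq> \<Omega>" using K(2) sub by auto
  moreover have "\<phi> (y - c) = 0" if "y \<notin> (\<lambda>x. x + c) ` K" for y
    using that by (intro K(3)) (force intro: image_eqI[of _ _ "y - c"])
  ultimately show "(\<lambda>y. \<phi> (y - c)) \<in> test_functions \<Omega>"
    unfolding test_functions_def by blast
  have "((\<lambda>y. y - c) has_derivative (\<lambda>h. h)) (at y)" by (auto intro!: derivative_eq_intros)
  from has_derivative_compose[OF this test_function_derivative[OF \<phi>]]
  show "frechet_derivative (\<lambda>y. \<phi> (y - c)) (at y) = frechet_derivative \<phi> (at (y - c))"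
    by (rule frechet_derivative_at[symmetric])
qed

text \<open>The fundamental theorem of calculus along segments \<open>x + t *\<^sub>R h\<close>, \<open>0 \<le> t \<le> 1\<close>, and Fubini's theorem for
  the product of \<open>x\<close> and \<open>t\<close> need a measure for the parameter \<open>t\<close>.\<close>

abbreviation unit_interval :: "real measure" where
  "unit_interval \<equiv> restrict_space lborel {0..1}"

lemma emeasure_unit_interval:
  "emeasure unit_interval (space unit_interval) = 1" "emeasure unit_interval {0..1} = 1"
  by (simp_all add: emeasure_restrict_space space_restrict_space)

interpretation unit_interval: finite_measure unit_interval
  by (rule finite_measureI) (simp add: emeasure_unit_interval)

interpretation lborel_unit: pair_sigma_finite "lborel :: 'a::euclidean_space measure" unit_interval
  by (intro pair_sigma_finite.intro sigma_finite_lborel unit_interval.sigma_finite_measure_axioms)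

lemma measurable_unit_interval_ident: "(\<lambda>t. t) \<in> borel_measurable unit_interval"
  by (rule measurable_restrict_space1) simp

lemma measurable_shear [measurable]:
  fixes h :: "'a::euclidean_space"
  shows "(\<lambda>z. fst z + snd z *\<^sub>R h) \<in> borel_measurable (lborel \<Otimes>\<^sub>M unit_interval)"
    "(\<lambda>z. fst z - snd z *\<^sub>R h) \<in> borel_measurable (lborel \<Otimes>\<^sub>M unit_interval)"
proof -
  have [measurable]: "(\<lambda>z :: 'a \<times> real. fst z) \<in> borel_measurable (lborel \<Otimes>\<^sub>M unit_interval)"
    using measurable_fst[of "lborel :: 'a measure" unit_interval] by (simp add: measurable_lborel2)
  have [measurable]: "(\<lambda>z :: 'a \<times> real. snd z) \<in> borel_measurable (lborel \<Otimes>\<^sub>M unit_interval)"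
    by (rule measurable_compose[OF measurable_snd measurable_unit_interval_ident])
  show "(\<lambda>z. fst z + snd z *\<^sub>R h) \<in> borel_measurable (lborel \<Otimes>\<^sub>M unit_interval)"
    "(\<lambda>z. fst z - snd z *\<^sub>R h) \<in> borel_measurable (lborel \<Otimes>\<^sub>M unit_interval)"
    by measurable
qed

text \<open>By translation invariance the inner integral over \<open>x\<close> does not depend on \<open>t\<close>.\<close>

lemma nn_integral_shear:
  fixes h :: "'a::euclidean_space" and e :: "'a \<Rightarrow> ennreal"
  assumes [measurable]: "e \<in> borel_measurable borel"
  shows "(\<integral>\<^sup>+x. \<integral>\<^sup>+t. e (x + t *\<^sub>R h) \<partial>unit_interval \<partial>lborel) = (\<integral>\<^sup>+x. e x \<partial>lborel)"
proof -
  have m: "(\<lambda>z. e (fst z + snd z *\<^sub>R h)) \<in> borel_measurable (lborel \<Otimes>\<^sub>M unit_interval)" by measurable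
  have "(\<integral>\<^sup>+x. \<integral>\<^sup>+t. e (x + t *\<^sub>R h) \<partial>unit_interval \<partial>lborel)
      = (\<integral>\<^sup>+t. \<integral>\<^sup>+x. e (x + t *\<^sub>R h) \<partial>lborel \<partial>unit_interval)"
    using lborel_unit.Fubini[OF m] by simp
  also have "\<dots> = (\<integral>\<^sup>+t. (\<integral>\<^sup>+x. e x \<partial>lborel) \<partial>unit_interval)"
    by (simp add: nn_integral_lborel_shift)
  also have "\<dots> = (\<integral>\<^sup>+x. e x \<partial>lborel)" by (simp add: emeasure_unit_interval)
  finally show ?thesis .
qed

lemma integrable_shear:
  fixes f :: "'a::euclidean_space \<Rightarrow> real"
  assumes f: "integrable lborel f" and [measurable]: "f \<in> borel_measurable borel"
  shows "integrable (lborel \<Otimes>\<^sub>M unit_interval) (\<lambda>z. f (fst z + snd z *\<^sub>R h))"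
proof (rule integrableI_bounded)
  show m: "(\<lambda>z. f (fst z + snd z *\<^sub>R h)) \<in> borel_measurable (lborel \<Otimes>\<^sub>M unit_interval)" by measurable
  have "(\<integral>\<^sup>+z. ennreal (norm (f (fst z + snd z *\<^sub>R h))) \<partial>(lborel \<Otimes>\<^sub>M unit_interval))
      = (\<integral>\<^sup>+x. ennreal (norm (f x)) \<partial>lborel)"
    by (subst unit_interval.nn_integral_fst[symmetric]) (simp_all add: nn_integral_shear[of "\<lambda>x. ennreal \<bar>f x\<bar>"])
  then show "(\<integral>\<^sup>+z. ennreal (norm (f (fst z + snd z *\<^sub>R h))) \<partial>(lborel \<Otimes>\<^sub>M unit_interval)) < \<infinity>"
    using f by (simp add: integrable_iff_bounded)
qed

lemma integrable_times_bounded: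
  fixes f g :: "'a \<Rightarrow> real"
  assumes f: "integrable M f" and [measurable]: "g \<in> borel_measurable M" and B: "\<And>x. \<bar>g x\<bar> \<le> B"
  shows "integrable M (\<lambda>x. f x * g x)"
proof (rule Bochner_Integration.integrable_bound)
  show "integrable M (\<lambda>x. B * \<bar>f x\<bar>)" using f by auto
  show "AE x in M. norm (f x * g x) \<le> norm (B * \<bar>f x\<bar>)"
  proof (rule AE_I2)
    fix x
    have "\<bar>g x\<bar> * \<bar>f x\<bar> \<le> B * \<bar>f x\<bar>" by (intro mult_right_mono B) simp
    moreover have "0 \<le> B" using B[of x] by linarith
    ultimately show "norm (f x * g x) \<le> norm (B * \<bar>f x\<bar>)" by (simp add: abs_mult mult.commute)
  qed
  show "(\<lambda>x. f x * g x) \<in> borel_measurable M" using f by measurable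
qed

lemma integrable_imp_locally_integrable:
  "integrable lebesgue k \<Longrightarrow> locally_integrable V k"
  unfolding locally_integrable_def set_integrable_def
  by (intro allI impI integrable_mult_indicator) (auto intro: fmeasurableD lmeasurable_compact)

text \<open>The fundamental theorem of calculus for weakly differentiable functions, along almost every segment of
  direction \<open>h\<close>. It is proved by duality: for a test function \<open>\<phi>\<close> on \<open>V\<close>, the integral of
  \<open>(U (x + h) - U x) * \<phi> x\<close> is the integral of \<open>U y * (\<phi> (y - h) - \<phi> y)\<close>. The difference of \<open>\<phi>\<close> is a line
  integral of its derivative; Fubini's theorem and the definition of the weak gradient, applied to the
  translates \<open>\<phi> (y - t *\<^sub>R h)\<close>, move the derivative to \<open>U\<close>. These translates are test functions on \<open>\<Omega>\<close>
  because \<open>V + t *\<^sub>R h\<close> lies in \<open>\<Omega>\<close>. The fundamental lemma then removes \<open>\<phi>\<close>.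

  Here and below \<open>U\<close> and \<open>G\<close> are Borel versions, defined on the whole space, of a function on \<open>\<Omega>\<close> and
  of its weak gradient; Borel functions can be sheared and integrated over products.\<close>

theorem weak_gradient_line_integral:
  fixes U :: "'a::euclidean_space \<Rightarrow> real" and G :: "'a \<Rightarrow> 'a" and h :: 'a
  assumes V: "open V" and sub: "\<And>x t. x \<in> V \<Longrightarrow> 0 \<le> t \<Longrightarrow> t \<le> 1 \<Longrightarrow> x + t *\<^sub>R h \<in> \<Omega>"
    and U: "integrable lborel U" and G: "integrable lborel G"
    and weak: "\<And>\<phi> v. \<phi> \<in> test_functions \<Omega> \<Longrightarrow>
      (LINT x|lborel. U x * frechet_derivative \<phi> (at x) v) = - (LINT x|lborel. (G x \<bullet> v) * \<phi> x)"
  shows "AE x in lborel. x \<in> V \<longrightarrow> U (x + h) - U x = (\<integral>t. G (x + t *\<^sub>R h) \<bullet> h \<partial>unit_interval)"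
proof -
  note [measurable] = borel_measurable_integrable[OF U, simplified] borel_measurable_integrable[OF G, simplified]
  have Gh: "integrable lborel (\<lambda>x. G x \<bullet> h)" using G by auto
  note \<Gamma> = integrable_shear[OF Gh, of h]
  define L where "L = (\<lambda>x. \<integral>t. G (x + t *\<^sub>R h) \<bullet> h \<partial>unit_interval)"
  have L: "integrable lborel L"
    using lborel_unit.integrable_fst'[OF \<Gamma>] by (simp add: L_def)
  note [measurable] = borel_measurable_integrable[OF L, simplified]
  have Uh: "integrable lborel (\<lambda>x. U (x + h))" using U by (simp add: integrable_lborel_shift)
  define k where "k = (\<lambda>x. U (x + h) - U x - L x)"
  have k: "integrable lborel k" unfolding k_def using U Uh L by auto
  then have "integrable lebesgue k" by (simp add: integrable_completion)
  then have kloc: "locally_integrable V k" by (rule integrable_imp_locally_integrable)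
  have "(LINT x|lebesgue_on V. k x * \<phi> x) = 0" if \<phi>: "\<phi> \<in> test_functions V" for \<phi>
  proof -
    let ?d = "\<lambda>x. frechet_derivative \<phi> (at x) h"
    note c = test_function_continuous[OF \<phi>]
    obtain K where K: "compact K" "\<And>x. x \<notin> K \<Longrightarrow> \<phi> x = 0" "\<And>x v. x \<notin> K \<Longrightarrow> frechet_derivative \<phi> (at x) v = 0"
      using test_functionsE[OF \<phi>] by metis
    obtain B where B: "\<And>x. \<bar>\<phi> x\<bar> \<le> B"
      using bounded_compactly_supported[OF c(1) K(1,2)] by blast
    obtain B' where B': "\<And>x. \<bar>?d x\<bar> \<le> B'"
      using bounded_compactly_supported[OF c(2) K(1,3)] by blast
    have [measurable]: "\<phi> \<in> borel_measurable borel" "?d \<in> borel_measurable borel"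
      by (intro borel_measurable_continuous_onI c)+
    have int_\<phi>: "integrable lborel (\<lambda>x. f x * \<phi> x)" if "integrable lborel f" for f
      by (rule integrable_times_bounded[OF that _ B]) simp
    have FTC: "(\<integral>t. ?d (y - t *\<^sub>R h) \<partial>unit_interval) = \<phi> y - \<phi> (y - h)" for y
    proof -
      let ?F = "\<lambda>t. - \<phi> (y + t *\<^sub>R (- h))"
      have D: "(?F has_real_derivative ?d (y - t *\<^sub>R h)) (at t)" for t
      proof -
        have "frechet_derivative \<phi> (at (y + t *\<^sub>R (- h))) (- h) = - ?d (y - t *\<^sub>R h)"
          using has_derivative_linear[OF test_function_derivative[OF \<phi>], of "y - t *\<^sub>R h"]
          by (simp add: linear_neg)
        then show ?thesis
          using DERIV_minus[OF test_function_line_derivative[OF \<phi>, of y "- h" t]] by simp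
      qed
      have "continuous_on UNIV (\<lambda>t. ?d (y - t *\<^sub>R h))"
        by (intro continuous_on_compose2[OF c(2)[of UNIV]] continuous_intros) auto
      then have "isCont (\<lambda>t. ?d (y - t *\<^sub>R h)) t" for t
        by (simp add: continuous_on_eq_continuous_at)
      from integral_FTC_Icc_real[OF zero_le_one D this]
      show ?thesis by (simp add: integral_restrict_space mult.commute)
    qed
    \<comment> \<open>Undo the line integral: move \<open>t\<close> outside, translate, integrate by parts, move \<open>t\<close> inside.\<close>
    have "(LINT x|lborel. L x * \<phi> x) = (LINT x|lborel. (\<integral>t. (G (x + t *\<^sub>R h) \<bullet> h) * \<phi> x \<partial>unit_interval))"
      by (simp add: L_def)
    also have "\<dots> = (\<integral>t. (LINT x|lborel. (G (x + t *\<^sub>R h) \<bullet> h) * \<phi> x) \<partial>unit_interval)"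
    proof (rule lborel_unit.Fubini_integral[symmetric])
      have "integrable (lborel \<Otimes>\<^sub>M unit_interval) (\<lambda>z. (G (fst z + snd z *\<^sub>R h) \<bullet> h) * \<phi> (fst z))"
        by (rule integrable_times_bounded[OF \<Gamma> _ B]) measurable
      then show "integrable (lborel \<Otimes>\<^sub>M unit_interval) (\<lambda>(x, t). (G (x + t *\<^sub>R h) \<bullet> h) * \<phi> x)"
        by (simp add: split_beta')
    qed
    also have "\<dots> = (\<integral>t. (LINT y|lborel. - (U y * ?d (y - t *\<^sub>R h))) \<partial>unit_interval)"
    proof (rule Bochner_Integration.integral_cong[OF refl])
      fix t assume "t \<in> space unit_interval"
      then have t: "0 \<le> t" "t \<le> 1" by (auto simp: space_restrict_space)
      have V': "\<And>x. x \<in> V \<Longrightarrow> x + t *\<^sub>R h \<in> \<Omega>" using sub t by blast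
      have "(LINT x|lborel. (G (x + t *\<^sub>R h) \<bullet> h) * \<phi> x) = (LINT y|lborel. (G y \<bullet> h) * \<phi> (y - t *\<^sub>R h))"
        using integral_lborel_shift[of "\<lambda>y. (G y \<bullet> h) * \<phi> (y - t *\<^sub>R h)" "t *\<^sub>R h"] by simp
      also have "\<dots> = - (LINT y|lborel. U y * ?d (y - t *\<^sub>R h))"
        using weak[OF test_function_shift(1)[OF \<phi> V'], of h] by (simp add: test_function_shift(2)[OF \<phi> V'])
      finally show "(LINT x|lborel. (G (x + t *\<^sub>R h) \<bullet> h) * \<phi> x) = (LINT y|lborel. - (U y * ?d (y - t *\<^sub>R h)))"
        by simp
    qed
    also have "\<dots> = (LINT y|lborel. (\<integral>t. - (U y * ?d (y - t *\<^sub>R h)) \<partial>unit_interval))"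
    proof (rule lborel_unit.Fubini_integral)
      \<comment> \<open>The shear by \<open>0\<close> gives integrability of \<open>U\<close> as a function of both variables.\<close>
      have "integrable (lborel \<Otimes>\<^sub>M unit_interval) (\<lambda>z. U (fst z + snd z *\<^sub>R 0) * ?d (fst z - snd z *\<^sub>R h))"
        by (rule integrable_times_bounded[OF integrable_shear[OF U] _ B']) measurable
      then show "integrable (lborel \<Otimes>\<^sub>M unit_interval) (\<lambda>(y, t). - (U y * ?d (y - t *\<^sub>R h)))"
        by (simp add: split_beta')
    qed
    also have "\<dots> = (LINT y|lborel. U y * \<phi> (y - h) - U y * \<phi> y)"
      by (simp add: FTC algebra_simps)
    also have "\<dots> = (LINT y|lborel. U y * \<phi> (y - h)) - (LINT y|lborel. U y * \<phi> y)"
      using integrable_times_bounded[OF U _ B, of "\<lambda>y. y - h"]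
      by (intro Bochner_Integration.integral_diff int_\<phi> U integrable_times_bounded[OF U _ B]) measurable
    also have "(LINT y|lborel. U y * \<phi> (y - h)) = (LINT x|lborel. U (x + h) * \<phi> x)"
      using integral_lborel_shift[of "\<lambda>y. U y * \<phi> (y - h)" h] by simp
    finally have "(LINT x|lborel. k x * \<phi> x) = 0"
      using int_\<phi>[OF U] int_\<phi>[OF Uh] int_\<phi>[OF L] by (simp add: k_def left_diff_distrib)
    moreover have "(LINT x|lebesgue_on V. k x * \<phi> x) = (LINT x|lebesgue. k x * \<phi> x)"
      by (rule locally_integrable_test_function(3)[OF V kloc \<phi>])
    moreover have "(LINT x|lebesgue. k x * \<phi> x) = (LINT x|lborel. k x * \<phi> x)"
      by (intro integral_completion) (simp add: k_def)
    ultimately show ?thesis by simp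
  qed
  then have "AE x in lebesgue_on V. k x = 0"
    by (rule fundamental_lemma_calculus_of_variations[OF V kloc])
  then have "AE x in lebesgue. x \<in> V \<longrightarrow> k x = 0"
    using V by (simp add: AE_restrict_space_iff borel_open)
  then show ?thesis unfolding AE_completion_iff
    by eventually_elim (simp add: k_def L_def)
qed

text \<open>Jensen's inequality for the line integral, and Tonelli's theorem.\<close>

theorem weak_gradient_translation_estimate:
  fixes U :: "'a::euclidean_space \<Rightarrow> real" and G :: "'a \<Rightarrow> 'a" and h :: 'a
  assumes p: "1 < p"
    and V: "open V" and sub: "\<And>x t. x \<in> V \<Longrightarrow> 0 \<le> t \<Longrightarrow> t \<le> 1 \<Longrightarrow> x + t *\<^sub>R h \<in> \<Omega>"
    and U: "integrable lborel U" and G: "integrable lborel G"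
    and weak: "\<And>\<phi> v. \<phi> \<in> test_functions \<Omega> \<Longrightarrow>
      (LINT x|lborel. U x * frechet_derivative \<phi> (at x) v) = - (LINT x|lborel. (G x \<bullet> v) * \<phi> x)"
  shows "(\<integral>\<^sup>+x\<in>V. ennreal (\<bar>U (x + h) - U x\<bar> powr p) \<partial>lborel)
    \<le> ennreal (norm h powr p) * (\<integral>\<^sup>+x. ennreal (norm (G x) powr p) \<partial>lborel)"
proof -
  note [measurable] = borel_measurable_integrable[OF U, simplified] borel_measurable_integrable[OF G, simplified]
  note [measurable] = measurable_unit_interval_ident
  have Gt: "(\<lambda>t. G (x + t *\<^sub>R h) \<bullet> h) \<in> borel_measurable unit_interval" for x by measurable
  have *: "AE x in lborel. x \<in> V \<longrightarrow> U (x + h) - U x = (\<integral>t. G (x + t *\<^sub>R h) \<bullet> h \<partial>unit_interval)"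
    by (rule weak_gradient_line_integral[OF V _ U G, of h \<Omega>]) (use sub weak in blast)+
  have "(\<integral>\<^sup>+x\<in>V. ennreal (\<bar>U (x + h) - U x\<bar> powr p) \<partial>lborel)
      \<le> (\<integral>\<^sup>+x. (\<integral>\<^sup>+t. ennreal (\<bar>G (x + t *\<^sub>R h) \<bullet> h\<bar> powr p) \<partial>unit_interval) \<partial>lborel)"
  proof (rule nn_integral_mono_AE, use * in eventually_elim)
    case (elim x)
    then show ?case
      using powr_norm_integral_le[OF emeasure_unit_interval(1) p Gt, of x] by (auto simp: indicator_def)
  qed
  also have "\<dots> = (\<integral>\<^sup>+x. ennreal (\<bar>G x \<bullet> h\<bar> powr p) \<partial>lborel)"
    by (rule nn_integral_shear) measurable
  also have "\<dots> \<le> (\<integral>\<^sup>+x. ennreal (norm h powr p) * ennreal (norm (G x) powr p) \<partial>lborel)"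
  proof (rule nn_integral_mono)
    fix x
    have "\<bar>G x \<bullet> h\<bar> powr p \<le> (norm h * norm (G x)) powr p"
      using Cauchy_Schwarz_ineq2[of "G x" h] p by (intro powr_mono2) (auto simp: mult.commute)
    then show "ennreal (\<bar>G x \<bullet> h\<bar> powr p) \<le> ennreal (norm h powr p) * ennreal (norm (G x) powr p)"
      by (simp add: powr_mult ennreal_mult'[symmetric] ennreal_leI)
  qed
  also have "\<dots> = ennreal (norm h powr p) * (\<integral>\<^sup>+x. ennreal (norm (G x) powr p) \<partial>lborel)"
    by (rule nn_integral_cmult) measurable
  finally show ?thesis .
qed

section \<open>From translation estimates to the Poincare inequality\<close>

text \<open>All that the Poincare inequality needs to know about \<open>U\<close>: translates of \<open>U\<close> along segments inside \<open>\<Omega>\<close>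
  differ from \<open>U\<close> by at most \<open>D * norm h powr p\<close>, in the sense of \<open>p\<close>-th powers of \<open>L\<^sup>p\<close> norms. In the
  application \<open>D\<close> is the integral of \<open>norm (G x) powr p\<close> for the gradient \<open>G\<close> of \<open>U\<close>.\<close>

definition translation_estimate ::
  "'a::euclidean_space set \<Rightarrow> real \<Rightarrow> ('a \<Rightarrow> real) \<Rightarrow> ennreal \<Rightarrow> bool" where
  "translation_estimate \<Omega> p U D \<longleftrightarrow> U \<in> borel_measurable borel \<and>
     (\<forall>V h. open V \<and> (\<forall>x\<in>V. \<forall>t\<in>{0..1}. x + t *\<^sub>R h \<in> \<Omega>) \<longrightarrow>
        (\<integral>\<^sup>+x\<in>V. ennreal (\<bar>U (x + h) - U x\<bar> powr p) \<partial>lborel) \<le> ennreal (norm h powr p) * D)"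

lemma exists_le_average:
  fixes f :: "'a \<Rightarrow> ennreal"
  assumes [measurable]: "f \<in> borel_measurable M" "B \<in> sets M"
    and B: "0 < emeasure M B" "emeasure M B < \<infinity>"
    and le: "(\<integral>\<^sup>+y\<in>B. f y \<partial>M) \<le> A * emeasure M B"
  shows "\<exists>y\<in>B. f y \<le> A"
proof (rule ccontr)
  assume "\<not> (\<exists>y\<in>B. f y \<le> A)"
  then have gt: "A < f y" if "y \<in> B" for y using that by (meson not_le)
  have "B \<noteq> {}" using B(1) by auto
  then have A: "A < top" using gt by (metis ex_in_conv less_top order.strict_trans2 top_greatest)
  have "(\<integral>\<^sup>+y\<in>B. f y \<partial>M) = (\<integral>\<^sup>+y. (f y - A) * indicator B y + A * indicator B y \<partial>M)"
    using gt by (intro nn_integral_cong) (auto simp: indicator_def less_imp_le diff_add_cancel_ennreal)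
  also have "\<dots> = (\<integral>\<^sup>+y. (f y - A) * indicator B y \<partial>M) + A * emeasure M B"
    by (subst nn_integral_add) (auto simp: nn_integral_cmult_indicator)
  finally have "A * emeasure M B + (\<integral>\<^sup>+y. (f y - A) * indicator B y \<partial>M) \<le> A * emeasure M B + 0"
    using le by (simp add: add.commute)
  moreover have "A * emeasure M B \<noteq> \<infinity>"
    using A B(2) by (auto simp: ennreal_mult_eq_top_iff)
  ultimately have "(\<integral>\<^sup>+y. (f y - A) * indicator B y \<partial>M) = 0"
    by (simp only: ennreal_add_left_cancel_le le_zero_eq simp_thms)
  then have "AE y in M. (f y - A) * indicator B y = 0"
    by (subst (asm) nn_integral_0_iff_AE) auto
  then have "AE y in M. y \<notin> B"
  proof eventually_elim
    case (elim y)
    then show ?case using gt[of y] A by (auto simp: indicator_def diff_eq_0_iff_ennreal)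
  qed
  then have "emeasure M B = 0" by (subst (asm) AE_iff_measurable[of B]) (auto dest: sets.sets_into_space[OF assms(2), THEN subsetD])
  with B(1) show False by simp
qed

text \<open>Integrate \<open>\<bar>U x - U y\<bar> powr p\<close> over all pairs of points \<open>x\<close>, \<open>y\<close> of the ball and substitute
  \<open>x = y + h\<close>. For fixed \<open>h\<close> the admissible \<open>y\<close> form an open set \<open>V\<close>, and convexity of the ball keeps the
  segments from \<open>V\<close> to \<open>V + h\<close> inside, so the translation estimate bounds the double integral. Some \<open>y\<close>
  does at least as well as the average, and \<open>c = U y\<close> is the required constant.\<close>

lemma translation_estimate_ball:
  fixes z :: "'a::euclidean_space"
  assumes p: "0 \<le> p" and r: "0 < r" and sub: "ball z r \<subseteq> \<Omega>"
  obtains K :: real where "0 \<le> K"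
    "\<And>U D. translation_estimate \<Omega> p U D \<Longrightarrow> \<exists>c. (\<integral>\<^sup>+x\<in>ball z r. ennreal (\<bar>U x - c\<bar> powr p) \<partial>lborel) \<le> ennreal K * D"
proof -
  define B where "B = ball z r"
  have [measurable]: "B \<in> sets borel" by (simp add: B_def)
  let ?B2 = "ball (0::'a) (2 * r)"
  define b b2 where "b = measure lborel B" and "b2 = measure lborel ?B2"
  have fin: "emeasure lborel (ball x s) < \<infinity>" for x :: 'a and s
    using emeasure_bounded_finite[of "ball x s"] by simp
  have eb: "emeasure lborel B = ennreal b" "emeasure lborel ?B2 = ennreal b2"
    unfolding b_def b2_def B_def by (intro emeasure_eq_ennreal_measure less_imp_neq fin[simplified])+
  have b: "0 < b" unfolding b_def B_def by (rule content_ball_pos[OF r])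
  define K where "K = b2 * (2 * r) powr p / b"
  have "\<exists>c. (\<integral>\<^sup>+x\<in>B. ennreal (\<bar>U x - c\<bar> powr p) \<partial>lborel) \<le> ennreal K * D"
    if est: "translation_estimate \<Omega> p U D" for U D
  proof -
    have [measurable]: "U \<in> borel_measurable borel" using est by (simp add: translation_estimate_def)
    define F where "F y = (\<integral>\<^sup>+x\<in>B. ennreal (\<bar>U x - U y\<bar> powr p) \<partial>lborel)" for y
    have slice: "(\<integral>\<^sup>+y. ennreal (\<bar>U (y + h) - U y\<bar> powr p) * indicator B (y + h) * indicator B y \<partial>lborel)
        \<le> ennreal ((2 * r) powr p) * D * indicator ?B2 h" for h
    proof -
      define V where "V = B \<inter> (\<lambda>y. y + h) -` B"
      have V: "open V" unfolding V_def B_def by (intro open_Int open_vimage open_ball continuous_intros)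
      have eq: "(\<integral>\<^sup>+y. ennreal (\<bar>U (y + h) - U y\<bar> powr p) * indicator B (y + h) * indicator B y \<partial>lborel)
          = (\<integral>\<^sup>+y\<in>V. ennreal (\<bar>U (y + h) - U y\<bar> powr p) \<partial>lborel)"
        by (intro nn_integral_cong) (auto simp: V_def indicator_def)
      show ?thesis
      proof (cases "h \<in> ?B2")
        case True
        have "x + t *\<^sub>R h \<in> \<Omega>" if "x \<in> V" "t \<in> {0..1}" for x t
        proof -
          have "(1 - t) *\<^sub>R x + t *\<^sub>R (x + h) \<in> B"
            using that unfolding B_def by (intro convexD_alt[OF convex_ball]) (auto simp: V_def B_def)
          moreover have "(1 - t) *\<^sub>R x + t *\<^sub>R (x + h) = x + t *\<^sub>R h" by (simp add: algebra_simps)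
          ultimately show ?thesis using sub by (auto simp: B_def)
        qed
        then have "(\<integral>\<^sup>+y\<in>V. ennreal (\<bar>U (y + h) - U y\<bar> powr p) \<partial>lborel) \<le> ennreal (norm h powr p) * D"
          using est V by (simp add: translation_estimate_def)
        also have "\<dots> \<le> ennreal ((2 * r) powr p) * D"
          using True p by (intro mult_right_mono ennreal_leI powr_mono2) auto
        finally show ?thesis using True by (simp add: eq)
      next
        case False
        have "V = {}"
        proof -
          have "norm h < 2 * r" if "x \<in> B" "x + h \<in> B" for x
            using that norm_triangle_ineq4[of "x + h - z" "x - z"] by (simp add: B_def dist_norm norm_minus_commute)
          then show ?thesis using False by (auto simp: V_def)
        qed
        then show ?thesis by (simp add: eq)
      qed
    qed
    have Fm [measurable]: "F \<in> borel_measurable borel"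
      unfolding F_def by measurable
    have "(\<integral>\<^sup>+y\<in>B. F y \<partial>lborel)
        = (\<integral>\<^sup>+y. \<integral>\<^sup>+x. ennreal (\<bar>U x - U y\<bar> powr p) * indicator B x * indicator B y \<partial>lborel \<partial>lborel)"
      unfolding F_def by (intro nn_integral_cong nn_integral_multc[symmetric]) measurable
    also have "\<dots> = (\<integral>\<^sup>+y. \<integral>\<^sup>+h. ennreal (\<bar>U (y + h) - U y\<bar> powr p) * indicator B (y + h) * indicator B y \<partial>lborel \<partial>lborel)"
    proof (rule nn_integral_cong)
      fix y
      show "(\<integral>\<^sup>+x. ennreal (\<bar>U x - U y\<bar> powr p) * indicator B x * indicator B y \<partial>lborel)
          = (\<integral>\<^sup>+h. ennreal (\<bar>U (y + h) - U y\<bar> powr p) * indicator B (y + h) * indicator B y \<partial>lborel)"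
        using nn_integral_lborel_shift[of "\<lambda>x. ennreal (\<bar>U x - U y\<bar> powr p) * indicator B x * indicator B y" y]
        by (simp add: add.commute)
    qed
    also have "\<dots> = (\<integral>\<^sup>+h. \<integral>\<^sup>+y. ennreal (\<bar>U (y + h) - U y\<bar> powr p) * indicator B (y + h) * indicator B y \<partial>lborel \<partial>lborel)"
      by (rule lborel_pair.Fubini') measurable
    also have "\<dots> \<le> (\<integral>\<^sup>+h. ennreal ((2 * r) powr p) * D * indicator ?B2 h \<partial>lborel)"
      by (intro nn_integral_mono slice)
    also have "\<dots> = ennreal ((2 * r) powr p) * D * ennreal b2"
      by (simp add: nn_integral_cmult_indicator eb)
    also have "\<dots> = ennreal K * D * emeasure lborel B"
    proof -
      have "ennreal K * ennreal b = ennreal ((2 * r) powr p) * ennreal b2"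
        using b by (simp add: K_def ennreal_mult'[symmetric] b2_def mult.commute)
      then show ?thesis by (simp add: eb mult.assoc mult.left_commute mult.commute)
    qed
    finally have "(\<integral>\<^sup>+y\<in>B. F y \<partial>lborel) \<le> ennreal K * D * emeasure lborel B" .
    then obtain y where "F y \<le> ennreal K * D"
      using exists_le_average[of F lborel B "ennreal K * D"] b by (auto simp: eb)
    then show ?thesis by (auto simp: F_def)
  qed
  moreover have "0 \<le> K" using b by (simp add: K_def b2_def)
  ultimately show ?thesis using that unfolding B_def by blast
qed


text \<open>Fix a ball in \<open>\<Omega>\<close> and a constant \<open>c\<close> close to \<open>U\<close> on this ball. Call a set \<open>W\<close> good if \<open>U\<close> stays close
  to the same \<open>c\<close> on \<open>W\<close>, with a bound independent of \<open>U\<close>. Finite unions of good sets are good since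
  \<open>c\<close> is the same. If \<open>V\<close> can be translated into a good set along segments inside \<open>\<Omega>\<close>, then \<open>V\<close> is good:
  compare \<open>U\<close> with its translate. Translating small balls into neighbouring ones, the points with a good
  neighbourhood form a set that is open and closed in \<open>\<Omega>\<close>; by connectedness every compact subset of
  \<open>\<Omega>\<close> lies in a good set. Near a boundary point \<open>\<Omega>\<close> is the region above a graph, and moving this region
  up, in the direction \<open>e\<close>, pushes it into a compact subset of \<open>\<Omega>\<close>. So every point of the closure has a
  neighbourhood whose trace on \<open>\<Omega>\<close> is good, and the closure is compact.\<close>

theorem poincare_of_translation_estimate:
  fixes \<Omega> :: "'a::euclidean_space set"
  assumes \<Omega>: "\<Omega> \<noteq> {}" "bounded \<Omega>" "connected \<Omega>" "open \<Omega>" and smooth: "smooth_boundary \<Omega>"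
    and p: "0 \<le> p"
  obtains K :: real where "0 \<le> K"
    "\<And>U D. translation_estimate \<Omega> p U D \<Longrightarrow> \<exists>c. (\<integral>\<^sup>+x\<in>\<Omega>. ennreal (\<bar>U x - c\<bar> powr p) \<partial>lborel) \<le> ennreal K * D"
proof -
  obtain z r where r: "0 < r" and B0: "ball z r \<subseteq> \<Omega>"
    using \<Omega> by (meson ex_in_conv open_contains_ball)
  obtain K0 :: real where K0: "0 \<le> K0"
    "\<And>U D. translation_estimate \<Omega> p U D \<Longrightarrow> \<exists>c. (\<integral>\<^sup>+x\<in>ball z r. ennreal (\<bar>U x - c\<bar> powr p) \<partial>lborel) \<le> ennreal K0 * D"
    using translation_estimate_ball[OF p r B0] by blast
  define admissible where "admissible U D c \<longleftrightarrow> translation_estimate \<Omega> p U D \<and>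
    (\<integral>\<^sup>+x\<in>ball z r. ennreal (\<bar>U x - c\<bar> powr p) \<partial>lborel) \<le> ennreal K0 * D" for U D c
  define good where "good W \<longleftrightarrow> W \<in> sets borel \<and> (\<exists>K\<ge>0. \<forall>U D c. admissible U D c \<longrightarrow>
    (\<integral>\<^sup>+x\<in>W. ennreal (\<bar>U x - c\<bar> powr p) \<partial>lborel) \<le> ennreal K * D)" for W :: "'a set"
  have Um: "U \<in> borel_measurable borel" if "admissible U D c" for U D c
    using that by (simp add: admissible_def translation_estimate_def)
  have good_ball: "good (ball z r)"
    using K0(1) by (auto simp: good_def admissible_def)
  have good_mono: "good W'" if "good W" "W' \<subseteq> W" "W' \<in> sets borel" for W W'
  proof -
    obtain K where K: "0 \<le> K" "\<And>U D c. admissible U D c \<Longrightarrow>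
        (\<integral>\<^sup>+x\<in>W. ennreal (\<bar>U x - c\<bar> powr p) \<partial>lborel) \<le> ennreal K * D"
      using \<open>good W\<close> by (auto simp: good_def)
    have "(\<integral>\<^sup>+x\<in>W'. ennreal (\<bar>U x - c\<bar> powr p) \<partial>lborel) \<le> ennreal K * D" if "admissible U D c" for U D c
      by (rule order_trans[OF nn_set_integral_set_mono[OF \<open>W' \<subseteq> W\<close>] K(2)[OF that]])
    then show ?thesis using K(1) that(3) by (auto simp: good_def)
  qed
  have good_Un: "good (W \<union> W')" if W: "good W" "good W'" for W W'
  proof -
    have [measurable]: "W \<in> sets borel" "W' \<in> sets borel" using W by (auto simp: good_def)
    obtain K where K: "0 \<le> K" "\<And>U D c. admissible U D c \<Longrightarrow>
        (\<integral>\<^sup>+x\<in>W. ennreal (\<bar>U x - c\<bar> powr p) \<partial>lborel) \<le> ennreal K * D"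
      using \<open>good W\<close> by (auto simp: good_def)
    obtain K' where K': "0 \<le> K'" "\<And>U D c. admissible U D c \<Longrightarrow>
        (\<integral>\<^sup>+x\<in>W'. ennreal (\<bar>U x - c\<bar> powr p) \<partial>lborel) \<le> ennreal K' * D"
      using \<open>good W'\<close> by (auto simp: good_def)
    have "(\<integral>\<^sup>+x\<in>W \<union> W'. ennreal (\<bar>U x - c\<bar> powr p) \<partial>lborel) \<le> ennreal (K + K') * D"
      if adm: "admissible U D c" for U D c
    proof -
      note [measurable] = Um[OF adm]
      have "(\<integral>\<^sup>+x\<in>W \<union> W'. ennreal (\<bar>U x - c\<bar> powr p) \<partial>lborel)
          \<le> (\<integral>\<^sup>+x. ennreal (\<bar>U x - c\<bar> powr p) * indicator W x + ennreal (\<bar>U x - c\<bar> powr p) * indicator W' x \<partial>lborel)"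
        by (intro nn_integral_mono) (auto simp: indicator_def)
      also have "\<dots> = (\<integral>\<^sup>+x\<in>W. ennreal (\<bar>U x - c\<bar> powr p) \<partial>lborel) + (\<integral>\<^sup>+x\<in>W'. ennreal (\<bar>U x - c\<bar> powr p) \<partial>lborel)"
        by (rule nn_integral_add) measurable
      also have "\<dots> \<le> ennreal K * D + ennreal K' * D" by (intro add_mono K(2) K'(2) adm)
      also have "\<dots> = ennreal (K + K') * D" using K(1) K'(1) by (simp add: distrib_right)
      finally show ?thesis .
    qed
    moreover have "0 \<le> K + K'" using K(1) K'(1) by simp
    ultimately show ?thesis by (auto simp: good_def)
  qed
  have good_Union: "good (\<Union>F)" if "finite F" "\<And>W. W \<in> F \<Longrightarrow> good W" for F
    using that
  proof (induction F rule: finite_induct)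
    case empty
    show ?case by (rule good_mono[OF good_ball]) auto
  next
    case (insert W F)
    then show ?case using good_Un[of W "\<Union>F"] by simp
  qed
  have good_shift: "good V" if W: "good W" and V: "open V" and VW: "\<And>x. x \<in> V \<Longrightarrow> x + h \<in> W"
    and seg: "\<And>x t. x \<in> V \<Longrightarrow> 0 \<le> t \<Longrightarrow> t \<le> 1 \<Longrightarrow> x + t *\<^sub>R h \<in> \<Omega>" for V W h
  proof -
    have [measurable]: "W \<in> sets borel" "V \<in> sets borel" using W V by (auto simp: good_def)
    obtain K where K: "0 \<le> K" "\<And>U D c. admissible U D c \<Longrightarrow>
        (\<integral>\<^sup>+x\<in>W. ennreal (\<bar>U x - c\<bar> powr p) \<partial>lborel) \<le> ennreal K * D"
      using W by (auto simp: good_def)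
    have "(\<integral>\<^sup>+x\<in>V. ennreal (\<bar>U x - c\<bar> powr p) \<partial>lborel) \<le> ennreal (2 powr p * (norm h powr p + K)) * D"
      if adm: "admissible U D c" for U D c
    proof -
      note [measurable] = Um[OF adm]
      have "(\<integral>\<^sup>+x\<in>V. ennreal (\<bar>U x - c\<bar> powr p) \<partial>lborel)
          \<le> (\<integral>\<^sup>+x. ennreal (2 powr p) * (ennreal (\<bar>U (x + h) - U x\<bar> powr p) * indicator V x
               + ennreal (\<bar>U (x + h) - c\<bar> powr p) * indicator W (x + h)) \<partial>lborel)"
      proof (rule nn_integral_mono)
        fix x
        have "\<bar>U x - c\<bar> powr p \<le> 2 powr p * (\<bar>U (x + h) - U x\<bar> powr p + \<bar>U (x + h) - c\<bar> powr p)"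
          using norm_add_powr_le[OF p, of "U x - U (x + h)" "U (x + h) - c"]
          by (simp add: abs_minus_commute)
        then have "ennreal (\<bar>U x - c\<bar> powr p)
            \<le> ennreal (2 powr p) * (ennreal (\<bar>U (x + h) - U x\<bar> powr p) + ennreal (\<bar>U (x + h) - c\<bar> powr p))"
          by (simp add: ennreal_mult'[symmetric] ennreal_plus[symmetric] ennreal_leI del: ennreal_plus)
        then show "ennreal (\<bar>U x - c\<bar> powr p) * indicator V x
            \<le> ennreal (2 powr p) * (ennreal (\<bar>U (x + h) - U x\<bar> powr p) * indicator V x
               + ennreal (\<bar>U (x + h) - c\<bar> powr p) * indicator W (x + h))"
          using VW[of x] by (auto simp: indicator_def)
      qed
      also have "\<dots> = ennreal (2 powr p) * (\<integral>\<^sup>+x. ennreal (\<bar>U (x + h) - U x\<bar> powr p) * indicator V x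
               + ennreal (\<bar>U (x + h) - c\<bar> powr p) * indicator W (x + h) \<partial>lborel)"
        by (rule nn_integral_cmult) measurable
      also have "(\<integral>\<^sup>+x. ennreal (\<bar>U (x + h) - U x\<bar> powr p) * indicator V x
               + ennreal (\<bar>U (x + h) - c\<bar> powr p) * indicator W (x + h) \<partial>lborel)
          = (\<integral>\<^sup>+x\<in>V. ennreal (\<bar>U (x + h) - U x\<bar> powr p) \<partial>lborel)
          + (\<integral>\<^sup>+x. ennreal (\<bar>U (x + h) - c\<bar> powr p) * indicator W (x + h) \<partial>lborel)"
        by (rule nn_integral_add) measurable
      also have "(\<integral>\<^sup>+x. ennreal (\<bar>U (x + h) - c\<bar> powr p) * indicator W (x + h) \<partial>lborel)
          = (\<integral>\<^sup>+x\<in>W. ennreal (\<bar>U x - c\<bar> powr p) \<partial>lborel)"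
        by (rule nn_integral_lborel_shift) measurable
      also have "ennreal (2 powr p) * ((\<integral>\<^sup>+x\<in>V. ennreal (\<bar>U (x + h) - U x\<bar> powr p) \<partial>lborel)
          + (\<integral>\<^sup>+x\<in>W. ennreal (\<bar>U x - c\<bar> powr p) \<partial>lborel))
          \<le> ennreal (2 powr p) * (ennreal (norm h powr p) * D + ennreal K * D)"
      proof (intro mult_left_mono add_mono K(2) adm)
        show "(\<integral>\<^sup>+x\<in>V. ennreal (\<bar>U (x + h) - U x\<bar> powr p) \<partial>lborel) \<le> ennreal (norm h powr p) * D"
          using adm V seg by (simp add: admissible_def translation_estimate_def)
      qed simp
      also have "\<dots> = ennreal (2 powr p * (norm h powr p + K)) * D"
        using K(1) by (simp add: ennreal_mult' distrib_right mult.assoc)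
      finally show ?thesis .
    qed
    moreover have "0 \<le> 2 powr p * (norm h powr p + K)" using K(1) by simp
    ultimately show ?thesis unfolding good_def by auto
  qed
  \<comment> \<open>The points with a good neighbourhood form a non-empty set that is open and closed in \<open>\<Omega>\<close>.\<close>
  define A where "A = {x. \<exists>s>0. good (ball x s)}"
  have A: "open A"
  proof (rule openI)
    fix x assume "x \<in> A"
    then obtain s where s: "0 < s" "good (ball x s)" by (auto simp: A_def)
    have "y \<in> A" if "y \<in> ball x s" for y
    proof -
      obtain s' where "0 < s'" "ball y s' \<subseteq> ball x s"
        using openE[OF open_ball \<open>y \<in> ball x s\<close>] by blast
      then show ?thesis using good_mono[OF s(2)] by (auto simp: A_def)
    qed
    then show "\<exists>e>0. ball x e \<subseteq> A" using s(1) by blast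
  qed
  have OA: "open (\<Omega> - A)"
  proof (rule openI)
    fix x assume x: "x \<in> \<Omega> - A"
    obtain e where e: "0 < e" "ball x e \<subseteq> \<Omega>" using x \<Omega>(4) by (meson DiffD1 open_contains_ball)
    have "y \<notin> A" if y: "y \<in> ball x (e / 2)" for y
    proof
      assume "y \<in> A"
      then obtain s where s: "0 < s" "good (ball y s)" by (auto simp: A_def)
      \<comment> \<open>The minimum keeps the segments from \<open>ball x ?s\<close> to \<open>ball y s\<close> in \<open>ball x e\<close>.\<close>
      let ?s = "min s (e / 2)"
      have "good (ball x ?s)"
      proof (rule good_shift[OF s(2), of _ "y - x"])
        show "w + (y - x) \<in> ball y s" if "w \<in> ball x ?s" for w
          using that by (simp add: dist_norm algebra_simps)
        show "w + t *\<^sub>R (y - x) \<in> \<Omega>" if "w \<in> ball x ?s" "0 \<le> t" "t \<le> 1" for w t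
        proof -
          have "norm (w + t *\<^sub>R (y - x) - x) \<le> norm (w - x) + norm (t *\<^sub>R (y - x))"
            using norm_triangle_ineq[of "w - x" "t *\<^sub>R (y - x)"] by (simp add: algebra_simps)
          also have "norm (t *\<^sub>R (y - x)) \<le> norm (y - x)"
            using that by (simp add: mult_left_le_one_le)
          also have "norm (w - x) + norm (y - x) < e"
            using that(1) y by (simp add: dist_norm norm_minus_commute)
          finally have "w + t *\<^sub>R (y - x) \<in> ball x e" by (simp add: dist_norm norm_minus_commute)
          then show ?thesis using e(2) by blast
        qed
      qed simp
      then have "x \<in> A" using s(1) e(1) by (auto simp: A_def intro!: exI[of _ ?s])
      then show False using x by simp
    qed
    moreover have "ball x (e / 2) \<subseteq> \<Omega>" using e by auto
    ultimately show "\<exists>e>0. ball x e \<subseteq> \<Omega> - A"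
      using e(1) by (intro exI[of _ "e / 2"]) auto
  qed
  have "A \<inter> \<Omega> = {} \<or> (\<Omega> - A) \<inter> \<Omega> = {}"
    by (rule connectedD[OF \<Omega>(3) A OA]) auto
  moreover have "z \<in> A \<inter> \<Omega>" using r B0 good_ball by (auto simp: A_def)
  ultimately have "\<Omega> \<subseteq> A" by blast
  then have inner: "\<exists>s>0. good (ball x s)" if "x \<in> \<Omega>" for x using that by (auto simp: A_def)
  have good_compact: "\<exists>W. good W \<and> C \<subseteq> W" if C: "compact C" "C \<subseteq> \<Omega>" for C
  proof -
    have "\<forall>x\<in>C. \<exists>s>0. good (ball x s)" using C inner by blast
    then obtain s where s: "\<And>x. x \<in> C \<Longrightarrow> 0 < s x" "\<And>x. x \<in> C \<Longrightarrow> good (ball x (s x))" by metis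
    have "C \<subseteq> (\<Union>x\<in>C. ball x (s x))" using s(1) by force
    from compactE_image[OF C(1) open_ball this]
    obtain F where F: "F \<subseteq> C" "finite F" "C \<subseteq> (\<Union>x\<in>F. ball x (s x))" by blast
    have "good (\<Union>x\<in>F. ball x (s x))" using F s by (intro good_Union) auto
    with F(3) show ?thesis by blast
  qed
  have boundary: "\<exists>s>0. good (\<Omega> \<inter> ball y s)" if y: "y \<in> frontier \<Omega>" for y
  proof -
    obtain R e \<gamma> where R: "0 < R" and e: "norm e = 1" and \<gamma>: "smooth_on UNIV \<gamma>"
      and graph: "\<Omega> \<inter> ball y R = {x \<in> ball y R. \<gamma> (x - (x \<bullet> e) *\<^sub>R e) < x \<bullet> e}"
      using bspec[OF smooth[unfolded smooth_boundary_def] y] by blast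
    have \<gamma>c: "continuous_on UNIV \<gamma>"
      using \<gamma>[unfolded smooth_on_def, THEN spec[of _ 0]] by simp
    have ee: "e \<bullet> e = 1" using e by (simp add: norm_eq_1)
    \<comment> \<open>The radius of the trace and the height of the translation are both \<open>s\<close>; so everything stays
      within \<open>2 * s < R\<close> of \<open>y\<close>.\<close>
    define s where "s = R / 3"
    have s: "0 < s" using R by (simp add: s_def)
    have proj: "(x + t *\<^sub>R e) - ((x + t *\<^sub>R e) \<bullet> e) *\<^sub>R e = x - (x \<bullet> e) *\<^sub>R e" for x t
      by (simp add: inner_add_left ee algebra_simps)
    have near: "dist y (x + (t * s) *\<^sub>R e) < 2 * s" if "x \<in> ball y s" "0 \<le> t" "t \<le> 1" for x t
    proof -
      have "dist y (x + (t * s) *\<^sub>R e) \<le> dist y x + norm ((t * s) *\<^sub>R e)"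
        using norm_triangle_ineq4[of "y - x" "(t * s) *\<^sub>R e"] by (simp add: dist_norm algebra_simps)
      also have "norm ((t * s) *\<^sub>R e) \<le> s" using that s e by (simp add: mult_left_le_one_le)
      finally show ?thesis using that(1) by simp
    qed
    define C where "C = cball y (2 * s) \<inter> {x. \<gamma> (x - (x \<bullet> e) *\<^sub>R e) + s \<le> x \<bullet> e}"
    have "compact C" unfolding C_def
      by (intro compact_Int_closed compact_cball closed_Collect_le continuous_intros
          continuous_on_compose2[OF \<gamma>c]) auto
    moreover have "C \<subseteq> \<Omega>"
    proof
      fix x assume "x \<in> C"
      then have "x \<in> {x \<in> ball y R. \<gamma> (x - (x \<bullet> e) *\<^sub>R e) < x \<bullet> e}"
        using s by (auto simp: C_def s_def)
      then show "x \<in> \<Omega>" unfolding graph[symmetric] by simp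
    qed
    ultimately obtain W where W: "good W" "C \<subseteq> W" using good_compact by blast
    have above: "\<gamma> (x - (x \<bullet> e) *\<^sub>R e) < x \<bullet> e" if "x \<in> \<Omega> \<inter> ball y s" for x
    proof -
      have "x \<in> \<Omega> \<inter> ball y R" using that s by (auto simp: s_def)
      then show ?thesis unfolding graph by simp
    qed
    have "good (\<Omega> \<inter> ball y s)"
    proof (rule good_shift[OF W(1), of _ "s *\<^sub>R e"])
      show "x + s *\<^sub>R e \<in> W" if x: "x \<in> \<Omega> \<inter> ball y s" for x
      proof -
        have "dist y (x + s *\<^sub>R e) \<le> 2 * s" using near[of x 1] x by simp
        moreover have "\<gamma> (x - (x \<bullet> e) *\<^sub>R e) + s \<le> (x + s *\<^sub>R e) \<bullet> e"
          using above[OF x] by (simp add: inner_add_left ee)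
        ultimately have "x + s *\<^sub>R e \<in> C" unfolding C_def by (simp add: proj)
        then show ?thesis using W(2) by blast
      qed
      show "x + t *\<^sub>R s *\<^sub>R e \<in> \<Omega>" if x: "x \<in> \<Omega> \<inter> ball y s" and t: "0 \<le> t" "t \<le> 1" for x t
      proof -
        have "0 \<le> t * s" using t s by simp
        moreover have "(x + (t * s) *\<^sub>R e) \<bullet> e = x \<bullet> e + t * s" by (simp add: inner_add_left ee)
        ultimately have "\<gamma> (x - (x \<bullet> e) *\<^sub>R e) < (x + (t * s) *\<^sub>R e) \<bullet> e"
          using above[OF x] by linarith
        moreover have "x + (t * s) *\<^sub>R e \<in> ball y R" using near[of x t] x t s by (simp add: s_def)
        ultimately have "x + (t * s) *\<^sub>R e \<in> \<Omega> \<inter> ball y R" unfolding graph by (simp add: proj)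
        then show ?thesis by simp
      qed
      show "open (\<Omega> \<inter> ball y s)" using \<Omega>(4) by auto
    qed
    then show ?thesis using s by blast
  qed
  have "\<forall>y\<in>closure \<Omega>. \<exists>s>0. good (\<Omega> \<inter> ball y s)"
  proof
    fix y assume "y \<in> closure \<Omega>"
    show "\<exists>s>0. good (\<Omega> \<inter> ball y s)"
    proof (cases "y \<in> \<Omega>")
      case True
      then obtain s where "0 < s" "good (ball y s)" using inner by blast
      then show ?thesis using good_mono[of "ball y s" "\<Omega> \<inter> ball y s"] \<Omega>(4) by auto
    next
      case False
      then show ?thesis using boundary \<open>y \<in> closure \<Omega>\<close> \<Omega>(4) by (simp add: frontier_def interior_open)
    qed
  qed
  then obtain s where s: "\<And>y. y \<in> closure \<Omega> \<Longrightarrow> 0 < s y" "\<And>y. y \<in> closure \<Omega> \<Longrightarrow> good (\<Omega> \<inter> ball y (s y))"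
    by metis
  have "compact (closure \<Omega>)" using \<Omega>(2) by simp
  moreover have "closure \<Omega> \<subseteq> (\<Union>y\<in>closure \<Omega>. ball y (s y))" using s(1) by force
  ultimately obtain F where F: "F \<subseteq> closure \<Omega>" "finite F" "closure \<Omega> \<subseteq> (\<Union>y\<in>F. ball y (s y))"
    by (rule compactE_image[OF _ open_ball])
  have "good (\<Union>y\<in>F. \<Omega> \<inter> ball y (s y))" using F s by (intro good_Union) auto
  then have "good \<Omega>"
    by (rule good_mono) (use F(3) closure_subset[of \<Omega>] \<Omega>(4) in auto)
  then obtain K where K: "0 \<le> K" "\<And>U D c. admissible U D c \<Longrightarrow>
      (\<integral>\<^sup>+x\<in>\<Omega>. ennreal (\<bar>U x - c\<bar> powr p) \<partial>lborel) \<le> ennreal K * D"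
    by (auto simp: good_def)
  show ?thesis
  proof (rule that[OF K(1)])
    fix U D assume est: "translation_estimate \<Omega> p U D"
    then obtain c where "admissible U D c" using K0(2) by (auto simp: admissible_def)
    then show "\<exists>c. (\<integral>\<^sup>+x\<in>\<Omega>. ennreal (\<bar>U x - c\<bar> powr p) \<partial>lborel) \<le> ennreal K * D" using K(2) by blast
  qed
qed

section \<open>The Poincare inequality in Sobolev spaces\<close>

lemma finite_measure_lebesgue_on_bounded_open:
  fixes \<Omega> :: "'a::euclidean_space set"
  assumes "bounded \<Omega>" "open \<Omega>"
  shows "finite_measure (lebesgue_on \<Omega>)"
  using assms by (intro finite_measure_lebesgue_on lmeasurable_open)

lemma lp_space_integrable:
  fixes \<Omega> :: "'a::euclidean_space set" and u :: "'a \<Rightarrow> 'b::euclidean_space"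
  assumes "bounded \<Omega>" "open \<Omega>" "1 \<le> p" and u: "u \<in> lp_space p \<Omega>"
  shows "integrable (lebesgue_on \<Omega>) u"
proof -
  interpret finite_measure "lebesgue_on \<Omega>"
    by (rule finite_measure_lebesgue_on_bounded_open[OF assms(1,2)])
  have "integrable (lebesgue_on \<Omega>) (\<lambda>x. 1 + norm (u x) powr p)"
    using u by (intro Bochner_Integration.integrable_add) (auto simp: lp_space_def)
  then show ?thesis
  proof (rule Bochner_Integration.integrable_bound)
    show "AE x in lebesgue_on \<Omega>. norm (u x) \<le> norm (1 + norm (u x) powr p)"
      using le_add_powr_scaled[OF norm_ge_zero zero_less_one \<open>1 \<le> p\<close>, of "u _"]
      by (intro AE_I2) (simp add: add_nonneg_nonneg)
  qed (use u in \<open>simp add: lp_space_def\<close>)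
qed

lemma lebesgue_borel_representative:
  fixes f :: "'a::euclidean_space \<Rightarrow> 'b::euclidean_space"
  assumes f: "integrable lebesgue f"
  obtains F where "F \<in> borel_measurable borel" "integrable lborel F" "AE x in lebesgue. f x = F x"
proof -
  have "\<exists>Fi\<in>borel_measurable lborel. AE x in lborel. f x \<bullet> i = Fi x" for i
    using f by (intro completion_ex_borel_measurable_real borel_measurable_inner)
      (auto intro: borel_measurable_integrable)
  then obtain Fi where Fi: "\<And>i. Fi i \<in> borel_measurable lborel" "\<And>i. AE x in lborel. f x \<bullet> i = Fi i x"
    by metis
  define F where "F x = (\<Sum>i\<in>Basis. Fi i x *\<^sub>R i)" for x
  have Fm: "F \<in> borel_measurable borel"
    using Fi(1) unfolding F_def by (intro borel_measurable_sum borel_measurable_scaleR) auto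
  have "AE x in lborel. \<forall>i\<in>Basis. f x \<bullet> i = Fi i x"
    using Fi(2) by (simp add: AE_ball_countable countable_finite)
  then have ae: "AE x in lborel. f x = F x"
  proof eventually_elim
    case (elim x)
    then have "F x = (\<Sum>i\<in>Basis. (f x \<bullet> i) *\<^sub>R i)" unfolding F_def by (intro sum.cong) auto
    then show ?case by (simp add: euclidean_representation)
  qed
  then have ae': "AE x in lebesgue. f x = F x" by (rule AE_completion)
  have "integrable lebesgue F"
    by (rule integrable_cong_AE_imp[OF f]) (use Fm ae' in \<open>auto intro: measurable_completion\<close>)
  then have "integrable lborel F" using Fm by (simp add: integrable_completion)
  with Fm ae' show ?thesis using that by blast
qed

text \<open>Extends a function and its weak gradient by zero and makes them Borel. The defining identity of the weak
  gradient then holds with integrals over the whole space, since test functions live in \<open>\<Omega>\<close>, and, by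
  linearity, for derivatives in all directions.\<close>

lemma weak_gradient_borel_representative:
  fixes \<Omega> :: "'a::euclidean_space set"
  assumes \<Omega>: "open \<Omega>" and u: "integrable (lebesgue_on \<Omega>) u" and g: "integrable (lebesgue_on \<Omega>) g"
    and ug: "weak_gradient \<Omega> u g"
  obtains U G where "U \<in> borel_measurable borel" "integrable lborel U" "AE x in lebesgue_on \<Omega>. u x = U x"
    "G \<in> borel_measurable borel" "integrable lborel G"
    "AE x in lebesgue. indicator \<Omega> x *\<^sub>R g x = G x"
    "\<And>\<phi> v. \<phi> \<in> test_functions \<Omega> \<Longrightarrow>
      (LINT x|lborel. U x * frechet_derivative \<phi> (at x) v) = - (LINT x|lborel. (G x \<bullet> v) * \<phi> x)"
proof -
  have \<Omega>m: "\<Omega> \<in> sets lebesgue" using \<Omega> by (simp add: borel_open)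
  have ui: "integrable lebesgue (\<lambda>x. indicator \<Omega> x *\<^sub>R u x)" and gi: "integrable lebesgue (\<lambda>x. indicator \<Omega> x *\<^sub>R g x)"
    using u g \<Omega>m by (simp_all add: integrable_restrict_space del: real_scaleR_def)
  obtain U where U: "U \<in> borel_measurable borel" "integrable lborel U" "AE x in lebesgue. indicator \<Omega> x *\<^sub>R u x = U x"
    using lebesgue_borel_representative[OF ui] by blast
  obtain G where G: "G \<in> borel_measurable borel" "integrable lborel G" "AE x in lebesgue. indicator \<Omega> x *\<^sub>R g x = G x"
    using lebesgue_borel_representative[OF gi] by blast
  note [measurable] = U(1) G(1)
  have transfer: "(LINT x|lebesgue_on \<Omega>. f x * \<psi> x) = (LINT x|lborel. F x * \<psi> x)"
    if F: "F \<in> borel_measurable borel" "AE x in lebesgue. indicator \<Omega> x * f x = F x"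
      and \<psi>: "\<psi> \<in> borel_measurable borel" for f F \<psi> :: "'a \<Rightarrow> real"
  proof -
    have m: "(\<lambda>x. F x * \<psi> x) \<in> borel_measurable lborel" using F \<psi> by simp
    have ml: "(\<lambda>x. F x * \<psi> x) \<in> borel_measurable lebesgue" by (rule measurable_completion[OF m])
    have ae: "AE x in lebesgue. F x * \<psi> x = indicator \<Omega> x *\<^sub>R (f x * \<psi> x)"
      using F(2) by eventually_elim (simp add: mult.assoc[symmetric])
    have "(LINT x|lebesgue_on \<Omega>. f x * \<psi> x) = (LINT x|lebesgue. indicator \<Omega> x *\<^sub>R (f x * \<psi> x))"
      using \<Omega>m by (simp add: integral_restrict_space)
    also have "\<dots> = (LINT x|lebesgue. F x * \<psi> x)"
      by (rule integral_cong_AE[symmetric, OF ml borel_measurable_AE[OF ml ae] ae])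
    also have "\<dots> = (LINT x|lborel. F x * \<psi> x)" by (rule integral_completion[OF m])
    finally show ?thesis .
  qed
  have weak: "(LINT x|lborel. U x * frechet_derivative \<phi> (at x) v) = - (LINT x|lborel. (G x \<bullet> v) * \<phi> x)"
    if \<phi>: "\<phi> \<in> test_functions \<Omega>" for \<phi> v
  proof -
    note c = test_function_continuous[OF \<phi>]
    obtain K where K: "compact K" "\<And>x. x \<notin> K \<Longrightarrow> \<phi> x = 0" "\<And>x v. x \<notin> K \<Longrightarrow> frechet_derivative \<phi> (at x) v = 0"
      using test_functionsE[OF \<phi>] by metis
    obtain B where B: "\<And>x. \<bar>\<phi> x\<bar> \<le> B"
      using bounded_compactly_supported[OF c(1) K(1,2)] by blast
    have m [measurable]: "\<phi> \<in> borel_measurable borel" "(\<lambda>x. frechet_derivative \<phi> (at x) w) \<in> borel_measurable borel" for w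
      by (intro borel_measurable_continuous_onI c)+
    have int1: "integrable lborel (\<lambda>x. U x * frechet_derivative \<phi> (at x) i)" for i
    proof -
      obtain B' where "\<And>x. \<bar>frechet_derivative \<phi> (at x) i\<bar> \<le> B'"
        using bounded_compactly_supported[OF c(2) K(1,3)] by blast
      then show ?thesis by (intro integrable_times_bounded[OF U(2)]) simp_all
    qed
    have int2: "integrable lborel (\<lambda>x. (G x \<bullet> i) * \<phi> x)" for i
      by (rule integrable_times_bounded[OF _ _ B]) (use G(2) in auto)
    have basis: "(LINT x|lborel. U x * frechet_derivative \<phi> (at x) i) = - (LINT x|lborel. (G x \<bullet> i) * \<phi> x)"
      if "i \<in> Basis" for i
    proof -
      have "AE x in lebesgue. indicator \<Omega> x * (g x \<bullet> i) = G x \<bullet> i"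
        using G(3) by eventually_elim (metis inner_scaleR_left)
      from transfer[OF _ this m(1)] transfer[OF U(1) U(3)[unfolded real_scaleR_def] m(2)[of i]]
      show ?thesis using ug \<phi> that by (simp add: weak_gradient_def)
    qed
    have D: "frechet_derivative \<phi> (at x) v = (\<Sum>i\<in>Basis. (v \<bullet> i) * frechet_derivative \<phi> (at x) i)" for x
    proof -
      have "linear (frechet_derivative \<phi> (at x))"
        using has_derivative_linear[OF test_function_derivative[OF \<phi>]] .
      then have "frechet_derivative \<phi> (at x) (\<Sum>i\<in>Basis. (v \<bullet> i) *\<^sub>R i)
          = (\<Sum>i\<in>Basis. (v \<bullet> i) * frechet_derivative \<phi> (at x) i)"
        by (simp add: linear_sum linear_cmul)
      then show ?thesis by (simp add: euclidean_representation)
    qed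
    have "(LINT x|lborel. U x * frechet_derivative \<phi> (at x) v)
        = (LINT x|lborel. (\<Sum>i\<in>Basis. (v \<bullet> i) * (U x * frechet_derivative \<phi> (at x) i)))"
      by (simp add: D sum_distrib_left mult.left_commute)
    also have "\<dots> = (\<Sum>i\<in>Basis. (v \<bullet> i) * (LINT x|lborel. U x * frechet_derivative \<phi> (at x) i))"
      using int1 by (subst Bochner_Integration.integral_sum) auto
    also have "\<dots> = (\<Sum>i\<in>Basis. (v \<bullet> i) * - (LINT x|lborel. (G x \<bullet> i) * \<phi> x))"
      using basis by (intro sum.cong) auto
    also have "\<dots> = - (\<Sum>i\<in>Basis. (v \<bullet> i) * (LINT x|lborel. (G x \<bullet> i) * \<phi> x))"
      by (simp add: sum_negf)
    also have "(\<Sum>i\<in>Basis. (v \<bullet> i) * (LINT x|lborel. (G x \<bullet> i) * \<phi> x))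
        = (LINT x|lborel. (\<Sum>i\<in>Basis. (v \<bullet> i) * ((G x \<bullet> i) * \<phi> x)))"
      using int2 by (subst Bochner_Integration.integral_sum) auto
    also have "\<dots> = (LINT x|lborel. (G x \<bullet> v) * \<phi> x)"
      by (subst euclidean_inner[of "G _" v]) (simp add: sum_distrib_right mult.assoc mult.left_commute)
    finally show ?thesis .
  qed
  have "AE x in lebesgue_on \<Omega>. u x = U x"
  proof (subst AE_restrict_space_iff)
    show "AE x in lebesgue. x \<in> \<Omega> \<longrightarrow> u x = U x" using U(3) by eventually_elim auto
  qed (use \<Omega>m in simp)
  with U G weak show ?thesis using that by blast
qed

text \<open>The translation estimate gives a constant \<open>c\<close> close to \<open>u\<close>. As \<open>u\<close> has mean zero, Jensen's inequality
  bounds \<open>c\<close> by the same distance, because \<open>c\<close> is the mean of \<open>c - u\<close>.\<close>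

theorem poincare_inequality_mean_zero:
  fixes \<Omega> :: "'a::euclidean_space set"
  assumes \<Omega>: "\<Omega> \<noteq> {}" "bounded \<Omega>" "connected \<Omega>" "open \<Omega>" "smooth_boundary \<Omega>"
    and p: "1 < p"
  obtains K where "0 \<le> K"
    "\<And>u g. u \<in> sobolev_mean_zero p \<Omega> \<Longrightarrow> g \<in> lp_space p \<Omega> \<Longrightarrow> weak_gradient \<Omega> u g \<Longrightarrow>
      (LINT x|lebesgue_on \<Omega>. \<bar>u x\<bar> powr p) \<le> K * (LINT x|lebesgue_on \<Omega>. norm (g x) powr p)"
proof -
  interpret finite_measure "lebesgue_on \<Omega>"
    by (rule finite_measure_lebesgue_on_bounded_open[OF \<Omega>(2,4)])
  have \<Omega>m: "\<Omega> \<in> sets lebesgue" using \<Omega>(4) by (simp add: borel_open)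
  obtain K :: real where K: "0 \<le> K" "\<And>U D. translation_estimate \<Omega> p U D \<Longrightarrow>
      \<exists>c. (\<integral>\<^sup>+x\<in>\<Omega>. ennreal (\<bar>U x - c\<bar> powr p) \<partial>lborel) \<le> ennreal K * D"
    using poincare_of_translation_estimate[OF \<Omega>, of p] p by auto
  show ?thesis
  proof (rule that[of "2 powr p * (2 * K)"])
    fix u g assume u: "u \<in> sobolev_mean_zero p \<Omega>" and g: "g \<in> lp_space p \<Omega>" and ug: "weak_gradient \<Omega> u g"
    have ulp: "u \<in> lp_space p \<Omega>" and mean: "(LINT x|lebesgue_on \<Omega>. u x) = 0"
      using u by (auto simp: sobolev_mean_zero_def sobolev_space_def)
    have um [measurable]: "u \<in> borel_measurable (lebesgue_on \<Omega>)"
      and up: "integrable (lebesgue_on \<Omega>) (\<lambda>x. norm (u x) powr p)"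
      and gp: "integrable (lebesgue_on \<Omega>) (\<lambda>x. norm (g x) powr p)"
      using ulp g by (auto simp: lp_space_def)
    have ui: "integrable (lebesgue_on \<Omega>) u" and gi: "integrable (lebesgue_on \<Omega>) g"
      using lp_space_integrable[OF \<Omega>(2,4) less_imp_le[OF p]] ulp g by blast+
    obtain U G where U: "U \<in> borel_measurable borel" "integrable lborel U" "AE x in lebesgue_on \<Omega>. u x = U x"
      and G: "G \<in> borel_measurable borel" "integrable lborel G" "AE x in lebesgue. indicator \<Omega> x *\<^sub>R g x = G x"
      and weak: "\<And>\<phi> v. \<phi> \<in> test_functions \<Omega> \<Longrightarrow>
        (LINT x|lborel. U x * frechet_derivative \<phi> (at x) v) = - (LINT x|lborel. (G x \<bullet> v) * \<phi> x)"
      using weak_gradient_borel_representative[OF \<Omega>(4) ui gi ug] by blast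
    define I where "I = (LINT x|lebesgue_on \<Omega>. norm (g x) powr p)"
    have I0: "0 \<le> I" by (simp add: I_def)
    have "(\<integral>\<^sup>+x. ennreal (norm (G x) powr p) \<partial>lborel) = (\<integral>\<^sup>+x. ennreal (norm (G x) powr p) \<partial>lebesgue)"
      by (simp add: nn_integral_completion)
    also have "\<dots> = (\<integral>\<^sup>+x. ennreal (norm (g x) powr p) * indicator \<Omega> x \<partial>lebesgue)"
    proof (rule nn_integral_cong_AE, use G(3) in eventually_elim)
      case (elim x)
      then show ?case by (cases "x \<in> \<Omega>") auto
    qed
    also have "\<dots> = (\<integral>\<^sup>+x. ennreal (norm (g x) powr p) \<partial>lebesgue_on \<Omega>)"
      using \<Omega>m by (simp add: nn_integral_restrict_space)
    also have "\<dots> = ennreal I" unfolding I_def using gp by (intro nn_integral_eq_integral) auto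
    finally have GI: "(\<integral>\<^sup>+x. ennreal (norm (G x) powr p) \<partial>lborel) = ennreal I" .
    have "translation_estimate \<Omega> p U (ennreal I)"
      unfolding translation_estimate_def GI[symmetric]
    proof (intro conjI allI impI U(1))
      fix V :: "'a set" and h assume "open V \<and> (\<forall>x\<in>V. \<forall>t\<in>{0..1}. x + t *\<^sub>R h \<in> \<Omega>)"
      then show "(\<integral>\<^sup>+x\<in>V. ennreal (\<bar>U (x + h) - U x\<bar> powr p) \<partial>lborel)
          \<le> ennreal (norm h powr p) * (\<integral>\<^sup>+x. ennreal (norm (G x) powr p) \<partial>lborel)"
        by (intro weak_gradient_translation_estimate[OF p _ _ U(2) G(2) weak, where \<Omega> = \<Omega>]) auto
    qed
    then obtain c where c: "(\<integral>\<^sup>+x\<in>\<Omega>. ennreal (\<bar>U x - c\<bar> powr p) \<partial>lborel) \<le> ennreal K * ennreal I"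
      using K(2) by blast
    have ucp: "integrable (lebesgue_on \<Omega>) (\<lambda>x. norm (c - u x) powr p)"
      using integrable_powr_norm_add[of p "\<lambda>_. c" "lebesgue_on \<Omega>" "\<lambda>x. - u x"] p up by simp
    define J where "J = (LINT x|lebesgue_on \<Omega>. norm (c - u x) powr p)"
    have "ennreal J = (\<integral>\<^sup>+x. ennreal (norm (c - u x) powr p) \<partial>lebesgue_on \<Omega>)"
      unfolding J_def using ucp by (intro nn_integral_eq_integral[symmetric]) auto
    also have "\<dots> = (\<integral>\<^sup>+x. ennreal (\<bar>U x - c\<bar> powr p) \<partial>lebesgue_on \<Omega>)"
    proof (rule nn_integral_cong_AE, use U(3) in eventually_elim)
      case (elim x)
      then show ?case by (simp add: abs_minus_commute)
    qed
    also have "\<dots> = (\<integral>\<^sup>+x\<in>\<Omega>. ennreal (\<bar>U x - c\<bar> powr p) \<partial>lebesgue)"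
      using \<Omega>m by (simp add: nn_integral_restrict_space)
    also have "\<dots> = (\<integral>\<^sup>+x\<in>\<Omega>. ennreal (\<bar>U x - c\<bar> powr p) \<partial>lborel)"
      by (rule nn_integral_completion)
    finally have "ennreal J \<le> ennreal (K * I)" using c K(1) by (simp add: ennreal_mult')
    then have J: "J \<le> K * I" using K(1) I0 by (simp add: ennreal_le_iff)
    \<comment> \<open>Jensen's inequality; the linear term integrates to zero since \<open>u\<close> has mean zero.\<close>
    have "(LINT x|lebesgue_on \<Omega>. norm c powr p) = (LINT x|lebesgue_on \<Omega>. norm c powr p + p * (duality_map p c \<bullet> (c - u x - c)))"
      using ui mean by simp
    also have "\<dots> \<le> J"
      unfolding J_def using ui ucp powr_norm_subgradient[OF p, of c "c - u _"]
      by (intro integral_mono) auto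
    finally have cJ: "(LINT x|lebesgue_on \<Omega>. norm c powr p) \<le> J" .
    have "(LINT x|lebesgue_on \<Omega>. norm (u x) powr p)
        \<le> (LINT x|lebesgue_on \<Omega>. 2 powr p * (norm c powr p + norm (c - u x) powr p))"
    proof (rule integral_mono[OF up])
      show "integrable (lebesgue_on \<Omega>) (\<lambda>x. 2 powr p * (norm c powr p + norm (c - u x) powr p))"
        using ucp by auto
      show "norm (u x) powr p \<le> 2 powr p * (norm c powr p + norm (c - u x) powr p)" for x
        using norm_add_powr_le[of p c "u x - c"] p by (simp add: abs_minus_commute)
    qed
    also have "\<dots> = 2 powr p * ((LINT x|lebesgue_on \<Omega>. norm c powr p) + J)"
      using ucp by (simp add: J_def)
    also have "\<dots> \<le> 2 powr p * (K * I + K * I)"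
      using cJ J by (intro mult_left_mono add_mono) auto
    finally show "(LINT x|lebesgue_on \<Omega>. \<bar>u x\<bar> powr p) \<le> 2 powr p * (2 * K) * (LINT x|lebesgue_on \<Omega>. norm (g x) powr p)"
      by (simp add: I_def mult.assoc)
  qed (use K(1) in simp)
qed

section \<open>Surjectivity of the operator \<open>B\<close>\<close>

text \<open>The chosen gradient \<open>wgrad \<Omega> u\<close> is a priori only locally integrable. Being equal to \<open>g\<close> almost
  everywhere, it is measurable because the Lebesgue measure is complete.\<close>

lemma wgrad_AE_eq:
  assumes "open \<Omega>" "weak_gradient \<Omega> u g" and g: "g \<in> borel_measurable (lebesgue_on \<Omega>)"
  shows "AE x in lebesgue_on \<Omega>. wgrad \<Omega> u x = g x" "wgrad \<Omega> u \<in> borel_measurable (lebesgue_on \<Omega>)"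
proof -
  have "weak_gradient \<Omega> u (wgrad \<Omega> u)" unfolding wgrad_def
    by (rule someI[of "weak_gradient \<Omega> u" g, OF assms(2)])
  from weak_gradient_unique[OF assms(1) this assms(2)]
  show ae: "AE x in lebesgue_on \<Omega>. wgrad \<Omega> u x = g x" .
  have \<Omega>m: "\<Omega> \<in> sets lebesgue" using assms(1) by (simp add: borel_open)
  have gm: "(\<lambda>x. indicator \<Omega> x *\<^sub>R g x) \<in> borel_measurable lebesgue"
    using g \<Omega>m by (simp add: borel_measurable_restrict_space_iff)
  have "AE x in lebesgue. x \<in> \<Omega> \<longrightarrow> wgrad \<Omega> u x = g x"
    using ae \<Omega>m by (simp add: AE_restrict_space_iff)
  then have "AE x in lebesgue. indicator \<Omega> x *\<^sub>R g x = indicator \<Omega> x *\<^sub>R wgrad \<Omega> u x"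
    by eventually_elim (auto simp: indicator_def)
  from borel_measurable_AE[OF gm this]
  show "wgrad \<Omega> u \<in> borel_measurable (lebesgue_on \<Omega>)"
    using \<Omega>m by (simp add: borel_measurable_restrict_space_iff)
qed

lemma lp_space_lincomb:
  fixes u v :: "'a::euclidean_space \<Rightarrow> 'b::euclidean_space"
  assumes "0 \<le> p" and u: "u \<in> lp_space p \<Omega>" and v: "v \<in> lp_space p \<Omega>"
  shows "(\<lambda>x. a *\<^sub>R u x + b *\<^sub>R v x) \<in> lp_space p \<Omega>"
proof -
  have m [measurable]: "u \<in> borel_measurable (lebesgue_on \<Omega>)" "v \<in> borel_measurable (lebesgue_on \<Omega>)"
    using u v by (auto simp: lp_space_def)
  have "integrable (lebesgue_on \<Omega>) (\<lambda>x. norm (a *\<^sub>R u x + b *\<^sub>R v x) powr p)"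
    using u v by (intro integrable_powr_norm_add assms(1) integrable_powr_norm_scale) (auto simp: lp_space_def)
  then show ?thesis by (simp add: lp_space_def)
qed

lemma sobolev_mean_zero_lincomb:
  fixes \<Omega> :: "'a::euclidean_space set"
  assumes \<Omega>: "bounded \<Omega>" "open \<Omega>" and p: "1 \<le> p"
    and u: "u \<in> sobolev_mean_zero p \<Omega>" and v: "v \<in> sobolev_mean_zero p \<Omega>"
  shows "(\<lambda>x. a * u x + b * v x) \<in> sobolev_mean_zero p \<Omega>"
proof -
  have uv: "u \<in> lp_space p \<Omega>" "v \<in> lp_space p \<Omega>"
    using u v by (auto simp: sobolev_mean_zero_def sobolev_space_def)
  obtain g h where g: "g \<in> lp_space p \<Omega>" "weak_gradient \<Omega> u g" and h: "h \<in> lp_space p \<Omega>" "weak_gradient \<Omega> v h"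
    using u v by (auto simp: sobolev_mean_zero_def sobolev_space_def)
  have "(\<lambda>x. a * u x + b * v x) \<in> lp_space p \<Omega>"
    using lp_space_lincomb[OF _ uv, of a b] p by simp
  moreover have "\<exists>g\<in>lp_space p \<Omega>. weak_gradient \<Omega> (\<lambda>x. a * u x + b * v x) g"
    using lp_space_lincomb[OF _ g(1) h(1), of a b] weak_gradient_lincomb[OF \<Omega>(2) g(2) h(2), of a b] p by auto
  moreover have "(LINT x|lebesgue_on \<Omega>. a * u x + b * v x) = 0"
    using u v lp_space_integrable[OF \<Omega> p uv(1)] lp_space_integrable[OF \<Omega> p uv(2)]
    by (simp add: sobolev_mean_zero_def)
  ultimately show ?thesis by (simp add: sobolev_mean_zero_def sobolev_space_def)
qed

text \<open>The gradients of functions in the test space form a subspace of \<open>L\<^sup>p\<close>, and the Poincare inequality turns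
  the bound of \<open>S u\<close> by the Sobolev norm of \<open>u\<close> into a bound by the \<open>L\<^sup>p\<close> norm of its gradient. So \<open>S\<close> is a
  bounded functional of the gradient, represented by some \<open>L\<^sup>q\<close> field; \<open>w\<close> is its negative.\<close>

theorem op_B_surjective:
  fixes \<Omega> :: "'a::euclidean_space set"
  assumes \<Omega>: "\<Omega> \<noteq> {}" "bounded \<Omega>" "connected \<Omega>" "open \<Omega>" "smooth_boundary \<Omega>"
    and q: "2 \<le> q"
    and S: "S \<in> dual_space (test_space q \<Omega>) (sobolev_norm (conj_exp q) \<Omega>)"
  obtains w where "w \<in> lp_space q \<Omega>" "op_B q \<Omega> w = S"
proof -
  define p where "p = conj_exp q"
  have p: "1 < p" "p \<le> 2" "q = p / (p - 1)"
    using q by (auto simp: p_def conj_exp_def field_simps)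
  let ?V = "sobolev_mean_zero p \<Omega>"
  have fin: "finite_measure (lebesgue_on \<Omega>)"
    by (rule finite_measure_lebesgue_on_bounded_open[OF \<Omega>(2,4)])
  have S_ext: "S \<in> extensional ?V"
    and S_lin: "\<And>u v a b. u \<in> ?V \<Longrightarrow> v \<in> ?V \<Longrightarrow> S (\<lambda>x. a * u x + b * v x) = a * S u + b * S v"
    and "\<exists>C. \<forall>u\<in>?V. \<bar>S u\<bar> \<le> C * sobolev_norm p \<Omega> u"
    using S unfolding dual_space_def p_def by blast+
  then obtain C where C: "\<And>u. u \<in> ?V \<Longrightarrow> \<bar>S u\<bar> \<le> C * sobolev_norm p \<Omega> u" by blast
  obtain K where K: "0 \<le> K"
    "\<And>u g. u \<in> ?V \<Longrightarrow> g \<in> lp_space p \<Omega> \<Longrightarrow> weak_gradient \<Omega> u g \<Longrightarrow>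
      (LINT x|lebesgue_on \<Omega>. \<bar>u x\<bar> powr p) \<le> K * (LINT x|lebesgue_on \<Omega>. norm (g x) powr p)"
    using poincare_inequality_mean_zero[OF \<Omega> p(1)] by blast
  define X where "X = {(S u, g) |u g. u \<in> ?V \<and> g \<in> lp_space p \<Omega> \<and> weak_gradient \<Omega> u g}"
  have bound: "\<bar>l\<bar> \<le> (\<bar>C\<bar> * (K + 1) powr (1 / p)) * (LINT x|lebesgue_on \<Omega>. norm (g x) powr p) powr (1 / p)"
    if "(l, g) \<in> X" for l g
  proof -
    obtain u where u: "u \<in> ?V" "l = S u" and g: "g \<in> lp_space p \<Omega>" "weak_gradient \<Omega> u g"
      using \<open>(l, g) \<in> X\<close> by (auto simp: X_def)
    let ?I = "LINT x|lebesgue_on \<Omega>. norm (g x) powr p"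
    have gm [measurable]: "g \<in> borel_measurable (lebesgue_on \<Omega>)" using g by (simp add: lp_space_def)
    note wg = wgrad_AE_eq[OF \<Omega>(4) g(2) gm]
    note [measurable] = wg(2)
    have "(LINT x|lebesgue_on \<Omega>. norm (wgrad \<Omega> u x) powr p) = ?I"
      by (rule integral_cong_AE) (use wg(1) in \<open>auto elim!: AE_mp\<close>)
    then have "(LINT x|lebesgue_on \<Omega>. \<bar>u x\<bar> powr p) + (LINT x|lebesgue_on \<Omega>. norm (wgrad \<Omega> u x) powr p) \<le> (K + 1) * ?I"
      using K(2)[OF u(1) g] by (simp add: distrib_right)
    then have "sobolev_norm p \<Omega> u \<le> ((K + 1) * ?I) powr (1 / p)"
      unfolding sobolev_norm_def using p by (intro powr_mono2 add_nonneg_nonneg integral_nonneg) auto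
    also have "\<dots> = (K + 1) powr (1 / p) * ?I powr (1 / p)" by (rule powr_mult)
    finally have N: "sobolev_norm p \<Omega> u \<le> (K + 1) powr (1 / p) * ?I powr (1 / p)" .
    have "\<bar>l\<bar> \<le> C * sobolev_norm p \<Omega> u" using C[OF u(1)] u(2) by simp
    also have "\<dots> \<le> \<bar>C\<bar> * sobolev_norm p \<Omega> u"
      by (intro mult_right_mono) (auto simp: sobolev_norm_def)
    also have "\<dots> \<le> \<bar>C\<bar> * ((K + 1) powr (1 / p) * ?I powr (1 / p))"
      by (intro mult_left_mono N) auto
    finally show ?thesis by (simp add: mult.assoc)
  qed
  have lin: "(a * l + b * l', \<lambda>x. a *\<^sub>R g x + b *\<^sub>R g' x) \<in> X" if X: "(l, g) \<in> X" "(l', g') \<in> X" for l l' g g' a b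
  proof -
    obtain u where u: "u \<in> ?V" "l = S u" and g: "g \<in> lp_space p \<Omega>" "weak_gradient \<Omega> u g"
      using X(1) by (auto simp: X_def)
    obtain v where v: "v \<in> ?V" "l' = S v" and g': "g' \<in> lp_space p \<Omega>" "weak_gradient \<Omega> v g'"
      using X(2) by (auto simp: X_def)
    have "a * l + b * l' = S (\<lambda>x. a * u x + b * v x)" using S_lin[OF u(1) v(1), of a b] u(2) v(2) by simp
    moreover have "(\<lambda>x. a * u x + b * v x) \<in> ?V"
      using sobolev_mean_zero_lincomb[OF \<Omega>(2,4) _ u(1) v(1)] p by simp
    moreover have "(\<lambda>x. a *\<^sub>R g x + b *\<^sub>R g' x) \<in> lp_space p \<Omega>"
      using lp_space_lincomb[OF _ g(1) g'(1)] p by simp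
    ultimately show ?thesis
      using weak_gradient_lincomb[OF \<Omega>(4) g(2) g'(2), of a b] unfolding X_def by blast
  qed
  have meas: "g \<in> borel_measurable (lebesgue_on \<Omega>)"
    and int: "integrable (lebesgue_on \<Omega>) (\<lambda>x. norm (g x) powr p)" if "(l, g) \<in> X" for l g
    using that by (auto simp: X_def lp_space_def)
  obtain w where w: "w \<in> borel_measurable (lebesgue_on \<Omega>)"
    "integrable (lebesgue_on \<Omega>) (\<lambda>x. norm (w x) powr q)"
    "\<And>l g. (l, g) \<in> X \<Longrightarrow> l = (LINT x|lebesgue_on \<Omega>. w x \<bullet> g x)"
    by (rule bounded_functional_on_Lp_subspace[OF fin p lin meas int bound]) blast+
  note [measurable] = w(1)
  show ?thesis
  proof (rule that[of "\<lambda>x. - w x"])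
    show "(\<lambda>x. - w x) \<in> lp_space q \<Omega>" using w by (simp add: lp_space_def)
    show "op_B q \<Omega> (\<lambda>x. - w x) = S"
    proof (rule extensionalityI[of _ ?V])
      show "op_B q \<Omega> (\<lambda>x. - w x) \<in> extensional ?V" by (simp add: op_B_def p_def)
      fix u assume u: "u \<in> ?V"
      then obtain g where g: "g \<in> lp_space p \<Omega>" "weak_gradient \<Omega> u g"
        by (auto simp: sobolev_mean_zero_def sobolev_space_def)
      have gm [measurable]: "g \<in> borel_measurable (lebesgue_on \<Omega>)" using g by (simp add: lp_space_def)
      note wg = wgrad_AE_eq[OF \<Omega>(4) g(2) gm]
      note [measurable] = wg(2)
      have "op_B q \<Omega> (\<lambda>x. - w x) u = (LINT x|lebesgue_on \<Omega>. w x \<bullet> wgrad \<Omega> u x)"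
        using u by (simp add: op_B_def p_def)
      also have "\<dots> = (LINT x|lebesgue_on \<Omega>. w x \<bullet> g x)"
        by (rule integral_cong_AE) (use wg(1) in \<open>auto elim!: AE_mp\<close>)
      also have "\<dots> = S u" by (rule w(3)[symmetric]) (use u g X_def in blast)
      finally show "op_B q \<Omega> (\<lambda>x. - w x) u = S u" .
    qed (rule S_ext)
  qed
qed

section \<open>Constant densities and the constraint qualification\<close>

lemma const_in_C_closure: "(\<lambda>x\<in>closure \<Omega>. a) \<in> mspace (C_closure \<Omega>)"
proof -
  have "continuous_on (closure \<Omega>) (\<lambda>x\<in>closure \<Omega>. a)"
    by (rule continuous_on_eq[OF continuous_on_const[of _ a]]) simp
  moreover have "bounded ((\<lambda>x\<in>closure \<Omega>. a) ` closure \<Omega>)"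
    by (rule bounded_subset[of "{a}"]) auto
  ultimately show ?thesis by simp
qed

text \<open>A continuous function that equals \<open>a\<close> almost everywhere on an open set equals \<open>a\<close> on this set and on its
  closure.\<close>

lemma sobolev_injection_const:
  fixes \<Omega> :: "'a::euclidean_space set"
  assumes "open \<Omega>"
  shows "sobolev_injection \<Omega> (\<lambda>_. a) = (\<lambda>x\<in>closure \<Omega>. a)"
  unfolding sobolev_injection_def
proof (rule the_equality)
  have "AE x in lebesgue_on \<Omega>. (\<lambda>x\<in>closure \<Omega>. a) x = a"
    using closure_subset[of \<Omega>] by (intro AE_I2) auto
  then show "(\<lambda>x\<in>closure \<Omega>. a) \<in> mspace (C_closure \<Omega>) \<and> (AE x in lebesgue_on \<Omega>. (\<lambda>x\<in>closure \<Omega>. a) x = a)"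
    using const_in_C_closure by blast
  fix z assume z: "z \<in> mspace (C_closure \<Omega>) \<and> (AE x in lebesgue_on \<Omega>. z x = a)"
  then have zc: "continuous_on (closure \<Omega>) z" and ze: "z \<in> extensional (closure \<Omega>)"
    and ae: "AE x in lebesgue_on \<Omega>. z x = a" by auto
  have eq: "z x = a" if x: "x \<in> \<Omega>" for x
  proof (rule ccontr)
    assume "z x \<noteq> a"
    let ?T = "\<Omega> \<inter> z -` (- {a})"
    have "open ?T"
      by (rule continuous_open_preimage[OF continuous_on_subset[OF zc closure_subset] assms]) auto
    moreover have "?T \<noteq> {}" using x \<open>z x \<noteq> a\<close> by auto
    ultimately have "\<not> negligible ?T" by (rule open_not_negligible)
    moreover have "negligible ?T"
    proof -
      have "AE x in lebesgue. x \<in> \<Omega> \<longrightarrow> z x = a"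
        using ae assms by (simp add: AE_restrict_space_iff borel_open)
      then have "AE x in lebesgue. x \<notin> ?T" by eventually_elim auto
      then show ?thesis
        using \<open>open ?T\<close> by (simp add: negligible_iff_null_sets AE_iff_null_sets borel_open)
    qed
    ultimately show False by blast
  qed
  have "z x = a" if "x \<in> closure \<Omega>" for x
    by (rule continuous_constant_on_closure[OF zc eq that])
  then show "z = (\<lambda>x\<in>closure \<Omega>. a)"
    using ze by (intro extensionalityI[of _ "closure \<Omega>"]) auto
qed

lemma const_in_energy_domain:
  fixes \<Omega> :: "'a::euclidean_space set"
  assumes \<Omega>: "bounded \<Omega>" "open \<Omega>" and a: "0 < a" and q: "0 < q" and w: "w \<in> lp_space q \<Omega>"
  shows "((\<lambda>_. a), w) \<in> energy_domain q f \<Omega>"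
proof -
  interpret finite_measure "lebesgue_on \<Omega>"
    by (rule finite_measure_lebesgue_on_bounded_open[OF \<Omega>])
  have "(\<lambda>_. a) \<in> lp_space q \<Omega>" "(\<lambda>_. 0) \<in> lp_space q \<Omega>" by (auto simp: lp_space_def)
  then have m: "(\<lambda>_. a) \<in> sobolev_space q \<Omega>"
    using weak_gradient_const[OF \<Omega>(2), of a] by (auto simp: sobolev_space_def)
  define k where "k = 1 / q / a powr (q - 1)"
  have "ell q a (w x) = ennreal (k * norm (w x) powr q)" for x
    using a by (simp add: ell_def k_def)
  moreover have "integrable (lebesgue_on \<Omega>) (\<lambda>x. k * norm (w x) powr q)"
    using w by (auto simp: lp_space_def)
  moreover have "0 \<le> k * norm (w x) powr q" for x using q by (simp add: k_def)
  ultimately have "(\<integral>\<^sup>+x. ell q a (w x) \<partial>lebesgue_on \<Omega>) = ennreal (LINT x|lebesgue_on \<Omega>. k * norm (w x) powr q)"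
    by (simp add: nn_integral_eq_integral)
  then have "kinetic_energy q \<Omega> (\<lambda>_. a) w < \<infinity>"
    using q by (simp add: kinetic_energy_def enn2ereal_ennreal k_def)
  then have "total_energy q f \<Omega> (\<lambda>_. a) w < \<infinity>"
    by (simp add: total_energy_def)
  with m w show ?thesis by (simp add: energy_domain_def)
qed


lemma op_A_const:
  assumes "open \<Omega>" "\<phi> \<in> test_space q \<Omega>"
  shows "op_A q \<Omega> (\<lambda>_. a) \<phi> = 0"
proof -
  have "AE x in lebesgue_on \<Omega>. wgrad \<Omega> (\<lambda>_. a) x = 0"
    by (rule wgrad_AE_eq(1)[OF assms(1) weak_gradient_const[OF assms(1)]]) simp
  then have "(LINT x|lebesgue_on \<Omega>. wgrad \<Omega> (\<lambda>_. a) x \<bullet> wgrad \<Omega> \<phi> x) = 0"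
    by (intro integral_eq_zero_AE) (auto elim!: AE_mp)
  then show ?thesis using assms(2) by (simp add: op_A_def)
qed

lemma zero_in_dual_space:
  fixes \<Omega> :: "'a::euclidean_space set"
  assumes "bounded \<Omega>" "open \<Omega>" "1 \<le> p"
  shows "(\<lambda>\<phi>\<in>sobolev_mean_zero p \<Omega>. 0) \<in> dual_space (sobolev_mean_zero p \<Omega>) N"
  unfolding dual_space_def
  using sobolev_mean_zero_lincomb[OF assms] by (auto intro!: exI[of _ 0])

theorem lemma3p2:
  fixes \<Omega> :: "(real ^ 'd) set" and f :: "real ^ 'd \<Rightarrow> real \<Rightarrow> real" and q :: real
  assumes "2 \<le> CARD('d)"
    and "\<Omega> \<noteq> {}" and "bounded \<Omega>" and "connected \<Omega>" and "open \<Omega>"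
    and "smooth_boundary \<Omega>" and "uniform_interior_ball \<Omega>"
    and "measure lebesgue \<Omega> > 1"
    and "continuous_on (closure \<Omega> \<times> UNIV) (\<lambda>(x, s). f x s)"
    and "\<And>x. x \<in> closure \<Omega> \<Longrightarrow> mono (f x)"
    and "q > real CARD('d)"
  shows "Y_zero q \<Omega> \<in> Y_topology q \<Omega> interior_of
           {Y_diff q \<Omega> y k | y k. y \<in> op_G q \<Omega> ` energy_domain q f \<Omega> \<and> k \<in> constraint_K q \<Omega>}"
    (is "_ \<in> _ interior_of ?R")
proof -
  note \<Omega> = \<open>\<Omega> \<noteq> {}\<close> \<open>bounded \<Omega>\<close> \<open>connected \<Omega>\<close> \<open>open \<Omega>\<close> \<open>smooth_boundary \<Omega>\<close>
  have q: "2 < q" using assms(1,11) by linarith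
  define p where "p = conj_exp q"
  have p: "1 \<le> p" using q by (simp add: p_def conj_exp_def le_divide_eq)
  define v where "v = measure lebesgue \<Omega>"
  have v: "1 < v" using assms(8) by (simp add: v_def)
  have int_const: "(LINT x|lebesgue_on \<Omega>. a) = a * v" for a
    using \<Omega>(4) by (simp add: v_def measure_restrict_space space_restrict_space borel_open mult.commute)
  \<comment> \<open>The constant density \<open>(1 + a) / v\<close> stays below \<open>1 - \<epsilon>\<close> as long as \<open>\<bar>a\<bar> \<le> \<epsilon>\<close>.\<close>
  define \<epsilon> where "\<epsilon> = (v - 1) / (v + 1)"
  have \<epsilon>: "0 < \<epsilon>" "\<epsilon> < 1" using v by (auto simp: \<epsilon>_def field_simps)
  have "v + 1 \<noteq> 0" using v by simp
  then have "1 + \<epsilon> = 2 * v / (v + 1)" "1 - \<epsilon> = 2 / (v + 1)"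
    by (simp_all add: \<epsilon>_def field_simps)
  then have \<epsilon>3: "(1 + \<epsilon>) / v = 1 - \<epsilon>" using v by simp
  let ?D = "dual_metric (sobolev_mean_zero p \<Omega>) (sobolev_norm p \<Omega>)"
  let ?C = "C_closure \<Omega>"
  let ?z = "(\<lambda>x\<in>closure \<Omega>. 0) :: real ^ 'd \<Rightarrow> real"
  interpret C: Metric_space "mspace ?C" "mdist ?C" by (rule Metric_space_mspace_mdist)
  have D: "mspace ?D = dual_space (sobolev_mean_zero p \<Omega>) (sobolev_norm p \<Omega>)"
    by (rule mspace_dual_metric) (simp add: sobolev_norm_def)
  \<comment> \<open>The first component is unrestricted because \<open>op_B\<close> is onto.\<close>
  define T where "T = mspace ?D \<times> {- \<epsilon><..<\<epsilon>} \<times> C.mball ?z \<epsilon>"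
  have "openin (mtopology_of ?D) (mspace ?D)"
    using openin_topspace[of "mtopology_of ?D"] by (simp only: topspace_mtopology_of)
  moreover have "openin (mtopology_of ?C) (C.mball ?z \<epsilon>)"
    unfolding mtopology_of_def by (rule C.openin_mball)
  ultimately have "openin (Y_topology q \<Omega>) T"
    unfolding Y_topology_def p_def[symmetric] T_def openin_prod_Times_iff by simp
  moreover have "Y_zero q \<Omega> \<in> T"
    using \<epsilon>(1) zero_in_dual_space[OF \<Omega>(2,4) p] const_in_C_closure[where \<Omega> = \<Omega> and a = 0]
    by (simp add: Y_zero_def T_def D p_def[symmetric] del: mspace_cfunspace)
  moreover have "T \<subseteq> ?R"
  proof
    fix y assume "y \<in> T"
    then obtain S a z where y: "y = (S, a, z)" and S: "S \<in> dual_space (sobolev_mean_zero p \<Omega>) (sobolev_norm p \<Omega>)"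
      and a: "- \<epsilon> < a" "a < \<epsilon>" and z: "z \<in> mspace ?C" "mdist ?C ?z z < \<epsilon>"
      unfolding T_def D by (auto simp del: mspace_cfunspace)
    have z_le: "\<bar>z x\<bar> \<le> \<epsilon>" if "x \<in> closure \<Omega>" for x
      using mdist_cfunspace_imp_mdist_le[OF const_in_C_closure z(1) less_imp_le[OF z(2)], of x] that
      by (simp add: dist_real_def)
    define b where "b = (1 + a) / v"
    have b: "0 < b" using a \<epsilon>(2) v by (simp add: b_def)
    have "b \<le> (1 + \<epsilon>) / v" unfolding b_def using a v by (intro divide_right_mono) auto
    then have b_le: "b \<le> 1 - \<epsilon>" by (simp add: \<epsilon>3)
    obtain w where w: "w \<in> lp_space q \<Omega>" "op_B q \<Omega> w = S"
      using op_B_surjective[OF \<Omega> less_imp_le[OF q] S[unfolded p_def]] by blast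
    define c where "c = (\<lambda>x\<in>closure \<Omega>. b - z x)"
    have zc: "continuous_on (closure \<Omega>) z" and ze: "z \<in> extensional (closure \<Omega>)" using z(1) by auto
    have "c \<in> mspace ?C"
    proof -
      have "continuous_on (closure \<Omega>) c"
        by (rule continuous_on_eq[OF continuous_on_diff[OF continuous_on_const[of _ b] zc]]) (simp add: c_def)
      moreover from this have "bounded (c ` closure \<Omega>)"
        using \<Omega>(2) by (intro compact_imp_bounded compact_continuous_image) auto
      ultimately show ?thesis by (simp add: c_def)
    qed
    then have k: "((\<lambda>\<phi>\<in>test_space q \<Omega>. 0), 0, c) \<in> constraint_K q \<Omega>"
      using b_le z_le by (force simp: constraint_K_def upper_bound_C_def c_def simp del: mspace_cfunspace)
    have m: "((\<lambda>_. b), w) \<in> energy_domain q f \<Omega>"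
      using const_in_energy_domain[OF \<Omega>(2,4) b _ w(1)] q by simp
    have "(\<lambda>\<phi>\<in>test_space q \<Omega>. op_A q \<Omega> (\<lambda>_. b) \<phi> + op_B q \<Omega> w \<phi>) = S"
      using S op_A_const[OF \<Omega>(4), of _ q b] w(2)
      by (intro extensionalityI[of _ "test_space q \<Omega>"]) (auto simp: dual_space_def p_def)
    moreover have "(\<lambda>\<phi>\<in>test_space q \<Omega>. S \<phi> - (\<lambda>\<phi>\<in>test_space q \<Omega>. 0) \<phi>) = S"
      using S by (intro extensionalityI[of _ "test_space q \<Omega>"]) (auto simp: dual_space_def p_def)
    moreover have "(\<lambda>x\<in>closure \<Omega>. (\<lambda>x\<in>closure \<Omega>. b) x - c x) = z"
      using ze by (intro extensionalityI[of _ "closure \<Omega>"]) (auto simp: c_def)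
    moreover have "b * v - 1 = a" using v by (simp add: b_def)
    ultimately have "y = Y_diff q \<Omega> (op_G q \<Omega> ((\<lambda>_. b), w)) ((\<lambda>\<phi>\<in>test_space q \<Omega>. 0), 0, c)"
      by (simp add: y sobolev_injection_const[OF \<Omega>(4)] int_const del: lebesgue_integral_const)
    then show "y \<in> ?R" using k m by blast
  qed
  ultimately show ?thesis unfolding interior_of_def by blast
qed

end
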